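(* Let $0\le\delta<\frac12$, let $a\in S_\delta$, and let $(x_0,\xi_0)\in \mathrm{ess}\text{-}\mathrm{supp}(a)$. Then there exists a family of points $(x_h,\xi_h)\in T^*\mathbb{R}^n$, $0<h<h_0$, such that for every $\phi\in\mathscr{S}(\mathbb{R}^n)$ with $\phi\not\equiv 0$ whose Fourier transform is nonnegative and has compact support, \[ (x_0,\xi_0)\in \mathrm{WF}_h\bigl(Op_{1,h}(a)\,\phi_{x_h,\xi_h,h}\bigr). \] (The family $(x_h,\xi_h)$ does not depend on $\phi$.)
   Context: Here $h\in(0,h_0)$ is a small semiclassical parameter, with $h_0>0$ fixed, and $T^*\mathbb{R}^n=\mathbb{R}^n_x\times\mathbb{R}^n_\xi$. $\mathcal{O}(h^\infty)$ means $\mathcal{O}(h^N)$ as $h\to0$ for every $N$. Symbol classes: for $\delta\ge0$, $S_\delta$ is the set of families $a(x,\xi;h)$, $0<h<h_0$, of complex-valued functions with $a(\cdot,\cdot;h)\in C^\infty(T^*\mathbb{R}^n)$ such that for all multi-indices $\alpha,\beta$ there is $C_{\alpha,\beta}$ (independent of $h$) with $|\partial_x^\alpha\partial_\xi^\beta a(x,\xi;h)|\le C_{\alpha,\beta}h^{-\delta(|\alpha|+|\beta|)}$ everywhere. Put $S=S_0$. Quantization: for $t\in[0,1]$, \[Op_{t,h}(a)u(x)=(2\pi h)^{-n}\iint a(tx+(1-t)y,\xi;h)e^{i\langle x-y,\xi\rangle/h}u(y)\,dy\,d\xi\] (an oscillatory integral for $u\in\mathscr{S}(\mathbb{R}^n)$;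 for $a\in S_\delta$, $0\le\delta<\frac12$, it extends to bounded operators on $L^2(\mathbb{R}^n)$ with norm bounded uniformly in $h$). In particular $Op_{1,h}(a)u(x)=(2\pi h)^{-n/2}\int a(x,\xi;h)e^{i\langle x,\xi\rangle/h}\mathcal{F}_hu(\xi)\,d\xi$, where $\mathcal{F}_hu(\xi)=(2\pi h)^{-n/2}\int u(x)e^{-i\langle x,\xi\rangle/h}dx$. The Fourier transform is $\hat\phi=\mathcal{F}_1\phi$. Essential support: for $a\in S_\delta$, $0\le\delta<\frac12$, $(x_0,\xi_0)\notin\mathrm{ess}\text{-}\mathrm{supp}(a)$ if and only if there is an open neighborhood $U$ of $(x_0,\xi_0)$ with $a=\mathcal{O}_{C^\infty(U)}(h^\infty)$, i.e. every derivative of $a$ in $(x,\xi)$ is $\mathcal{O}(h^\infty)$ uniformly on $U$. Wavefront set of a family: for $u=\{u(h)\}_{0<h<h_0}\subseteq L^2(\mathbb{R}^n)$ with $\|u(h)\|_{L^2}\le C$, $(x_0,\xi_0)\notin\mathrm{WF}_h(u)\subseteq T^*\mathbb{R}^n$ if and only if there is $c\in S$ with $\inf_h|c(x_0,\xi_0;h)|>0$ and $\|Op_{t,h}(c)u(h)\|_{L^2}=\mathcal{O}(h^\infty)$ (this does not depend on $t\in[0,1]$). Coherent state: for $\phi\in\mathscr{S}(\mathbb{R}^n)$ and $(y,\eta)\in T^*\mathbb{R}^n$, \[\phi_{y,\eta,h}(x)=h^{-n/4}\phi\left(\frac{x-y}{h^{1/2}}\right)e^{i\langle x,\eta\rangle/h}.\]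 *)

theory Defs
  imports "HOL-Analysis.Analysis" "HOL-Library.Landau_Symbols"
begin

section \<open>Smooth functions and symbol classes\<close>

definition partial_deriv ::
    "'a::euclidean_space \<Rightarrow> ('a \<Rightarrow> complex) \<Rightarrow> 'a \<Rightarrow> complex" where
  "partial_deriv b f x = vector_derivative (\<lambda>s. f (x + s *\<^sub>R b)) (at 0)"

text \<open>
  Partial derivatives of higher order are indexed by the list of the successive coordinate
  directions instead of by a multi-index. On smooth functions the order of differentiation is
  irrelevant, so a list \<open>bs\<close> amounts to the multi-index counting the occurrences of each direction,
  and \<open>length bs\<close> is the order of that multi-index.
\<close>

definition partial_derivs ::
    "'a::euclidean_space list \<Rightarrow> ('a \<Rightarrow> complex) \<Rightarrow> 'a \<Rightarrow> complex" where
  "partial_derivs bs f = foldr partial_deriv bs f"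

text \<open>
  Asking for Frechet differentiability (hence continuity) of all iterated partial derivatives
  is the same as \<open>C\<^sup>\<infinity>\<close>.
\<close>

definition smooth :: "('a::euclidean_space \<Rightarrow> complex) \<Rightarrow> bool" where
  "smooth f \<longleftrightarrow> (\<forall>bs\<in>lists Basis. \<forall>x. partial_derivs bs f differentiable (at x))"

text \<open>
  The cotangent space is the type \<open>real^'n \<times> real^'n\<close> of pairs \<open>(x, \<xi>)\<close>. Its \<open>Basis\<close> consists of the
  \<open>x\<close>-directions and the \<open>\<xi>\<close>-directions, so \<open>length bs\<close> below is \<open>|\<alpha>| + |\<beta>|\<close>.
  Families indexed by \<open>h\<close> are functions on all of \<open>real\<close>; only their values
  for \<open>0 < h < h0\<close> matter.
\<close>

definition symbol_class ::
    "real \<Rightarrow> real \<Rightarrow> (real \<Rightarrow> (real^'n) \<times> (real^'n) \<Rightarrow> complex) set" where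
  "symbol_class h0 \<delta> =
     {a. (\<forall>h\<in>{0<..<h0}. smooth (a h)) \<and>
         (\<forall>bs\<in>lists Basis. \<exists>C. \<forall>h\<in>{0<..<h0}. \<forall>z.
            cmod (partial_derivs bs (a h) z) \<le> C * h powr (- \<delta> * real (length bs)))}"

definition ess_supp ::
    "(real \<Rightarrow> (real^'n) \<times> (real^'n) \<Rightarrow> complex) \<Rightarrow> ((real^'n) \<times> (real^'n)) set" where
  "ess_supp a =
     {z0. \<not> (\<exists>U. open U \<and> z0 \<in> U \<and>
               (\<forall>bs\<in>lists Basis. \<forall>N::nat. \<exists>C. \<forall>\<^sub>F h in at_right 0. \<forall>z\<in>U.
                  cmod (partial_derivs bs (a h) z) \<le> C * h ^ N))}"


section \<open>Schwartz functions, Fourier transform, coherent states\<close>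

definition schwartz :: "(real^'n \<Rightarrow> complex) \<Rightarrow> bool" where
  "schwartz f \<longleftrightarrow>
     smooth f \<and>
     (\<forall>bs\<in>lists Basis. \<forall>k::nat. \<exists>C. \<forall>x. (1 + norm x) ^ k * cmod (partial_derivs bs f x) \<le> C)"

definition fourier :: "real \<Rightarrow> (real^'n \<Rightarrow> complex) \<Rightarrow> real^'n \<Rightarrow> complex" where
  "fourier h u \<xi> =
     of_real ((2 * pi * h) powr (- real CARD('n) / 2)) *
     (LINT x|lborel. u x * cis (- (x \<bullet> \<xi>) / h))"

definition coherent_state ::
    "(real^'n \<Rightarrow> complex) \<Rightarrow> real^'n \<Rightarrow> real^'n \<Rightarrow> real \<Rightarrow> real^'n \<Rightarrow> complex" where
  "coherent_state \<phi> y \<eta> h x =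
     of_real (h powr (- real CARD('n) / 4)) *
     \<phi> ((1 / sqrt h) *\<^sub>R (x - y)) * cis ((x \<bullet> \<eta>) / h)"


section \<open>Quantization\<close>

text \<open>
  For a bounded symbol with bounded derivatives and Schwartz \<open>u\<close>, the integral over \<open>y\<close> is
  absolutely convergent and, by integration by parts in \<open>y\<close>, rapidly decreasing in \<open>\<xi>\<close>. The iterated
  integral in this order (first \<open>y\<close>, then \<open>\<xi>\<close>) is therefore the value of the oscillatory integral.
  The argument \<open>a\<close> is the symbol at the given value of \<open>h\<close>.
\<close>

definition quantize ::
    "real \<Rightarrow> real \<Rightarrow> ((real^'n) \<times> (real^'n) \<Rightarrow> complex) \<Rightarrow>
     (real^'n \<Rightarrow> complex) \<Rightarrow> real^'n \<Rightarrow> complex" where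
  "quantize t h a u x =
     of_real (1 / (2 * pi * h) ^ CARD('n)) *
     (LINT \<xi>|lborel. LINT y|lborel.
        a (t *\<^sub>R x + (1 - t) *\<^sub>R y, \<xi>) * cis (((x - y) \<bullet> \<xi>) / h) * u y)"

lemma quantize_1:
  fixes a :: "(real^'n) \<times> (real^'n) \<Rightarrow> complex"
  assumes "h > 0"
  shows "quantize 1 h a u x =
    of_real ((2 * pi * h) powr (- real CARD('n) / 2)) *
    (LINT \<xi>|lborel. a (x, \<xi>) * cis ((x \<bullet> \<xi>) / h) * fourier h u \<xi>)"
proof -
  define c where "c = complex_of_real ((2 * pi * h) powr (- real CARD('n) / 2))"
  have "(2 * pi * h) powr (- real CARD('n) / 2) * (2 * pi * h) powr (- real CARD('n) / 2)
      = 1 / (2 * pi * h) ^ CARD('n)"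
    using assms by (simp add: powr_add [symmetric] powr_minus_divide powr_realpow)
  then have cc: "complex_of_real (1 / (2 * pi * h) ^ CARD('n)) = c * c"
    unfolding c_def by (metis of_real_mult)
  have eq: "a (x, \<xi>) * cis (((x - y) \<bullet> \<xi>) / h) * u y =
      (a (x, \<xi>) * cis ((x \<bullet> \<xi>) / h)) * (u y * cis (- (y \<bullet> \<xi>) / h))" for \<xi> y
    by (simp add: cis_mult [symmetric] inner_diff_left diff_divide_distrib
        add_divide_distrib cis_divide [symmetric] field_simps flip: cis_inverse)
  have "quantize 1 h a u x = c * c *
     (LINT \<xi>|lborel. (a (x, \<xi>) * cis ((x \<bullet> \<xi>) / h)) *
        (LINT y|lborel. u y * cis (- (y \<bullet> \<xi>) / h)))"
    unfolding quantize_def cc by (simp add: eq)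
  also have "\<dots> = c * (LINT \<xi>|lborel. c * ((a (x, \<xi>) * cis ((x \<bullet> \<xi>) / h)) *
        (LINT y|lborel. u y * cis (- (y \<bullet> \<xi>) / h))))"
    by (simp add: mult.assoc)
  also have "\<dots> = c * (LINT \<xi>|lborel. a (x, \<xi>) * cis ((x \<bullet> \<xi>) / h) * fourier h u \<xi>)"
    unfolding fourier_def c_def by (simp add: mult_ac)
  finally show ?thesis unfolding c_def .
qed


section \<open>Extension to square-integrable functions and the wavefront set\<close>

definition L2 :: "(real^'n \<Rightarrow> complex) set" where
  "L2 = {u \<in> borel_measurable lborel. integrable lborel (\<lambda>x. (cmod (u x))\<^sup>2)}"

definition L2_norm :: "(real^'n \<Rightarrow> complex) \<Rightarrow> real" where
  "L2_norm u = sqrt (LINT x|lborel. (cmod (u x))\<^sup>2)"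

text \<open>
  \<open>T\<close> is a bounded linear operator on the space of square-integrable functions modulo equality
  almost everywhere, acting on representatives, that agrees with \<open>A\<close> on Schwartz functions.
  As Schwartz functions are dense, \<open>T\<close> is determined by \<open>A\<close> up to equality almost everywhere.
\<close>

definition bounded_L2_extension ::
    "((real^'n \<Rightarrow> complex) \<Rightarrow> real^'n \<Rightarrow> complex) \<Rightarrow>
     ((real^'n \<Rightarrow> complex) \<Rightarrow> real^'n \<Rightarrow> complex) \<Rightarrow> bool" where
  "bounded_L2_extension A T \<longleftrightarrow>
     (\<forall>u\<in>L2. T u \<in> L2) \<and>
     (\<forall>u\<in>L2. \<forall>v\<in>L2. AE x in lborel. T (\<lambda>y. u y + v y) x = T u x + T v x) \<and>
     (\<forall>u\<in>L2. \<forall>k. AE x in lborel. T (\<lambda>y. k * u y) x = k * T u x) \<and>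
     (\<exists>C. \<forall>u\<in>L2. L2_norm (T u) \<le> C * L2_norm u) \<and>
     (\<forall>u. schwartz u \<longrightarrow> (AE x in lborel. T u x = A u x))"

text \<open>
  The operators \<open>T h\<close> are the extensions of the quantizations of \<open>c h\<close>; they exist for every \<open>c\<close> in
  \<open>symbol_class h0 0\<close> (Calderon-Vaillancourt) and are essentially unique, so the quantifier
  over \<open>T\<close> only names them. The set is meant for families \<open>u\<close> that are bounded in \<open>L2\<close>.
\<close>

definition wavefront_set ::
    "real \<Rightarrow> real \<Rightarrow> (real \<Rightarrow> real^'n \<Rightarrow> complex) \<Rightarrow> ((real^'n) \<times> (real^'n)) set" where
  "wavefront_set h0 t u =
     {z0. \<not> (\<exists>c\<in>symbol_class h0 0.
               (INF h\<in>{0<..<h0}. cmod (c h z0)) > 0 \<and>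
               (\<exists>T. (\<forall>h\<in>{0<..<h0}. bounded_L2_extension (quantize t h (c h)) (T h)) \<and>
                    (\<forall>N::nat. (\<lambda>h. L2_norm (T h (u h))) \<in> O[at_right 0](\<lambda>h. h ^ N))))}"

end

theory Submission
  imports Defs "HOL-Probability.Probability"
begin

text \<open>
  Fix \<open>\<delta> < \<kappa> < 1/2\<close>. Since \<open>(x0, \<xi>0)\<close> lies in the essential support, interpolation between \<open>a\<close> and its
  derivatives yields, arbitrarily close to \<open>(x0, \<xi>0)\<close> and along sequences \<open>h \<rightarrow> 0\<close>, points where
  \<open>|a| \<ge> h^N\<close>. Moving to a maximum of \<open>|a|\<close> damped exponentially at scale \<open>h^\<kappa>\<close> gives a point \<open>z_h\<close> near which
  \<open>|a| \<le> C |a(z_h)|\<close> at scale \<open>h^\<kappa>\<close>; interpolation against derivatives of high order then bounds the \<open>k\<close>-th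
  derivatives by \<open>C h^(- \<kappa> k) |a(z_h)|\<close>. As \<open>\<kappa> < 1/2\<close>, the symbol \<open>a(z_h + h^(1/2) w) / a(z_h)\<close> tends to 1,
  with derivatives bounded by a power of \<open>1 + |w|\<close> that depends on neither \<open>h\<close> nor the order.

  Conjugating with the phase-space translation to \<open>z_h\<close> and the dilation by \<open>h^(1/2)\<close>, the function \<open>Op(c) Op(a) \<phi>_h\<close>
  becomes \<open>c(z_h) a(z_h)\<close> times a function converging pointwise to \<open>\<phi>\<close>, by dominated convergence and
  Fourier inversion. By Fatou's lemma its norm is at least of the order of \<open>h^N\<close> if \<open>c\<close> is elliptic at \<open>(x0, \<xi>0)\<close>.
\<close>

subsection \<open>Iterated partial derivatives\<close>

text \<open>Each neighbourhood of a point of the essential support comes with its own exponent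
  \<open>N\<close>, and these exponents may grow as the neighbourhoods shrink. Hence no sequence of
  points converging to the given one can be expected to satisfy the lower bound with one fixed
  \<open>N\<close>. Instead, for every \<open>k\<close> a separate sequence of parameters carries
  points within distance \<open>1 / (k + 1)\<close> and an exponent \<open>N k\<close>, and all
  these sequences are interleaved into one family. An elliptic \<open>c\<close> has a Lipschitz
  constant uniform in \<open>h\<close>, so it stays elliptic at the points of one suitable
  \<open>k\<close>, and decay of order \<open>N k + 1\<close> along that sequence is contradictory.
  It is essential that the growth exponent \<open>p\<close> of the rescaled symbol is the same for
  all orders of differentiation. The compact Fourier support bounds the frequency, the amplitude
  grows like \<open>(1 + norm s) ^ p\<close> in position, and \<open>k + p\<close> integrations by
  parts leave decay of order \<open>k\<close>. With an exponent growing with the order, nothing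
  would be gained. The damping is exponential because it can be recentred by the triangle inequality
  and shifts the peak only by \<open>h powr \<kappa>\<close> times a logarithm.\<close>

lemma partial_derivs_simps [simp]:
  "partial_derivs [] f = f"
  "partial_derivs (b # bs) f = partial_deriv b (partial_derivs bs f)"
  by (simp_all add: partial_derivs_def)

lemma partial_derivs_append:
  "partial_derivs (bs @ cs) f = partial_derivs bs (partial_derivs cs f)"
  by (simp add: partial_derivs_def)

lemma has_vector_derivative_line:
  assumes "(f has_derivative D) (at (x + s *\<^sub>R b))"
  shows "((\<lambda>s. f (x + s *\<^sub>R b)) has_vector_derivative D b) (at s)"
proof -
  have "((\<lambda>s. x + s *\<^sub>R b) has_derivative (\<lambda>s. s *\<^sub>R b)) (at s)"
    by (auto intro!: derivative_eq_intros)
  from diff_chain_at[OF this, of f D] assms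
  have "((\<lambda>s. f (x + s *\<^sub>R b)) has_derivative (\<lambda>s. D (s *\<^sub>R b))) (at s)"
    by (simp add: o_def)
  moreover have "D (s *\<^sub>R b) = s *\<^sub>R D b" for s
    using assms has_derivative_linear linear_scale by blast
  ultimately show ?thesis by (simp add: has_vector_derivative_def)
qed

lemma partial_deriv_eq:
  assumes "(f has_derivative D) (at x)"
  shows "partial_deriv b f x = D b"
  using has_vector_derivative_line[of f D x 0 b] assms
  by (simp add: partial_deriv_def vector_derivative_at)

lemma has_vector_derivative_partial:
  assumes "f differentiable (at (x + s *\<^sub>R b))"
  shows "((\<lambda>s. f (x + s *\<^sub>R b)) has_vector_derivative partial_deriv b f (x + s *\<^sub>R b)) (at s)"
  using assms has_vector_derivative_line partial_deriv_eq by (metis differentiable_def)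

lemma has_derivative_partial_deriv:
  assumes "f differentiable (at x)"
  shows "(f has_derivative (\<lambda>v. \<Sum>b\<in>Basis. (v \<bullet> b) *\<^sub>R partial_deriv b f x)) (at x)"
proof -
  obtain D where D: "(f has_derivative D) (at x)"
    using assms by (auto simp: differentiable_def)
  have lin: "linear D"
    using D has_derivative_linear by blast
  have "D v = (\<Sum>b\<in>Basis. (v \<bullet> b) *\<^sub>R partial_deriv b f x)" for v
  proof -
    have "D v = D (\<Sum>b\<in>Basis. (v \<bullet> b) *\<^sub>R b)"
      by (simp add: euclidean_representation)
    also have "\<dots> = (\<Sum>b\<in>Basis. (v \<bullet> b) *\<^sub>R D b)"
      by (simp add: linear_sum[OF lin] linear_scale[OF lin])
    finally show ?thesis by (simp add: partial_deriv_eq[OF D])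
  qed
  then show ?thesis
    using D by (simp add: fun_eq_iff has_derivative_eq_rhs)
qed

lemma smoothD:
  assumes "smooth f"
  shows "f differentiable (at x)" "b \<in> Basis \<Longrightarrow> smooth (partial_deriv b f)"
    "bs \<in> lists Basis \<Longrightarrow> smooth (partial_derivs bs f)"
proof -
  show "f differentiable (at x)"
    using assms by (auto simp: smooth_def dest: bspec[of _ _ "[]"])
  show *: "smooth (partial_derivs bs f)" if "bs \<in> lists Basis" for bs
    using assms that unfolding smooth_def by (metis append_in_lists_conv partial_derivs_append)
  show "smooth (partial_deriv b f)" if "b \<in> Basis"
    using *[of "[b]"] that by simp
qed

lemma smooth_continuous_on: "smooth f \<Longrightarrow> continuous_on S f"
  by (meson continuous_at_imp_continuous_on differentiable_imp_continuous_within smoothD(1))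

text \<open>Iterated derivatives never leave \<open>F\<close>, and every member of \<open>F\<close>
  is differentiable. This gives smoothness without formulas for higher derivatives; the second
  conclusion locates each derivative in \<open>F\<close>, from which bounds can be read off.\<close>

lemma smooth_coinduct:
  assumes "f \<in> F" and "\<And>g x. g \<in> F \<Longrightarrow> g differentiable (at x)"
    and "\<And>g b. g \<in> F \<Longrightarrow> b \<in> Basis \<Longrightarrow> partial_deriv b g \<in> F"
  shows "smooth f" and "bs \<in> lists Basis \<Longrightarrow> partial_derivs bs f \<in> F"
proof -
  show *: "partial_derivs bs f \<in> F" if "bs \<in> lists Basis" for bs
    using that by (induction bs) (use assms in auto)
  then show "smooth f"
    using assms by (auto simp: smooth_def)
qed

lemma partial_deriv_const [simp]: "partial_deriv b (\<lambda>x. c) = (\<lambda>x. 0)"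
  by (rule ext, rule partial_deriv_eq) (auto intro!: derivative_eq_intros)

lemma smooth_const [simp]: "smooth (\<lambda>x. c)"
  by (rule smooth_coinduct(1)[of _ "range (\<lambda>c x. c)"]) auto

lemma partial_deriv_add:
  assumes "\<And>x. f differentiable (at x)" "\<And>x. g differentiable (at x)"
  shows "partial_deriv b (\<lambda>x. f x + g x) = (\<lambda>x. partial_deriv b f x + partial_deriv b g x)"
proof (rule ext, rule partial_deriv_eq)
  fix x
  show "((\<lambda>x. f x + g x) has_derivative
     (\<lambda>b. partial_deriv b f x + partial_deriv b g x)) (at x)"
    using assms[of x] by (auto simp: differentiable_def partial_deriv_eq intro!: derivative_eq_intros)
qed

lemma partial_deriv_mult:
  assumes "\<And>x. f differentiable (at x)" "\<And>x. g differentiable (at x)"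
  shows "partial_deriv b (\<lambda>x. f x * g x) = (\<lambda>x. partial_deriv b f x * g x + f x * partial_deriv b g x)"
proof (rule ext, rule partial_deriv_eq)
  fix x
  show "((\<lambda>x. f x * g x) has_derivative
     (\<lambda>b. partial_deriv b f x * g x + f x * partial_deriv b g x)) (at x)"
    using assms[of x] by (auto simp: differentiable_def partial_deriv_eq intro!: derivative_eq_intros)
qed

text \<open>Products alone are not stable under differentiation, because the product rule creates
  sums. Closing under both operations at once gives a set to which \<open>smooth_coinduct\<close>
  applies.\<close>

inductive_set smooth_algebra :: "('a::euclidean_space \<Rightarrow> complex) set" where
  "smooth f \<Longrightarrow> f \<in> smooth_algebra"
| "f \<in> smooth_algebra \<Longrightarrow> g \<in> smooth_algebra \<Longrightarrow> (\<lambda>x. f x + g x) \<in> smooth_algebra"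
| "f \<in> smooth_algebra \<Longrightarrow> g \<in> smooth_algebra \<Longrightarrow> (\<lambda>x. f x * g x) \<in> smooth_algebra"

lemma smooth_algebra_smooth:
  assumes "f \<in> smooth_algebra"
  shows "smooth f"
proof -
  have *: "(\<forall>x. g differentiable (at x)) \<and> (\<forall>b\<in>Basis. partial_deriv b g \<in> smooth_algebra)"
    if "g \<in> smooth_algebra" for g :: "'a \<Rightarrow> complex"
    using that
  proof induction
    case (1 f)
    then show ?case by (auto intro: smoothD smooth_algebra.intros)
  next
    case (2 f g)
    then show ?case by (auto simp: partial_deriv_add intro: smooth_algebra.intros)
  next
    case (3 f g)
    then show ?case by (auto simp: partial_deriv_mult intro!: smooth_algebra.intros(2,3))
  qed
  show ?thesis by (rule smooth_coinduct(1)[OF assms]) (use * in auto)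
qed

lemma smooth_add: "smooth f \<Longrightarrow> smooth g \<Longrightarrow> smooth (\<lambda>x. f x + g x)"
  and smooth_mult: "smooth f \<Longrightarrow> smooth g \<Longrightarrow> smooth (\<lambda>x. f x * g x)"
  by (auto intro!: smooth_algebra_smooth intro: smooth_algebra.intros)

lemma smooth_cmult: "smooth f \<Longrightarrow> smooth (\<lambda>x. c * f x)"
  by (auto intro: smooth_mult)

lemma partial_deriv_cmult:
  assumes "smooth f"
  shows "partial_deriv b (\<lambda>x. c * f x) = (\<lambda>x. c * partial_deriv b f x)"
  using partial_deriv_mult[of "\<lambda>x. c" f b] smoothD(1)[OF assms] by simp

lemma partial_derivs_cmult:
  assumes "smooth f" "bs \<in> lists Basis"
  shows "partial_derivs bs (\<lambda>x. c * f x) = (\<lambda>x. c * partial_derivs bs f x)"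
  using assms(2) by (induction bs) (auto simp: partial_deriv_cmult smoothD(3)[OF assms(1)])

lemma partial_deriv_affine:
  assumes "\<And>x \<tau>. L (x + \<tau> *\<^sub>R b) = L x + (\<tau> * c) *\<^sub>R b'"
    and "\<And>x. f differentiable (at x)"
  shows "partial_deriv b (\<lambda>x. f (L x)) = (\<lambda>x. of_real c * partial_deriv b' f (L x))"
proof
  fix x
  have "((\<lambda>s. f (L x + s *\<^sub>R b')) has_vector_derivative partial_deriv b' f (L x)) (at (0 * c))"
    using has_vector_derivative_partial[of f "L x" 0 b'] assms(2) by simp
  moreover have "((\<lambda>s::real. s * c) has_vector_derivative c) (at 0)"
    by (auto intro!: derivative_eq_intros simp: has_real_derivative_iff_has_vector_derivative[symmetric])
  ultimately have "((\<lambda>s. f (L x + (s * c) *\<^sub>R b')) has_vector_derivative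
      c *\<^sub>R partial_deriv b' f (L x)) (at 0)"
    using vector_diff_chain_at[of "\<lambda>s. s * c" c 0 "\<lambda>s. f (L x + s *\<^sub>R b')"] by (simp add: o_def)
  then show "partial_deriv b (\<lambda>x. f (L x)) x = of_real c * partial_deriv b' f (L x)"
    by (simp add: partial_deriv_def assms(1) vector_derivative_at scaleR_conv_of_real)
qed

text \<open>The condition says that \<open>L\<close> is affine and maps each coordinate direction to a multiple of
  a coordinate direction.\<close>

lemma
  fixes L :: "'b::euclidean_space \<Rightarrow> 'a::euclidean_space"
  assumes L: "\<And>b x \<tau>. b \<in> Basis \<Longrightarrow> L (x + \<tau> *\<^sub>R b) = L x + (\<tau> * c b) *\<^sub>R \<beta> b"
    and \<beta>: "\<And>b. b \<in> Basis \<Longrightarrow> \<beta> b \<in> Basis"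
    and diff: "\<And>x. L differentiable (at x)"
    and f: "smooth f"
  shows smooth_affine: "smooth (\<lambda>x. f (L x))"
    and partial_derivs_affine: "bs \<in> lists Basis \<Longrightarrow> partial_derivs bs (\<lambda>x. f (L x)) =
       (\<lambda>x. of_real (prod_list (map c bs)) * partial_derivs (map \<beta> bs) f (L x))"
proof -
  have comp: "(\<lambda>x. g (L x)) differentiable (at x)" if "smooth g" for g :: "'a \<Rightarrow> complex" and x
    using differentiable_compose[of g L x UNIV] smoothD(1)[OF that] diff by auto
  have pd: "partial_deriv b (\<lambda>x. k * g (L x)) = (\<lambda>x. of_real (c b) * k * partial_deriv (\<beta> b) g (L x))"
    if "b \<in> Basis" "smooth g" for b g and k :: complex
    using partial_deriv_affine[of L b "c b" "\<beta> b" "\<lambda>x. k * g x"] L that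
    by (simp add: partial_deriv_cmult smooth_cmult smoothD(1) mult.assoc)
  show "smooth (\<lambda>x. f (L x))"
  \<comment> \<open>The scalar \<open>k\<close> collects the chain-rule factors \<open>c b\<close>;
    it makes the set closed under differentiation.\<close>
  proof (rule smooth_coinduct(1)[of _ "{(\<lambda>x. k * g (L x)) |g k. smooth g}"])
    show "(\<lambda>x. f (L x)) \<in> {(\<lambda>x. k * g (L x)) |g k. smooth g}"
      using f by (auto intro!: exI[of _ f] exI[of _ 1])
    next
    fix g b assume "g \<in> {(\<lambda>x. k * g (L x)) |g k. smooth g}" and b: "(b::'b) \<in> Basis"
    then obtain k g' where "g = (\<lambda>x. k * g' (L x))" "smooth g'" by auto
    then show "partial_deriv b g \<in> {(\<lambda>x. k * g (L x)) |g k. smooth g}"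
      using pd[OF b, of g' k] \<beta>[OF b] smoothD(2) by blast
  qed (auto simp: comp)
  show "partial_derivs bs (\<lambda>x. f (L x)) =
       (\<lambda>x. of_real (prod_list (map c bs)) * partial_derivs (map \<beta> bs) f (L x))"
    if "bs \<in> lists Basis"
    using that
  proof (induction bs)
    case (Cons b bs)
    have "map \<beta> bs \<in> lists Basis"
      using Cons \<beta> by auto
    then show ?case
      using Cons pd[of b "partial_derivs (map \<beta> bs) f"] smoothD(3)[OF f]
      by (simp add: mult_ac)
  qed auto
qed

subsection \<open>Pointwise bounds on jets\<close>

definition jet_bound :: "nat \<Rightarrow> ('a::euclidean_space \<Rightarrow> complex) \<Rightarrow> 'a \<Rightarrow> real \<Rightarrow> bool" where
  "jet_bound K f z B \<longleftrightarrow>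
     (\<forall>bs\<in>lists Basis. length bs \<le> K \<longrightarrow> cmod (partial_derivs bs f z) \<le> B)"

lemma jet_bound_0 [simp]: "jet_bound 0 f z B \<longleftrightarrow> cmod (f z) \<le> B"
  by (auto simp: jet_bound_def)

text \<open>The direction split off is the last entry of the list, that is, the derivative taken
  first. The recursion passes to \<open>partial_deriv b f\<close>, so statements generalised over
  \<open>f\<close> can be proved by induction on \<open>K\<close>.\<close>

lemma jet_bound_Suc:
  "jet_bound (Suc K) f z B \<longleftrightarrow> cmod (f z) \<le> B \<and> (\<forall>b\<in>Basis. jet_bound K (partial_deriv b f) z B)"
proof
  assume *: "jet_bound (Suc K) f z B"
  have "cmod (partial_derivs bs (partial_deriv b f) z) \<le> B"
    if "b \<in> Basis" "bs \<in> lists Basis" "length bs \<le> K" for b bs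
    using * that unfolding jet_bound_def
    by (auto simp: partial_derivs_append dest!: bspec[of _ _ "bs @ [b]"])
  with * show "cmod (f z) \<le> B \<and> (\<forall>b\<in>Basis. jet_bound K (partial_deriv b f) z B)"
    by (auto simp: jet_bound_def dest: bspec[of _ _ "[]"])
next
  assume *: "cmod (f z) \<le> B \<and> (\<forall>b\<in>Basis. jet_bound K (partial_deriv b f) z B)"
  have "cmod (partial_derivs bs f z) \<le> B" if "bs \<in> lists Basis" "length bs \<le> Suc K" for bs
  proof (cases bs rule: rev_cases)
    case (snoc cs b)
    then show ?thesis
      using * that by (auto simp: partial_derivs_append jet_bound_def)
  qed (use * in auto)
  then show "jet_bound (Suc K) f z B" by (auto simp: jet_bound_def)
qed

lemma jet_boundD: "jet_bound K f z B \<Longrightarrow> bs \<in> lists Basis \<Longrightarrow> length bs \<le> K \<Longrightarrow>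
    cmod (partial_derivs bs f z) \<le> B"
  by (auto simp: jet_bound_def)

lemma jet_bound_val: "jet_bound K f z B \<Longrightarrow> cmod (f z) \<le> B"
  using jet_boundD[of K f z B "[]"] by simp

lemma jet_bound_pos: "jet_bound K f z B \<Longrightarrow> 0 \<le> B"
  using jet_bound_val norm_ge_zero order_trans by blast

lemma jet_bound_mono: "jet_bound K f z B \<Longrightarrow> K' \<le> K \<Longrightarrow> B \<le> B' \<Longrightarrow> jet_bound K' f z B'"
  by (auto simp: jet_bound_def intro: order_trans)

lemma jet_bound_deriv: "jet_bound (Suc K) f z B \<Longrightarrow> b \<in> Basis \<Longrightarrow> jet_bound K (partial_deriv b f) z B"
  by (auto simp: jet_bound_Suc)

lemma jet_bound_add:
  assumes "smooth f" "smooth g" "jet_bound K f z A" "jet_bound K g z B"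
  shows "jet_bound K (\<lambda>x. f x + g x) z (A + B)"
  using assms
proof (induction K arbitrary: f g)
  case (Suc K)
  then show ?case by (auto simp: jet_bound_Suc partial_deriv_add smoothD intro: norm_triangle_mono)
qed (auto intro: norm_triangle_mono)

text \<open>Each differentiation replaces a product by two products, so \<open>K\<close> of them
  produce at most \<open>2 ^ K\<close> terms, each bounded by \<open>A * B\<close>.\<close>

lemma jet_bound_mult:
  assumes "smooth f" "smooth g" "jet_bound K f z A" "jet_bound K g z B"
  shows "jet_bound K (\<lambda>x. f x * g x) z (2 ^ K * A * B)"
  using assms
proof (induction K arbitrary: f g)
  case 0
  then show ?case by (auto simp: norm_mult intro: mult_mono order_trans[OF norm_ge_zero])
next
  case (Suc K)
  have "0 \<le> A" "0 \<le> B"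
    using Suc.prems jet_bound_pos by blast+
  have "cmod (f z * g z) \<le> A * B"
    using Suc.prems by (auto simp: norm_mult jet_bound_Suc intro: mult_mono order_trans[OF norm_ge_zero])
  also have "\<dots> \<le> 2 ^ Suc K * (A * B)"
    using mult_right_mono[of 1 "2 ^ Suc K" "A * B"] \<open>0 \<le> A\<close> \<open>0 \<le> B\<close>
    by (simp del: power_Suc add: one_le_power)
  moreover
  have "jet_bound K (partial_deriv b (\<lambda>x. f x * g x)) z (2 ^ Suc K * A * B)" if b: "b \<in> Basis" for b
  proof -
    have le: "jet_bound K f z A" "jet_bound K g z B"
      using Suc.prems by (auto elim: jet_bound_mono)
    have "jet_bound K (\<lambda>x. partial_deriv b f x * g x + f x * partial_deriv b g x) z
        (2 ^ K * A * B + 2 ^ K * A * B)"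
      using Suc.prems b le
      by (intro jet_bound_add Suc.IH smooth_mult) (auto simp: jet_bound_Suc intro: smoothD)
    moreover have "2 ^ K * A * B + 2 ^ K * A * B = 2 ^ Suc K * A * B" by simp
    ultimately show ?thesis
      using Suc.prems by (simp only: partial_deriv_mult smoothD)
  qed
  ultimately show ?case by (simp add: jet_bound_Suc mult.assoc)
qed

lemma jet_bound_cmult:
  assumes "smooth f" "jet_bound K f z B"
  shows "jet_bound K (\<lambda>x. c * f x) z (cmod c * B)"
  using assms by (auto simp: jet_bound_def partial_derivs_cmult norm_mult intro: mult_left_mono)

text \<open>The chain rule multiplies a derivative by factors \<open>c b\<close>; being at most 1 in
  absolute value, they preserve the bound. This covers slices, projections (where some factors are
  0) and the contraction by \<open>1 - t\<close> in a quantization.\<close>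

lemma jet_bound_affine:
  fixes L :: "'b::euclidean_space \<Rightarrow> 'a::euclidean_space"
  assumes L: "\<And>b x \<tau>. b \<in> Basis \<Longrightarrow> L (x + \<tau> *\<^sub>R b) = L x + (\<tau> * c b) *\<^sub>R \<beta> b"
    and \<beta>: "\<And>b. b \<in> Basis \<Longrightarrow> \<beta> b \<in> Basis"
    and diff: "\<And>x. L differentiable (at x)"
    and f: "smooth f" and c: "\<And>b. b \<in> Basis \<Longrightarrow> \<bar>c b\<bar> \<le> 1"
    and bd: "jet_bound K f (L x) B"
  shows "jet_bound K (\<lambda>x. f (L x)) x B"
  unfolding jet_bound_def
proof (intro ballI impI)
  fix bs :: "'b list" assume bs: "bs \<in> lists Basis" "length bs \<le> K"
  have "\<bar>prod_list (map c bs)\<bar> \<le> 1"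
    using bs(1) by (induction bs) (auto simp: abs_mult intro!: mult_le_one c)
  moreover have "map \<beta> bs \<in> lists Basis"
    using bs \<beta> by auto
  then have "cmod (partial_derivs (map \<beta> bs) f (L x)) \<le> B"
    using bs bd by (auto simp: jet_bound_def)
  ultimately have "\<bar>prod_list (map c bs)\<bar> * cmod (partial_derivs (map \<beta> bs) f (L x)) \<le> 1 * B"
    by (intro mult_mono) auto
  then show "cmod (partial_derivs bs (\<lambda>x. f (L x)) x) \<le> B"
    using partial_derivs_affine[OF L \<beta> diff f bs(1)] by (simp add: norm_mult)
qed

subsection \<open>Lebesgue integration\<close>

text \<open>Substitution also holds where the integral is undefined, since both sides are then 0.
  The absence of an integrability condition makes the rescaling of a quantization a pure
  identity.\<close>

lemma lborel_integral_affine: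
  fixes f :: "'a::euclidean_space \<Rightarrow> 'b::{banach, second_countable_topology}"
  assumes c: "c > 0"
  shows "(LINT x|lborel. f x) = c ^ DIM('a) *\<^sub>R (LINT x|lborel. f (t + c *\<^sub>R x))"
proof (cases "f \<in> borel_measurable borel")
  case True
  have "(LINT x|lborel. f x) = integral\<^sup>L (density (distr lborel borel (\<lambda>x. t + c *\<^sub>R x)) (\<lambda>_. c ^ DIM('a))) f"
    using lborel_affine[of c t] c by simp
  also have "\<dots> = integral\<^sup>L (distr lborel borel (\<lambda>x. t + c *\<^sub>R x)) (\<lambda>x. c ^ DIM('a) *\<^sub>R f x)"
    using True c by (subst integral_density) auto
  also have "\<dots> = (LINT x|lborel. c ^ DIM('a) *\<^sub>R f (t + c *\<^sub>R x))"
    using True by (subst integral_distr) auto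
  finally show ?thesis by simp
next
  case False
  \<comment> \<open>Rescaling is invertible, so the rescaled function is not measurable either, and
    both integrals take the default value 0.\<close>
  have "\<not> (\<lambda>x. f (t + c *\<^sub>R x)) \<in> borel_measurable borel"
  proof
    assume *: "(\<lambda>x. f (t + c *\<^sub>R x)) \<in> borel_measurable borel"
    have "(\<lambda>x. f (t + c *\<^sub>R ((1 / c) *\<^sub>R (x - t)))) \<in> borel_measurable borel"
      by (rule measurable_compose[OF _ *]) simp
    with False c show False by simp
  qed
  then have "\<not> integrable lborel (\<lambda>x. f (t + c *\<^sub>R x))" "\<not> integrable lborel f"
    using False borel_measurable_integrable by auto
  then show ?thesis by (simp add: not_integrable_integral_eq)
qed

lemma nn_integral_lborel_affine:
  fixes f :: "'a::euclidean_space \<Rightarrow> ennreal"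
  assumes c: "c > 0" and [measurable]: "f \<in> borel_measurable borel"
  shows "(\<integral>\<^sup>+x. f x \<partial>lborel) = ennreal (c ^ DIM('a)) * (\<integral>\<^sup>+x. f (t + c *\<^sub>R x) \<partial>lborel)"
proof -
  have "(\<integral>\<^sup>+x. f x \<partial>lborel) =
      integral\<^sup>N (density (distr lborel borel (\<lambda>x. t + c *\<^sub>R x)) (\<lambda>_. c ^ DIM('a))) f"
    using lborel_affine[of c t] c by simp
  also have "\<dots> = (\<integral>\<^sup>+x. ennreal (c ^ DIM('a)) * f (t + c *\<^sub>R x) \<partial>lborel)"
    by (simp add: nn_integral_density nn_integral_distr)
  finally show ?thesis by (simp add: nn_integral_cmult)
qed

lemma AE_lborel_affine:
  fixes P :: "'a::euclidean_space \<Rightarrow> bool"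
  assumes c: "c > 0" and "AE x in lborel. P x"
  shows "AE x in lborel. P (t + c *\<^sub>R x)"
proof -
  obtain N where N: "N \<in> null_sets lborel" "{x. \<not> P x} \<subseteq> N"
    using assms(2) by (auto elim!: AE_E simp: null_sets_def)
  then have [measurable]: "N \<in> sets borel" by auto
  have "(\<integral>\<^sup>+x. indicator N x \<partial>(lborel :: 'a measure)) = 0"
    using N(1) by (simp add: null_sets_def)
  then have "ennreal (c ^ DIM('a)) * (\<integral>\<^sup>+x. indicator N (t + c *\<^sub>R x) \<partial>(lborel :: 'a measure)) = 0"
    by (subst (asm) nn_integral_lborel_affine[OF c, of _ t]) auto
  then have "(\<integral>\<^sup>+x. indicator N (t + c *\<^sub>R x) \<partial>(lborel :: 'a measure)) = 0"
    using c by simp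
  then have "AE x in (lborel :: 'a measure). indicator N (t + c *\<^sub>R x) = (0::ennreal)"
    by (subst (asm) nn_integral_0_iff_AE) auto
  then show ?thesis by eventually_elim (use N in \<open>auto split: split_indicator_asm\<close>)
qed

lemma integrable_inverse_square: "integrable lborel (\<lambda>x::real. 1 / (1 + x\<^sup>2))"
proof -
  have "set_integrable lborel {0<..} (\<lambda>x::real. 1 / (1 + x\<^sup>2))"
    using integrable_I0i_1_div_plus_square
    by (simp add: interval_lebesgue_integrable_def einterval_eq_Ici zero_ereal_def)
  then have 1: "integrable lborel (\<lambda>x::real. indicator {0<..} x * (1 / (1 + x\<^sup>2)))"
    by (simp add: set_integrable_def)
  then have 2: "integrable lborel (\<lambda>x::real. indicator {0<..} (- x) * (1 / (1 + x\<^sup>2)))"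
    using lborel_integrable_real_affine[OF 1, of "-1" 0] by simp
  show ?thesis
  proof (rule Bochner_Integration.integrable_bound[OF Bochner_Integration.integrable_add[OF 1 2]])
    \<comment> \<open>The two half-lines omit the point 0, which is a null set.\<close>
    have "AE x in lborel. x \<noteq> (0::real)" by (rule AE_lborel_singleton)
    then show "AE x in lborel. norm (1 / (1 + x\<^sup>2))
        \<le> norm (indicat_real {0<..} x * (1 / (1 + x\<^sup>2)) + indicat_real {0<..} (- x) * (1 / (1 + x\<^sup>2)))"
      by eventually_elim (auto split: split_indicator)
  qed auto
qed

text \<open>Each \<open>1 + (x \<bullet> b)\<^sup>2\<close> is at most
  \<open>(1 + norm x)\<^sup>2\<close>. One such factor per coordinate explains the exponent: the
  weight is dominated by a product of integrable functions of one variable.\<close>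

lemma integrable_weight: "integrable lborel (\<lambda>x::'a::euclidean_space. 1 / (1 + norm x) ^ (2 * DIM('a)))"
proof (rule integrableI_bounded)
  have fin: "(\<integral>\<^sup>+x. ennreal (1 / (1 + x\<^sup>2)) \<partial>lborel) < \<infinity>"
    using integrable_inverse_square by (auto simp: integrable_iff_bounded)
  have "(1 / (1 + norm x) ^ (2 * DIM('a))) \<le> (\<Prod>b\<in>Basis. 1 / (1 + (x \<bullet> b)\<^sup>2))" for x :: 'a
  proof -
    have "(\<Prod>b\<in>Basis. (1 + (x \<bullet> b)\<^sup>2)) \<le> (\<Prod>b\<in>(Basis::'a set). (1 + norm x)\<^sup>2)"
    proof (rule prod_mono, intro conjI)
      fix b :: 'a assume b: "b \<in> Basis"
      have "(x \<bullet> b)\<^sup>2 \<le> (norm x)\<^sup>2"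
        using Basis_le_norm[OF b, of x] by (simp add: abs_le_square_iff[symmetric])
      also have "1 + \<dots> \<le> (1 + norm x)\<^sup>2" by (simp add: power2_sum)
      finally show "1 + (x \<bullet> b)\<^sup>2 \<le> (1 + norm x)\<^sup>2" by simp
    qed (simp add: add_nonneg_nonneg)
    moreover have "0 < (\<Prod>b\<in>Basis. (1 + (x \<bullet> b)\<^sup>2))"
      by (intro prod_pos) (auto intro: add_pos_nonneg)
    ultimately show ?thesis by (simp add: power_mult prod_dividef frac_le)
  qed
  then have "(\<integral>\<^sup>+x. ennreal (norm (1 / (1 + norm (x::'a)) ^ (2 * DIM('a)))) \<partial>lborel)
      \<le> (\<integral>\<^sup>+x. ennreal (\<Prod>b\<in>Basis. 1 / (1 + ((x::'a) \<bullet> b)\<^sup>2)) \<partial>lborel)"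
    by (intro nn_integral_mono ennreal_leI) (simp add: abs_of_nonneg)
  also have "\<dots> = (\<integral>\<^sup>+x. (\<Prod>b\<in>Basis. ennreal (1 / (1 + ((x::'a) \<bullet> b)\<^sup>2))) \<partial>lborel)"
    by (simp add: prod_ennreal)
  also have "\<dots> = (\<Prod>b\<in>(Basis::'a set). (\<integral>\<^sup>+x. ennreal (1 / (1 + x\<^sup>2)) \<partial>lborel))"
    by (subst nn_integral_lborel_prod) auto
  also have "\<dots> < \<infinity>"
    using fin by (auto simp: ennreal_prod_eq_top less_top[symmetric] power_eq_top_ennreal)
  finally show "(\<integral>\<^sup>+x. ennreal (norm (1 / (1 + norm (x::'a)) ^ (2 * DIM('a)))) \<partial>lborel) < \<infinity>" .
qed auto

lemma integrable_decay:
  fixes f :: "'a::euclidean_space \<Rightarrow> complex"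
  assumes [measurable]: "f \<in> borel_measurable borel"
    and le: "\<And>x. (1 + norm x) ^ (2 * DIM('a)) * cmod (f x) \<le> C"
  shows "integrable lborel f"
proof (rule Bochner_Integration.integrable_bound)
  show "integrable lborel (\<lambda>x::'a. C * (1 / (1 + norm x) ^ (2 * DIM('a))))"
    using integrable_weight by (rule integrable_mult_right)
  show "AE x in lborel. norm (f x) \<le> norm (C * (1 / (1 + norm x) ^ (2 * DIM('a))))"
  proof (rule AE_I2)
    fix x :: 'a
    have pos: "0 < 1 + norm x" by (simp add: add_pos_nonneg)
    have "0 \<le> C"
      using le[of x] by (meson mult_nonneg_nonneg norm_ge_zero order_trans pos zero_le_power less_imp_le)
    then show "norm (f x) \<le> norm (C * (1 / (1 + norm x) ^ (2 * DIM('a))))"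
      using le[of x] pos by (simp add: field_simps abs_of_nonneg)
  qed
qed auto

lemma continuous_borel_measurable [simp]: "continuous_on UNIV f \<Longrightarrow> f \<in> borel_measurable borel"
  by (rule borel_measurable_continuous_onI)

text \<open>Fubini for the integral of the derivative over \<open>x\<close> and over \<open>\<tau> \<in> [0, 1]\<close>: along each line the
  inner integral is \<open>f (x + b) - f x\<close>, which integrates to zero.\<close>

lemma integral_partial_deriv_eq_0:
  fixes f :: "'a::euclidean_space \<Rightarrow> complex"
  assumes diff: "\<And>x. f differentiable (at x)" and cont: "continuous_on UNIV (partial_deriv b f)"
    and int: "integrable lborel f" and int': "integrable lborel (partial_deriv b f)"
  shows "(LINT x|lborel. partial_deriv b f x) = 0"
proof -
  define D where "D = partial_deriv b f"
  have trans: "integrable lborel (\<lambda>x. g (x + v))" "(LINT x|lborel. g (x + v)) = (LINT x|lborel. g x)"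
    if "integrable lborel g" for g :: "'a \<Rightarrow> 'b::{banach, second_countable_topology}" and v
  proof -
    have [measurable]: "g \<in> borel_measurable borel"
      using that by auto
    show "(LINT x|lborel. g (x + v)) = (LINT x|lborel. g x)"
      using lborel_integral_affine[of 1 g v] by (simp add: add.commute)
    have "integrable (distr lborel borel ((+) v)) g"
      using that lborel_distr_plus[of v] by simp
    then show "integrable lborel (\<lambda>x. g (x + v))"
      by (subst (asm) integrable_distr_eq) (auto simp: add.commute)
  qed
  have cD [measurable]: "D \<in> borel_measurable borel" "continuous_on UNIV D"
    using cont by (auto simp: D_def)
  define F where "F = (\<lambda>(\<tau>::real, x). indicator {0..1} \<tau> *\<^sub>R D (x + \<tau> *\<^sub>R b))"
  have F_meas [measurable]: "F \<in> borel_measurable (lborel \<Otimes>\<^sub>M lborel)"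
    unfolding F_def by measurable
  have intD: "integrable lborel (\<lambda>x. D (x + v))" "integrable lborel (\<lambda>x. norm (D (x + v)))" for v
    using trans(1)[OF int', of v] by (auto simp: D_def)
  have normF: "(LINT x|lborel. norm (F (\<tau>, x))) = indicator {0..1} \<tau> * (LINT x|lborel. norm (D x))" for \<tau>
    using trans(2)[OF integrable_norm[OF int'], of "\<tau> *\<^sub>R b"] by (simp add: F_def D_def)
  have "integrable (lborel \<Otimes>\<^sub>M lborel) F"
  proof (rule lborel_pair.Fubini_integrable[OF F_meas])
    show "integrable lborel (\<lambda>\<tau>. LINT x|lborel. norm (F (\<tau>, x)))"
      by (simp add: normF)
    show "AE \<tau> in lborel. integrable lborel (\<lambda>x. F (\<tau>, x))"
      using intD(1) by (auto simp: F_def)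
  qed
  then have "(LINT x|lborel. LINT \<tau>|lborel. F (\<tau>, x)) = (LINT \<tau>|lborel. LINT x|lborel. F (\<tau>, x))"
    using lborel_pair.Fubini_integral[of "\<lambda>\<tau> x. F (\<tau>, x)"] by simp
  moreover have "(LINT \<tau>|lborel. F (\<tau>, x)) = f (x + b) - f x" for x
  proof -
    have "continuous_on {0..1} (\<lambda>\<tau>. D (x + \<tau> *\<^sub>R b))"
      by (intro continuous_on_compose2[OF cD(2)] continuous_intros) auto
    then show ?thesis
      using integral_FTC_atLeastAtMost[of 0 1 "\<lambda>\<tau>. f (x + \<tau> *\<^sub>R b)" "\<lambda>\<tau>. D (x + \<tau> *\<^sub>R b)"]
        has_vector_derivative_at_within[OF has_vector_derivative_partial[OF diff]]
      by (simp add: F_def D_def)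
  qed
  moreover have "(LINT x|lborel. f (x + b) - f x) = 0"
    using trans[OF int, of b] int by simp
  moreover have "(LINT x|lborel. F (\<tau>, x)) = indicator {0..1} \<tau> *\<^sub>R (LINT x|lborel. D x)" for \<tau>
    using trans(2)[OF int', of "\<tau> *\<^sub>R b"] by (simp add: F_def D_def)
  ultimately show ?thesis by (simp add: D_def)
qed

text \<open>Dominated convergence is applied to the Frechet remainder divided by the norm of the
  increment, along an arbitrary sequence of increments. The mean value inequality on the unit ball
  and the bound on the differential each contribute \<open>DIM('a) * g y\<close>.\<close>

lemma Leibniz_partial_deriv:
  fixes k :: "'a::euclidean_space \<Rightarrow> 'b \<Rightarrow> complex"
  assumes int: "\<And>z. integrable M (k z)"
    and diff: "\<And>z y. (\<lambda>z. k z y) differentiable (at z)"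
    and meas: "\<And>b z. b \<in> Basis \<Longrightarrow> (\<lambda>y. partial_deriv b (\<lambda>z. k z y) z) \<in> borel_measurable M"
    and dom: "\<And>z0. \<exists>g. integrable M g \<and>
       (\<forall>z\<in>ball z0 1. \<forall>y. \<forall>b\<in>Basis. cmod (partial_deriv b (\<lambda>z. k z y) z) \<le> g y)"
  shows "(\<lambda>z. LINT y|M. k z y) differentiable (at z0)"
    and "b \<in> Basis \<Longrightarrow> partial_deriv b (\<lambda>z. LINT y|M. k z y) z0 =
           (LINT y|M. partial_deriv b (\<lambda>z. k z y) z0)"
proof -
  obtain g where g: "integrable M g"
    and le: "\<And>z y b. z \<in> ball z0 1 \<Longrightarrow> b \<in> Basis \<Longrightarrow> cmod (partial_deriv b (\<lambda>z. k z y) z) \<le> g y"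
    using dom[of z0] by blast
  define D where "D z y v = (\<Sum>b\<in>Basis. (v \<bullet> b) *\<^sub>R partial_deriv b (\<lambda>z. k z y) z)" for z y v
  have der: "((\<lambda>z. k z y) has_derivative D z y) (at z)" for z y
    unfolding D_def by (rule has_derivative_partial_deriv[OF diff])
  have D_le: "cmod (D z y v) \<le> DIM('a) * g y * norm v" if "z \<in> ball z0 1" for z y v
  proof -
    have "cmod (D z y v) \<le> (\<Sum>b\<in>(Basis::'a set). norm v * g y)"
      unfolding D_def
    proof (rule sum_norm_le)
      fix b :: 'a assume b: "b \<in> Basis"
      show "norm ((v \<bullet> b) *\<^sub>R partial_deriv b (\<lambda>z. k z y) z) \<le> norm v * g y"
        using mult_mono[OF Basis_le_norm[OF b, of v] le[OF that b, of y]] by simp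
    qed
    then show ?thesis by (simp add: mult_ac)
  qed
  have k_le: "cmod (k z y - k z0 y) \<le> DIM('a) * g y * norm (z - z0)" if "z \<in> ball z0 1" for z y
  proof (rule differentiable_bound[of "ball z0 1" "\<lambda>z. k z y" "\<lambda>z. D z y"])
    show "onorm (D x y) \<le> DIM('a) * g y" if "x \<in> ball z0 1" for x
      using D_le[OF that] by (intro onorm_le) (simp add: mult_ac)
  qed (use that der in \<open>auto intro: has_derivative_at_withinI\<close>)
  have int_p: "integrable M (\<lambda>y. partial_deriv b (\<lambda>z. k z y) z0)" if "b \<in> Basis" for b
    by (rule Bochner_Integration.integrable_bound[OF g meas[OF that]])
      (use le[of z0 b] that in \<open>auto intro!: AE_I2 intro: order_trans[OF _ abs_ge_self]\<close>)
  define P where "P v = (\<Sum>b\<in>Basis. (v \<bullet> b) *\<^sub>R (LINT y|M. partial_deriv b (\<lambda>z. k z y) z0))" for v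
  have int_D: "integrable M (\<lambda>y. D z0 y v)" and P_eq: "P v = (LINT y|M. D z0 y v)" for v
    unfolding D_def P_def using int_p by (auto simp: integral_sum)
  have "((\<lambda>z. LINT y|M. k z y) has_derivative P) (at z0)"
    unfolding has_derivative_at
  proof
    show "bounded_linear P"
      unfolding P_def
      by (intro bounded_linear_sum bounded_linear_compose[OF bounded_linear_scaleR_left]
          bounded_linear_inner_left)
    show "(\<lambda>h. norm ((LINT y|M. k (z0 + h) y) - (LINT y|M. k z0 y) - P h) / norm h) \<midarrow>0\<rightarrow> 0"
      unfolding tendsto_at_iff_sequentially o_def
    proof (intro allI impI)
      fix X :: "nat \<Rightarrow> 'a"
      assume X: "\<forall>i. X i \<in> UNIV - {0}" "X \<longlonglongrightarrow> 0"
      have ev: "\<forall>\<^sub>F i in sequentially. norm (X i) < 1"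
        using X(2) by (auto simp: tendsto_iff)
      \<comment> \<open>Setting the quotient to 0 for increments of norm at least 1 makes the
        domination valid for every index; only finitely many indices are affected.\<close>
      define R where "R i y = (if norm (X i) < 1 then
         (k (z0 + X i) y - k z0 y - D z0 y (X i)) /\<^sub>R norm (X i) else 0)" for i y
      have "(\<lambda>i. LINT y|M. R i y) \<longlonglongrightarrow> (LINT y|M. 0)"
      proof (rule integral_dominated_convergence[where w = "\<lambda>y. 2 * DIM('a) * g y"])
        show "AE y in M. (\<lambda>i. R i y) \<longlonglongrightarrow> 0"
        proof (rule AE_I2)
          fix y
          have "(\<lambda>h. norm (k (z0 + h) y - k z0 y - D z0 y h) / norm h) \<midarrow>0\<rightarrow> 0"
            using der[where z=z0 and y=y] by (simp add: has_derivative_at)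
          then have "(\<lambda>i. norm (k (z0 + X i) y - k z0 y - D z0 y (X i)) / norm (X i)) \<longlonglongrightarrow> 0"
            using X unfolding tendsto_at_iff_sequentially o_def by blast
          moreover have "\<forall>\<^sub>F i in sequentially. norm (R i y) \<le>
              norm (k (z0 + X i) y - k z0 y - D z0 y (X i)) / norm (X i)"
            by (rule always_eventually) (auto simp: R_def divide_inverse mult.commute)
          ultimately show "(\<lambda>i. R i y) \<longlonglongrightarrow> 0"
            by (rule Lim_null_comparison[rotated])
        qed
        show "AE y in M. norm (R i y) \<le> 2 * DIM('a) * g y" for i
        proof (rule AE_I2)
          fix y
          have g0: "0 \<le> g y"
            using le[of z0 "SOME b. b \<in> Basis" y] norm_ge_zero order_trans
            by (metis centre_in_ball ex_in_conv nonempty_Basis someI_ex zero_less_one)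
          show "norm (R i y) \<le> 2 * DIM('a) * g y"
          proof (cases "norm (X i) < 1")
            case True
            have "norm (k (z0 + X i) y - k z0 y - D z0 y (X i)) \<le>
                DIM('a) * g y * norm (X i) + DIM('a) * g y * norm (X i)"
              using k_le[of "z0 + X i" y] D_le[of z0 y "X i"] True
              by (intro order_trans[OF norm_triangle_ineq4 add_mono]) (auto simp: dist_norm)
            moreover have "norm (R i y) = norm (k (z0 + X i) y - k z0 y - D z0 y (X i)) / norm (X i)"
              using True by (simp add: R_def divide_inverse mult.commute)
            ultimately show ?thesis
              using X(1) by (simp add: divide_le_eq algebra_simps)
          qed (use g0 in \<open>auto simp: R_def\<close>)
        qed
        show "R i \<in> borel_measurable M" for i
          using borel_measurable_integrable[OF int] borel_measurable_integrable[OF int_D]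
          unfolding R_def by (cases "norm (X i) < 1") auto
      qed (use g in auto)
      then have "(\<lambda>i. norm (LINT y|M. R i y)) \<longlonglongrightarrow> 0"
        using tendsto_norm by fastforce
      moreover have "\<forall>\<^sub>F i in sequentially. norm (LINT y|M. R i y) =
          norm ((LINT y|M. k (z0 + X i) y) - (LINT y|M. k z0 y) - P (X i)) / norm (X i)"
        using ev
      proof eventually_elim
        case (elim i)
        then have "(LINT y|M. R i y) = (LINT y|M. (k (z0 + X i) y - k z0 y - D z0 y (X i))) /\<^sub>R norm (X i)"
          by (simp add: R_def)
        also have "\<dots> = ((LINT y|M. k (z0 + X i) y) - (LINT y|M. k z0 y) - P (X i)) /\<^sub>R norm (X i)"
          using int int_D by (simp add: P_eq)
        finally show ?case by (simp add: divide_inverse mult.commute)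
      qed
      ultimately show "(\<lambda>i. norm ((LINT y|M. k (z0 + X i) y) - (LINT y|M. k z0 y) - P (X i)) / norm (X i))
          \<longlonglongrightarrow> 0"
        by (rule Lim_transform_eventually)
    qed
  qed
  then show "(\<lambda>z. LINT y|M. k z y) differentiable (at z0)"
    and "b \<in> Basis \<Longrightarrow> partial_deriv b (\<lambda>z. LINT y|M. k z y) z0 =
           (LINT y|M. partial_deriv b (\<lambda>z. k z y) z0)"
    by (auto simp: differentiable_def partial_deriv_eq P_eq D_def inner_Basis if_distrib[of "\<lambda>r. r *\<^sub>R _"] cong: if_cong)
qed

subsection \<open>The Fourier transform\<close>

lemma has_derivative_cis_inner:
  "((\<lambda>x. cis (x \<bullet> \<eta>)) has_derivative (\<lambda>v. \<i> * (v \<bullet> \<eta>) * cis (x \<bullet> \<eta>))) (at x)"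
proof -
  have "((\<lambda>x. cis (x \<bullet> \<eta>)) has_derivative (\<lambda>v. (v \<bullet> \<eta>) *\<^sub>R (\<i> * cis (x \<bullet> \<eta>)))) (at x)"
  proof (rule has_derivative_compose[of "\<lambda>x. x \<bullet> \<eta>" "\<lambda>v. v \<bullet> \<eta>" x UNIV cis "\<lambda>t. t *\<^sub>R (\<i> * cis (x \<bullet> \<eta>))"])
    show "((\<lambda>x. x \<bullet> \<eta>) has_derivative (\<lambda>v. v \<bullet> \<eta>)) (at x)"
      by (auto intro!: derivative_eq_intros)
    have "(cis has_vector_derivative \<i> * cis (x \<bullet> \<eta>)) (at (x \<bullet> \<eta>))"
      unfolding cis_conv_exp
      by (auto intro!: derivative_eq_intros has_vector_derivative_real_field simp: mult.commute)
    then show "(cis has_derivative (\<lambda>t. t *\<^sub>R (\<i> * cis (x \<bullet> \<eta>)))) (at (x \<bullet> \<eta>))"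
      by (simp add: has_vector_derivative_def)
  qed
  then show ?thesis by (simp add: scaleR_conv_of_real mult_ac)
qed

lemma cis_inner_differentiable [simp]: "(\<lambda>x. cis (x \<bullet> \<eta>)) differentiable (at x)"
  using has_derivative_cis_inner by (auto simp: differentiable_def)

lemma partial_deriv_cis_inner [simp]:
  "partial_deriv b (\<lambda>x. cis (x \<bullet> \<eta>)) = (\<lambda>x. \<i> * (b \<bullet> \<eta>) * cis (x \<bullet> \<eta>))"
  by (rule ext, rule partial_deriv_eq[OF has_derivative_cis_inner])

lemma smooth_cis_inner [simp]: "smooth (\<lambda>x. cis (x \<bullet> \<eta>))"
proof (rule smooth_coinduct(1)[of _ "range (\<lambda>c x. c * cis (x \<bullet> \<eta>))"])
  show "(\<lambda>x. cis (x \<bullet> \<eta>)) \<in> range (\<lambda>c x. c * cis (x \<bullet> \<eta>))"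
    by (auto intro: image_eqI[of _ _ 1])
qed (auto simp: partial_deriv_mult mult.assoc[symmetric])

lemma jet_bound_cis_inner: "\<exists>C. \<forall>x. jet_bound K (\<lambda>x. cis (x \<bullet> \<eta>)) x C"
proof (intro exI allI)
  show "jet_bound K (\<lambda>x. cis (x \<bullet> \<eta>)) x ((1 + norm \<eta>) ^ K)" for x
  proof (induction K)
    case (Suc K)
    have "jet_bound K (\<lambda>x. \<i> * (b \<bullet> \<eta>) * cis (x \<bullet> \<eta>)) x ((1 + norm \<eta>) ^ Suc K)"
      if "b \<in> Basis" for b
    proof (rule jet_bound_mono[OF jet_bound_cmult[OF _ Suc]])
      show "cmod (\<i> * (b \<bullet> \<eta>)) * (1 + norm \<eta>) ^ K \<le> (1 + norm \<eta>) ^ Suc K"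
        using Basis_le_norm[OF that, of \<eta>]
        by (auto simp: norm_mult inner_commute intro!: mult_right_mono)
    qed auto
    then show ?case by (simp add: jet_bound_Suc one_le_power del: power_Suc)
  qed simp
qed

lemma continuous_cis_inner [continuous_intros]:
  "continuous_on S f \<Longrightarrow> continuous_on S g \<Longrightarrow> continuous_on S (\<lambda>x. cis (f x \<bullet> g x))"
  unfolding cis_conv_exp by (intro continuous_intros)

lemma integrable_mult_cis:
  assumes "integrable lborel f"
  shows "integrable lborel (\<lambda>x::'a::euclidean_space. f x * cis (x \<bullet> \<sigma>))"
proof (rule Bochner_Integration.integrable_bound[OF integrable_norm[OF assms]])
  have "(\<lambda>x. cis (x \<bullet> \<sigma>)) \<in> borel_measurable borel"
    by (intro continuous_borel_measurable continuous_intros)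
  then show "(\<lambda>x. f x * cis (x \<bullet> \<sigma>)) \<in> borel_measurable lborel"
    using assms by auto
qed (auto simp: norm_mult)

text \<open>Integration by parts: the derivative of \<open>G x * cis (x \<bullet> \<sigma>)\<close>
  has integral zero, which trades a factor \<open>\<sigma> \<bullet> b\<close> for a derivative of
  \<open>G\<close>.\<close>

lemma fourier_integral_decay:
  fixes G :: "'a::euclidean_space \<Rightarrow> complex"
  assumes "smooth G" and b: "b \<in> Basis"
    and "\<And>i. i \<le> k \<Longrightarrow> integrable lborel (partial_derivs (replicate i b) G)"
  shows "\<bar>\<sigma> \<bullet> b\<bar> ^ k * cmod (LINT x|lborel. G x * cis (x \<bullet> \<sigma>))
      \<le> (LINT x|lborel. cmod (partial_derivs (replicate k b) G x))"
  using assms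
proof (induction k arbitrary: G)
  case 0
  then show ?case
    using integral_norm_bound[of lborel "\<lambda>x. G x * cis (x \<bullet> \<sigma>)"] by (simp add: norm_mult)
next
  case (Suc k)
  note G = \<open>smooth G\<close>
  have rep: "partial_derivs (replicate i b) (partial_deriv b G) = partial_derivs (replicate (Suc i) b) G" for i
  proof -
    have "replicate (Suc i) b = replicate i b @ [b]" by (simp add: replicate_append_same)
    then show ?thesis by (simp only: partial_derivs_append partial_derivs_simps)
  qed
  have int: "integrable lborel G" "integrable lborel (partial_deriv b G)"
    using Suc.prems(3)[of 0] Suc.prems(3)[of 1] by simp_all
  define F where "F = (\<lambda>x. G x * cis (x \<bullet> \<sigma>))"
  have F': "partial_deriv b F = (\<lambda>x. partial_deriv b G x * cis (x \<bullet> \<sigma>) + \<i> * (b \<bullet> \<sigma>) * (G x * cis (x \<bullet> \<sigma>)))"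
    unfolding F_def by (subst partial_deriv_mult) (auto simp: smoothD[OF G] mult_ac)
  have "smooth F"
    unfolding F_def by (intro smooth_mult G smooth_cis_inner)
  then have "(LINT x|lborel. partial_deriv b F x) = 0"
  proof (intro integral_partial_deriv_eq_0 smooth_continuous_on smoothD b)
    show "integrable lborel F"
      unfolding F_def by (intro integrable_mult_cis int)
    show "integrable lborel (partial_deriv b F)"
      unfolding F' by (intro Bochner_Integration.integrable_add integrable_mult_right integrable_mult_cis int)
  qed
  then have "(LINT x|lborel. partial_deriv b G x * cis (x \<bullet> \<sigma>)) = - \<i> * (b \<bullet> \<sigma>) * (LINT x|lborel. G x * cis (x \<bullet> \<sigma>))"
    using int by (simp add: F' integrable_mult_cis add_eq_0_iff)
  then have "\<bar>\<sigma> \<bullet> b\<bar> ^ Suc k * cmod (LINT x|lborel. G x * cis (x \<bullet> \<sigma>))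
     = \<bar>\<sigma> \<bullet> b\<bar> ^ k * cmod (LINT x|lborel. partial_deriv b G x * cis (x \<bullet> \<sigma>))"
    by (simp add: norm_mult inner_commute)
  also have "\<dots> \<le> (LINT x|lborel. cmod (partial_derivs (replicate k b) (partial_deriv b G) x))"
    using Suc.prems(3)[of "Suc _"] b smoothD(2)[OF G] by (intro Suc.IH) (auto simp: rep)
  finally show ?case by (simp add: rep)
qed

text \<open>Integration by parts gives decay in one coordinate at a time. The largest coordinate
  controls the norm up to the dimension, and \<open>max 1 m\<close> takes care of small
  vectors.\<close>

lemma one_plus_norm_power_le:
  fixes x :: "'a::euclidean_space"
  shows "(1 + norm x) ^ k \<le> (1 + DIM('a)) ^ k * (1 + (\<Sum>b\<in>Basis. \<bar>x \<bullet> b\<bar> ^ k))"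
proof -
  define m where "m = Max ((\<lambda>b. \<bar>x \<bullet> b\<bar>) ` Basis)"
  have fin: "finite ((\<lambda>b. \<bar>x \<bullet> b\<bar>) ` (Basis::'a set))" "(\<lambda>b. \<bar>x \<bullet> b\<bar>) ` (Basis::'a set) \<noteq> {}"
    by auto
  have "norm x \<le> (\<Sum>b\<in>Basis. \<bar>x \<bullet> b\<bar>)" by (rule norm_le_l1)
  also have "\<dots> \<le> (\<Sum>b\<in>(Basis::'a set). m)"
    unfolding m_def by (intro sum_mono Max_ge) auto
  finally have "norm x \<le> DIM('a) * m" by simp
  moreover obtain b where b: "b \<in> Basis" "m = \<bar>x \<bullet> b\<bar>"
    using Max_in[OF fin] unfolding m_def by blast
  moreover have "DIM('a) * m \<le> DIM('a) * max 1 m" by (intro mult_left_mono) auto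
  ultimately have "1 + norm x \<le> max 1 m + DIM('a) * max 1 m" by linarith
  then have "1 + norm x \<le> (1 + DIM('a)) * max 1 m" by (simp add: algebra_simps)
  then have "(1 + norm x) ^ k \<le> ((1 + DIM('a)) * max 1 m) ^ k" by (intro power_mono) auto
  also have "\<dots> = (1 + DIM('a)) ^ k * (max 1 m) ^ k" by (simp add: power_mult_distrib)
  also have "(max 1 m) ^ k \<le> 1 + m ^ k"
    using b by (cases "1 \<le> m") (auto simp: max_def)
  also have "m ^ k \<le> (\<Sum>b\<in>Basis. \<bar>x \<bullet> b\<bar> ^ k)"
    using b by (auto intro!: member_le_sum)
  finally show ?thesis by (simp add: mult_left_mono)
qed

subsection \<open>Fourier inversion\<close>

lemma lborel_integrable_affine:
  fixes f :: "'a::euclidean_space \<Rightarrow> 'b::{banach, second_countable_topology}"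
  assumes c: "c > 0" and f: "integrable lborel f"
  shows "integrable lborel (\<lambda>x. f (t + c *\<^sub>R x))"
proof (rule integrableI_bounded)
  have [measurable]: "f \<in> borel_measurable borel"
    using f by auto
  show "(\<lambda>x. f (t + c *\<^sub>R x)) \<in> borel_measurable lborel" by measurable
  have "(\<integral>\<^sup>+x. norm (f x) \<partial>lborel) < \<infinity>"
    using f by (simp add: integrable_iff_bounded)
  then show "(\<integral>\<^sup>+x. norm (f (t + c *\<^sub>R x)) \<partial>lborel) < \<infinity>"
    using c by (subst (asm) nn_integral_lborel_affine[OF c, of _ t]) (auto simp: ennreal_mult_less_top ennreal_mult_eq_top_iff less_top[symmetric])
qed

section \<open>Gaussians and their Fourier transforms\<close>

definition gaussian :: "'a::euclidean_space \<Rightarrow> real" where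
  "gaussian x = exp (- (norm x)\<^sup>2 / 2)"

lemma continuous_gaussian [continuous_intros]:
  "continuous_on S f \<Longrightarrow> continuous_on S (\<lambda>x. gaussian (f x))"
  unfolding gaussian_def by (intro continuous_intros) auto

lemma gaussian_le_1: "gaussian x \<le> 1" and gaussian_nonneg: "0 \<le> gaussian x"
  and gaussian_0 [simp]: "gaussian 0 = 1"
  by (auto simp: gaussian_def)

text \<open>The Gaussian is \<open>sqrt (2 * pi)\<close> times the standard normal density, whose
  characteristic function is known.\<close>

lemma gaussian_fourier_1d:
  "integrable lborel (\<lambda>x::real. complex_of_real (exp (- x\<^sup>2 / 2)) * cis (x * t))"
  "(LINT x|lborel. complex_of_real (exp (- x\<^sup>2 / 2)) * cis (x * t)) = sqrt (2 * pi) * exp (- t\<^sup>2 / 2)"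
proof -
  have eq: "complex_of_real (exp (- x\<^sup>2 / 2)) * cis (x * t) =
      sqrt (2 * pi) * (std_normal_density x *\<^sub>R iexp (t * x))" for x :: real
    by (simp add: std_normal_density_def cis_conv_exp scaleR_conv_of_real mult_ac)
  have "integrable std_normal_distribution (\<lambda>x. iexp (t * x))"
  proof -
    interpret real_distribution std_normal_distribution
      by (rule real_dist_normal_dist)
    show ?thesis by (intro integrable_const_bound[of _ 1] AE_I2) auto
  qed
  then have "integrable lborel (\<lambda>x. std_normal_density x *\<^sub>R iexp (t * x))"
    by (subst (asm) integrable_density) auto
  then show "integrable lborel (\<lambda>x::real. complex_of_real (exp (- x\<^sup>2 / 2)) * cis (x * t))"
    unfolding eq by (rule integrable_mult_right)
  have "(LINT x|lborel. std_normal_density x *\<^sub>R iexp (t * x)) = char std_normal_distribution t"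
    unfolding char_def by (subst integral_density) auto
  then show "(LINT x|lborel. complex_of_real (exp (- x\<^sup>2 / 2)) * cis (x * t)) = sqrt (2 * pi) * exp (- t\<^sup>2 / 2)"
    unfolding eq by (subst integral_mult_right_zero) (simp only: char_std_normal_distribution of_real_mult)
qed

text \<open>Gaussian and character both factor over the coordinates, and Lebesgue measure is the
  image of a product measure, so the one-dimensional case suffices.\<close>

lemma gaussian_fourier:
  fixes \<sigma> :: "'a::euclidean_space"
  shows "integrable lborel (\<lambda>x. complex_of_real (gaussian x) * cis (x \<bullet> \<sigma>))" (is ?A)
    and "(LINT x|lborel. complex_of_real (gaussian x) * cis (x \<bullet> \<sigma>)) =
      complex_of_real (sqrt (2 * pi) ^ DIM('a) * gaussian \<sigma>)" (is ?B)
proof -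
  interpret P: product_sigma_finite "\<lambda>_::'a. lborel :: real measure"
    by standard
  define f where "f = (\<lambda>x. complex_of_real (gaussian x) * cis (x \<bullet> \<sigma>))"
  have [measurable]: "f \<in> borel_measurable borel"
    unfolding f_def by (intro continuous_borel_measurable continuous_intros)
  have sumsq: "(norm x)\<^sup>2 = (\<Sum>b\<in>Basis. (x \<bullet> b)\<^sup>2)" for x :: 'a
    unfolding power2_norm_eq_inner by (subst euclidean_inner) (simp add: power2_eq_square)
  have prod_gaussian: "gaussian x = (\<Prod>b\<in>Basis. exp (- (x \<bullet> b)\<^sup>2 / 2))" for x :: 'a
    by (simp add: gaussian_def exp_sum[symmetric] sumsq sum_negf sum_divide_distrib)
  have prod_cis: "cis (\<Sum>b\<in>A. g b) = (\<Prod>b\<in>A. cis (g b))" for g :: "'a \<Rightarrow> real" and A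
    by (induction A rule: infinite_finite_induct) (auto simp: cis_mult[symmetric])
  have f_eq: "f (\<Sum>b\<in>Basis. y b *\<^sub>R b) =
      (\<Prod>b\<in>Basis. complex_of_real (exp (- (y b)\<^sup>2 / 2)) * cis (y b * (\<sigma> \<bullet> b)))" for y :: "'a \<Rightarrow> real"
  proof -
    have *: "(\<Sum>b\<in>Basis. y b *\<^sub>R b) \<bullet> c = y c" if "c \<in> Basis" for c
      using that by (simp add: inner_sum_left inner_Basis if_distrib cong: if_cong)
    have "(\<Sum>b\<in>Basis. y b *\<^sub>R b) \<bullet> \<sigma> = (\<Sum>b\<in>Basis. y b * (\<sigma> \<bullet> b))"
      by (simp add: inner_sum_left) (simp add: inner_commute)
    then show ?thesis by (simp add: f_def prod_gaussian * prod_cis prod.distrib)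
  qed
  note int = P.product_integrable_prod[of "Basis::'a set"
      "\<lambda>b x. complex_of_real (exp (- x\<^sup>2 / 2)) * cis (x * (\<sigma> \<bullet> b))", OF finite_Basis gaussian_fourier_1d(1)]
  show ?A
    unfolding f_def[symmetric]
    by (subst lborel_eq, subst integrable_distr_eq) (use int in \<open>auto simp: f_eq\<close>)
  have "(LINT x|lborel. f x) = (LINT y|(\<Pi>\<^sub>M b\<in>(Basis::'a set). lborel).
     (\<Prod>b\<in>Basis. complex_of_real (exp (- (y b)\<^sup>2 / 2)) * cis (y b * (\<sigma> \<bullet> b))))"
    by (subst lborel_eq, subst integral_distr) (auto simp: f_eq)
  also have "\<dots> = (\<Prod>b\<in>(Basis::'a set). LINT x|lborel. complex_of_real (exp (- x\<^sup>2 / 2)) * cis (x * (\<sigma> \<bullet> b)))"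
    by (rule P.product_integral_prod[OF finite_Basis gaussian_fourier_1d(1)])
  also have "\<dots> = (\<Prod>b\<in>(Basis::'a set). complex_of_real (sqrt (2 * pi) * exp (- (\<sigma> \<bullet> b)\<^sup>2 / 2)))"
    by (simp only: gaussian_fourier_1d(2))
  also have "\<dots> = complex_of_real (sqrt (2 * pi) ^ DIM('a) * gaussian \<sigma>)"
    by (simp add: prod.distrib prod_gaussian)
  finally show ?B by (simp only: f_def)
qed

lemma integrable_gaussian: "integrable lborel (gaussian :: 'a::euclidean_space \<Rightarrow> real)"
  and integral_gaussian: "(LINT x|lborel. gaussian (x::'a::euclidean_space)) = sqrt (2 * pi) ^ DIM('a)"
proof -
  have "integrable lborel (\<lambda>x::'a. complex_of_real (gaussian x))"
    using gaussian_fourier(1)[of 0] by simp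
  then show "integrable lborel (gaussian :: 'a::euclidean_space \<Rightarrow> real)"
    by (simp add: complex_of_real_integrable_eq)
  have "complex_of_real (LINT x|lborel. gaussian (x::'a::euclidean_space)) = sqrt (2 * pi) ^ DIM('a)"
    using gaussian_fourier(2)[of "0::'a"] by simp
  then show "(LINT x|lborel. gaussian (x::'a::euclidean_space)) = sqrt (2 * pi) ^ DIM('a)"
    using of_real_eq_iff by fastforce
qed

text \<open>Gaussian regularization: \<open>gaussian (\<epsilon>\<zeta>)\<close> is inserted as a convergence factor, which allows the order
  of integration to be exchanged, and \<open>\<epsilon>\<close> tends to 0.\<close>

theorem fourier_inversion_integral:
  fixes f :: "'a::euclidean_space \<Rightarrow> complex"
  assumes cont: "continuous_on UNIV f" and B: "\<And>x. cmod (f x) \<le> B" and int: "integrable lborel f"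
    and int': "integrable lborel (\<lambda>\<zeta>. LINT y|lborel. f y * cis (- (y \<bullet> \<zeta>)))"
  shows "(LINT \<zeta>|lborel. (LINT y|lborel. f y * cis (- (y \<bullet> \<zeta>))) * cis (s \<bullet> \<zeta>)) = (2 * pi) ^ DIM('a) * f s"
proof -
  define F where "F = (\<lambda>\<zeta>. LINT y|lborel. f y * cis (- (y \<bullet> \<zeta>)))"
  have intF: "integrable lborel F"
    using int' by (simp add: F_def)
  have [measurable]: "f \<in> borel_measurable borel" "F \<in> borel_measurable borel"
    using cont intF by auto
  have gauss [measurable]: "(gaussian :: 'a \<Rightarrow> real) \<in> borel_measurable borel"
    by (rule continuous_borel_measurable[OF continuous_gaussian[OF continuous_on_id]])
  have cis_meas [measurable]: "(\<lambda>p::'a \<times> 'a. cis (fst p \<bullet> snd p)) \<in> borel_measurable borel"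
    by (intro continuous_borel_measurable continuous_intros)
  have cis_meas' [measurable]: "(\<lambda>x. cis (x \<bullet> v)) \<in> borel_measurable borel"
     "(\<lambda>x. cis (v \<bullet> x)) \<in> borel_measurable borel" for v :: 'a
    by (intro continuous_borel_measurable continuous_intros)+
  define \<epsilon> where "\<epsilon> j = 1 / real (Suc j)" for j
  have \<epsilon>: "\<epsilon> j > 0" for j by (simp add: \<epsilon>_def)
  have \<epsilon>_lim: "\<epsilon> \<longlonglongrightarrow> 0"
    unfolding \<epsilon>_def by (rule LIMSEQ_Suc) (rule lim_1_over_n)
  define A where "A j = (LINT \<zeta>|lborel. F \<zeta> * cis (s \<bullet> \<zeta>) * gaussian (\<epsilon> j *\<^sub>R \<zeta>))" for j
  have "A \<longlonglongrightarrow> (LINT \<zeta>|lborel. F \<zeta> * cis (s \<bullet> \<zeta>))"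
    unfolding A_def
  proof (rule integral_dominated_convergence[where w = "\<lambda>\<zeta>. cmod (F \<zeta>)"])
    show "AE \<zeta> in lborel. (\<lambda>j. F \<zeta> * cis (s \<bullet> \<zeta>) * complex_of_real (gaussian (\<epsilon> j *\<^sub>R \<zeta>))) \<longlonglongrightarrow> F \<zeta> * cis (s \<bullet> \<zeta>)"
    proof (rule AE_I2)
      fix \<zeta> :: 'a
      have "(\<lambda>j. exp (- (norm (\<epsilon> j *\<^sub>R \<zeta>))\<^sup>2 / 2)) \<longlonglongrightarrow> exp (- (norm (0 *\<^sub>R \<zeta>))\<^sup>2 / 2)"
        by (intro tendsto_intros \<epsilon>_lim) auto
      then have "(\<lambda>j. gaussian (\<epsilon> j *\<^sub>R \<zeta>)) \<longlonglongrightarrow> 1"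
        by (simp add: gaussian_def)
      then have "(\<lambda>j. F \<zeta> * cis (s \<bullet> \<zeta>) * complex_of_real (gaussian (\<epsilon> j *\<^sub>R \<zeta>))) \<longlonglongrightarrow> F \<zeta> * cis (s \<bullet> \<zeta>) * complex_of_real 1"
        by (intro tendsto_intros)
      then show "(\<lambda>j. F \<zeta> * cis (s \<bullet> \<zeta>) * complex_of_real (gaussian (\<epsilon> j *\<^sub>R \<zeta>))) \<longlonglongrightarrow> F \<zeta> * cis (s \<bullet> \<zeta>)"
        by simp
    qed
    show "AE \<zeta> in lborel. norm (F \<zeta> * cis (s \<bullet> \<zeta>) * complex_of_real (gaussian (\<epsilon> j *\<^sub>R \<zeta>))) \<le> cmod (F \<zeta>)" for j
      by (auto simp: norm_mult abs_of_nonneg gaussian_nonneg gaussian_le_1 intro!: AE_I2 mult_left_le)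
  qed (use intF in auto)
  \<comment> \<open>After Fubini the frequency integral is an explicit Gaussian transform;
    substituting \<open>y = s + \<epsilon> j *\<^sub>R z\<close> exhibits \<open>A j\<close> as a
    Gaussian average of \<open>f\<close> around \<open>s\<close>.\<close>
  moreover have "A j = sqrt (2 * pi) ^ DIM('a) * (LINT z|lborel. f (s + \<epsilon> j *\<^sub>R z) * gaussian z)" for j
  proof -
    define k where "k = (\<lambda>(\<zeta>, y). f y * cis (\<zeta> \<bullet> (s - y)) * gaussian (\<epsilon> j *\<^sub>R \<zeta>))"
    have k_meas [measurable]: "k \<in> borel_measurable (lborel \<Otimes>\<^sub>M lborel)"
    proof -
      have "k \<in> borel_measurable borel"
        unfolding k_def case_prod_beta
        by (intro continuous_borel_measurable continuous_intros continuous_on_compose2[OF cont]) auto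
      then show ?thesis by (simp add: lborel_prod)
    qed
    have int_g: "integrable lborel (\<lambda>\<zeta>::'a. gaussian (\<epsilon> j *\<^sub>R \<zeta>))"
      using lborel_integrable_affine[OF \<epsilon> integrable_gaussian, of 0 j] by simp
    have norm_k: "cmod (k (\<zeta>, y)) = gaussian (\<epsilon> j *\<^sub>R \<zeta>) * cmod (f y)" for \<zeta> y
      by (simp add: k_def norm_mult gaussian_nonneg)
    have "integrable (lborel \<Otimes>\<^sub>M lborel) k"
    proof (rule lborel_pair.Fubini_integrable[OF k_meas])
      show "integrable lborel (\<lambda>\<zeta>. LINT y|lborel. norm (k (\<zeta>, y)))"
        using int int_g by (simp add: norm_k)
      show "AE \<zeta> in lborel. integrable lborel (\<lambda>y. k (\<zeta>, y))"
      proof (rule AE_I2)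
        fix \<zeta> :: 'a
        show "integrable lborel (\<lambda>y. k (\<zeta>, y))"
          by (rule Bochner_Integration.integrable_bound[of _ "\<lambda>y. gaussian (\<epsilon> j *\<^sub>R \<zeta>) * cmod (f y)"])
            (use int in \<open>auto simp: norm_k\<close>)
      qed
    qed
    then have swap: "(LINT \<zeta>|lborel. LINT y|lborel. k (\<zeta>, y)) = (LINT y|lborel. LINT \<zeta>|lborel. k (\<zeta>, y))"
      using lborel_pair.Fubini_integral[of "\<lambda>\<zeta> y. k (\<zeta>, y)"] by simp
    have "F \<zeta> * cis (s \<bullet> \<zeta>) * gaussian (\<epsilon> j *\<^sub>R \<zeta>) = (LINT y|lborel. k (\<zeta>, y))" for \<zeta>
    proof -
      have "k (\<zeta>, y) = f y * cis (- (y \<bullet> \<zeta>)) * (cis (s \<bullet> \<zeta>) * gaussian (\<epsilon> j *\<^sub>R \<zeta>))" for y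
      proof -
        have "cis (\<zeta> \<bullet> (s - y)) = cis (- (y \<bullet> \<zeta>)) * cis (s \<bullet> \<zeta>)"
          by (simp add: cis_mult inner_diff_right inner_commute)
        then show ?thesis by (simp add: k_def)
      qed
      then have "(LINT y|lborel. k (\<zeta>, y)) = F \<zeta> * (cis (s \<bullet> \<zeta>) * gaussian (\<epsilon> j *\<^sub>R \<zeta>))"
        by (simp add: F_def)
      then show ?thesis by (simp add: mult.assoc)
    qed
    then have "A j = (LINT y|lborel. LINT \<zeta>|lborel. k (\<zeta>, y))" by (simp add: A_def swap)
    also have "\<dots> = (LINT y|lborel. f y * (sqrt (2 * pi) ^ DIM('a) * gaussian ((1 / \<epsilon> j) *\<^sub>R (s - y)) / \<epsilon> j ^ DIM('a)))"
    proof (rule Bochner_Integration.integral_cong[OF refl])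
      fix y
      have "(LINT \<zeta>|lborel. k (\<zeta>, y)) = f y * (LINT \<zeta>|lborel. complex_of_real (gaussian (\<epsilon> j *\<^sub>R \<zeta>)) * cis (\<zeta> \<bullet> (s - y)))"
        by (simp add: k_def mult_ac)
      also have "(LINT \<zeta>|lborel. complex_of_real (gaussian (\<epsilon> j *\<^sub>R \<zeta>)) * cis (\<zeta> \<bullet> (s - y))) =
        (1 / \<epsilon> j) ^ DIM('a) *\<^sub>R (LINT \<zeta>|lborel. complex_of_real (gaussian \<zeta>) * cis (\<zeta> \<bullet> ((1 / \<epsilon> j) *\<^sub>R (s - y))))"
        using \<epsilon>[of j] by (subst lborel_integral_affine[of "1 / \<epsilon> j" _ 0]) auto
      also note gaussian_fourier(2)
      finally show "(LINT \<zeta>|lborel. k (\<zeta>, y)) =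
        f y * (sqrt (2 * pi) ^ DIM('a) * gaussian ((1 / \<epsilon> j) *\<^sub>R (s - y)) / \<epsilon> j ^ DIM('a))"
        by (simp add: scaleR_conv_of_real power_one_over)
    qed
    also have "\<dots> = (LINT z|lborel. f (s + \<epsilon> j *\<^sub>R z) * (sqrt (2 * pi) ^ DIM('a) * gaussian z))"
      using \<epsilon>[of j] by (subst lborel_integral_affine[of "\<epsilon> j" _ s]) (auto simp: scaleR_conv_of_real gaussian_def)
    also have "\<dots> = sqrt (2 * pi) ^ DIM('a) * (LINT z|lborel. f (s + \<epsilon> j *\<^sub>R z) * gaussian z)"
      by (subst integral_mult_right_zero[symmetric], intro Bochner_Integration.integral_cong) (auto simp: mult_ac)
    finally show ?thesis .
  qed
  moreover have "(\<lambda>j. sqrt (2 * pi) ^ DIM('a) * (LINT z|lborel. f (s + \<epsilon> j *\<^sub>R z) * gaussian z))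
      \<longlonglongrightarrow> sqrt (2 * pi) ^ DIM('a) * (LINT z|lborel. f s * gaussian (z::'a))"
  proof (intro tendsto_mult_left integral_dominated_convergence[where w = "\<lambda>z. B * gaussian z"])
    show "AE z in lborel. (\<lambda>j. f (s + \<epsilon> j *\<^sub>R z) * complex_of_real (gaussian z)) \<longlonglongrightarrow> f s * gaussian z"
    proof (rule AE_I2)
      fix z :: 'a
      have "(\<lambda>j. s + \<epsilon> j *\<^sub>R z) \<longlonglongrightarrow> s + 0 *\<^sub>R z"
        by (intro tendsto_intros \<epsilon>_lim)
      then have "(\<lambda>j. f (s + \<epsilon> j *\<^sub>R z)) \<longlonglongrightarrow> f s"
        using cont continuous_on_tendsto_compose[of UNIV f _ s] by fastforce
      then show "(\<lambda>j. f (s + \<epsilon> j *\<^sub>R z) * complex_of_real (gaussian z)) \<longlonglongrightarrow> f s * gaussian z"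
        by (intro tendsto_intros)
    qed
  qed (use integrable_gaussian B in \<open>auto simp: norm_mult gaussian_nonneg intro!: AE_I2 mult_right_mono\<close>)
  moreover have "(LINT z|lborel. f s * gaussian (z::'a)) = f s * sqrt (2 * pi) ^ DIM('a)"
    using integral_gaussian[where 'a='a] by simp
  ultimately have "(LINT \<zeta>|lborel. F \<zeta> * cis (s \<bullet> \<zeta>)) = sqrt (2 * pi) ^ DIM('a) * (f s * sqrt (2 * pi) ^ DIM('a))"
    by (metis (no_types, lifting) ext LIMSEQ_unique)
  \<comment> \<open>One factor \<open>sqrt (2 * pi) ^ DIM('a)\<close> comes from the Gaussian
    transform, the other from the total mass of the Gaussian.\<close>
  also have "\<dots> = complex_of_real ((sqrt (2 * pi) * sqrt (2 * pi)) ^ DIM('a)) * f s"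
    by (simp only: power_mult_distrib of_real_mult of_real_power mult_ac)
  finally show ?thesis by (simp add: F_def)
qed

section \<open>Supports of derivatives and uniform constants\<close>

lemma partial_derivs_eq_0_on_open:
  assumes "open U" "\<And>x. x \<in> U \<Longrightarrow> f x = 0" "x \<in> U"
  shows "partial_derivs bs f x = 0"
  using \<open>x \<in> U\<close>
proof (induction bs arbitrary: x)
  case (Cons b bs)
  have "(partial_derivs bs f has_derivative (\<lambda>_. 0)) (at x)"
    by (rule has_derivative_transform_within_open[of "\<lambda>_. 0" _ _ _ U])
      (use Cons assms in auto)
  then show ?case by (simp add: partial_deriv_eq)
qed (use assms in auto)

lemma jet_bound_const: "jet_bound K (\<lambda>x. c) z (cmod c)"
proof (cases K)
  case (Suc K')
  have "jet_bound K'' (\<lambda>x. 0) z 0" for K'' by (induction K'') (auto simp: jet_bound_Suc)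
  then show ?thesis
    using jet_bound_mono[of K' "\<lambda>x. 0" z 0 K' "cmod c"] by (auto simp: Suc jet_bound_Suc)
qed auto

text \<open>Individually chosen constants are merged into the sum of their absolute values; the
  weights are nonnegative, so enlarging a constant is harmless.\<close>

lemma finite_choice_bound:
  assumes "finite A" "\<And>a. a \<in> A \<Longrightarrow> \<exists>C. \<forall>i\<in>I. P a i \<le> C * w i" "\<And>i. i \<in> I \<Longrightarrow> 0 \<le> w i"
  shows "\<exists>C\<ge>0. \<forall>a\<in>A. \<forall>i\<in>I. P a i \<le> C * (w i :: real)"
proof -
  obtain C where C: "\<And>a i. a \<in> A \<Longrightarrow> i \<in> I \<Longrightarrow> P a i \<le> C a * w i"
    using assms(2) by metis
  have "P a i \<le> (\<Sum>a\<in>A. \<bar>C a\<bar>) * w i" if "a \<in> A" "i \<in> I" for a i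
  proof -
    have "C a \<le> (\<Sum>a\<in>A. \<bar>C a\<bar>)"
      using member_le_sum[of a A "\<lambda>a. \<bar>C a\<bar>"] assms(1) that by auto
    then show ?thesis
      using C[OF that] assms(3)[OF that(2)] by (meson mult_right_mono order_trans)
  qed
  then show ?thesis by (intro exI[of _ "\<Sum>a\<in>A. \<bar>C a\<bar>"]) (auto intro: sum_nonneg)
qed

text \<open>Only finitely many lists of directions have length at most \<open>K\<close>, so bounds
  known for each list separately combine into one constant.\<close>

lemma jet_bound_uniform:
  fixes f :: "'i \<Rightarrow> 'a::euclidean_space \<Rightarrow> complex"
  assumes "\<And>bs. bs \<in> lists Basis \<Longrightarrow> length bs \<le> K \<Longrightarrow>
      \<exists>C. \<forall>i\<in>I. cmod (partial_derivs bs (f i) (z i)) \<le> C * w i"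
    and "\<And>i. i \<in> I \<Longrightarrow> 0 \<le> w i"
  shows "\<exists>C\<ge>0. \<forall>i\<in>I. jet_bound K (f i) (z i) (C * w i)"
proof -
  have "finite {bs. set bs \<subseteq> (Basis::'a set) \<and> length bs \<le> K}"
    by (rule finite_lists_length_le) auto
  then have "\<exists>C\<ge>0. \<forall>bs\<in>{bs. set bs \<subseteq> (Basis::'a set) \<and> length bs \<le> K}. \<forall>i\<in>I.
      cmod (partial_derivs bs (f i) (z i)) \<le> C * w i"
    by (rule finite_choice_bound) (use assms in \<open>auto simp: lists_eq_set\<close>)
  then show ?thesis
    unfolding jet_bound_def by (auto simp: lists_eq_set)
qed

lemma smooth_linear:
  assumes "bounded_linear (l :: 'a::euclidean_space \<Rightarrow> real)"
  shows "smooth (\<lambda>x. complex_of_real (l x))"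
    and "partial_deriv b (\<lambda>x. complex_of_real (l x)) = (\<lambda>x. complex_of_real (l b))"
proof -
  have d: "((\<lambda>x. complex_of_real (l x)) has_derivative (\<lambda>x. complex_of_real (l x))) (at x)" for x
    by (rule bounded_linear_imp_has_derivative)
      (rule bounded_linear_compose[OF bounded_linear_of_real assms])
  show pd: "partial_deriv b (\<lambda>x. complex_of_real (l x)) = (\<lambda>x. complex_of_real (l b))" for b
    by (rule ext) (rule partial_deriv_eq[OF d])
  show "smooth (\<lambda>x. complex_of_real (l x))"
    by (rule smooth_coinduct(1)[of _ "insert (\<lambda>x. complex_of_real (l x)) (range (\<lambda>c x. c))"])
      (use d in \<open>auto simp: pd intro: differentiableI\<close>)
qed

subsection \<open>Smoothness of Fourier transforms\<close>

text \<open>Differentiation in the frequency multiplies the integrand by a coordinate, which uses up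
  one power of the decay. As decay of every order is assumed, each derivative is an integral of the
  same kind, bounded by the integral of the modulus.\<close>

lemma smooth_fourier_integral:
  fixes \<psi> :: "'a::euclidean_space \<Rightarrow> complex"
  assumes cont: "continuous_on UNIV \<psi>" and decay: "\<And>k. \<exists>C. \<forall>x. (1 + norm x) ^ k * cmod (\<psi> x) \<le> C"
  defines "F \<equiv> \<lambda>\<psi> \<xi>. LINT x|lborel. \<psi> x * cis (- (x \<bullet> \<xi>))"
  shows "smooth (F \<psi>)" and "\<exists>C. \<forall>\<xi>. jet_bound K (F \<psi>) \<xi> C"
proof -
  define R where "R = {\<psi> :: 'a \<Rightarrow> complex. continuous_on UNIV \<psi> \<and>
     (\<forall>k. \<exists>C. \<forall>x. (1 + norm x) ^ k * cmod (\<psi> x) \<le> C)}"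
  have int: "integrable lborel \<psi>" if "\<psi> \<in> R" for \<psi>
  proof -
    obtain C where "\<And>x. (1 + norm x) ^ (2 * DIM('a)) * cmod (\<psi> x) \<le> C"
      using \<open>\<psi> \<in> R\<close> by (auto simp: R_def)
    then show ?thesis
      using \<open>\<psi> \<in> R\<close> by (intro integrable_decay) (auto simp: R_def)
  qed
  have R_mult: "(\<lambda>x. - \<i> * (x \<bullet> b) * \<psi> x) \<in> R" if "\<psi> \<in> R" "b \<in> Basis" for \<psi> b
    unfolding R_def
  proof (intro CollectI conjI allI)
    show "continuous_on UNIV (\<lambda>x. - \<i> * (x \<bullet> b) * \<psi> x)"
      using that by (auto simp: R_def intro!: continuous_intros)
    fix k
    obtain C where C: "\<And>x. (1 + norm x) ^ Suc k * cmod (\<psi> x) \<le> C"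
      using \<open>\<psi> \<in> R\<close> unfolding R_def by blast
    show "\<exists>C. \<forall>x. (1 + norm x) ^ k * cmod (- \<i> * (x \<bullet> b) * \<psi> x) \<le> C"
    proof (intro exI allI)
      fix x :: 'a
      have "(1 + norm x) ^ k * cmod (- \<i> * (x \<bullet> b) * \<psi> x) = \<bar>x \<bullet> b\<bar> * ((1 + norm x) ^ k * cmod (\<psi> x))"
        by (simp add: norm_mult)
      also have "\<dots> \<le> (1 + norm x) * ((1 + norm x) ^ k * cmod (\<psi> x))"
        using Basis_le_norm[OF that(2), of x] by (intro mult_right_mono) auto
      finally show "(1 + norm x) ^ k * cmod (- \<i> * (x \<bullet> b) * \<psi> x) \<le> C"
        using C[of x] by simp
    qed
  qed
  have pd: "partial_deriv b (\<lambda>\<xi>. \<psi> x * cis (- (x \<bullet> \<xi>))) = (\<lambda>\<xi>. - \<i> * (x \<bullet> b) * \<psi> x * cis (- (x \<bullet> \<xi>)))"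
    for x b and \<psi> :: "'a \<Rightarrow> complex"
  proof -
    have "partial_deriv b (\<lambda>\<xi>. \<psi> x * cis (\<xi> \<bullet> - x)) = (\<lambda>\<xi>. \<psi> x * (\<i> * (b \<bullet> - x) * cis (\<xi> \<bullet> - x)))"
      by (simp only: partial_deriv_cmult[OF smooth_cis_inner] partial_deriv_cis_inner)
    then show ?thesis by (simp add: inner_commute mult_ac)
  qed
  have diff: "F \<psi> differentiable (at \<xi>)"
    and deriv: "b \<in> Basis \<Longrightarrow> partial_deriv b (F \<psi>) \<xi> = F (\<lambda>x. - \<i> * (x \<bullet> b) * \<psi> x) \<xi>"
    if "\<psi> \<in> R" for \<psi> \<xi> b
  proof -
    have int': "integrable lborel (\<lambda>x. \<psi> x * cis (- (x \<bullet> \<xi>)))" if "\<psi> \<in> R" for \<psi> \<xi>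
      using integrable_mult_cis[OF int[OF that], of "- \<xi>"] by simp
    have meas: "(\<lambda>x. partial_deriv b (\<lambda>\<xi>. \<psi> x * cis (- (x \<bullet> \<xi>))) \<xi>) \<in> borel_measurable lborel"
      if "b \<in> Basis" for b \<xi>
      using int'[OF R_mult[OF \<open>\<psi> \<in> R\<close> that], of \<xi>] unfolding pd by (rule borel_measurable_integrable)
    have dom: "\<exists>g. integrable lborel g \<and> (\<forall>z\<in>ball z0 1. \<forall>x. \<forall>b\<in>Basis.
        cmod (partial_deriv b (\<lambda>\<xi>. \<psi> x * cis (- (x \<bullet> \<xi>))) z) \<le> g x)" for z0
    proof (intro exI[of _ "\<lambda>x. \<Sum>b\<in>Basis. cmod (- \<i> * (x \<bullet> b) * \<psi> x)"] conjI ballI allI)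
      show "integrable lborel (\<lambda>x. \<Sum>b\<in>Basis. cmod (- \<i> * (x \<bullet> b) * \<psi> x))"
        using int[OF R_mult[OF \<open>\<psi> \<in> R\<close>]] by (intro Bochner_Integration.integrable_sum integrable_norm)
      show "cmod (partial_deriv b (\<lambda>\<xi>. \<psi> x * cis (- (x \<bullet> \<xi>))) z) \<le> (\<Sum>b\<in>Basis. cmod (- \<i> * (x \<bullet> b) * \<psi> x))"
        if "b \<in> Basis" for z x b
        using that member_le_sum[of b Basis "\<lambda>b. cmod (- \<i> * (x \<bullet> b) * \<psi> x)"]
        by (simp add: pd norm_mult)
    qed
    have d: "(\<lambda>z. \<psi> x * cis (- (x \<bullet> z))) differentiable (at z)" for z x
      using smoothD(1)[OF smooth_cmult[OF smooth_cis_inner[of "- x"]]] by (simp add: inner_commute)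
    note L = Leibniz_partial_deriv[of lborel "\<lambda>\<xi> x. \<psi> x * cis (- (x \<bullet> \<xi>))", OF int'[OF \<open>\<psi> \<in> R\<close>] d meas dom]
    show "F \<psi> differentiable (at \<xi>)"
      unfolding F_def by (rule L(1))
    show "partial_deriv b (F \<psi>) \<xi> = F (\<lambda>x. - \<i> * (x \<bullet> b) * \<psi> x) \<xi>" if "b \<in> Basis"
    proof -
      have "partial_deriv b (F \<psi>) \<xi> = (LINT x|lborel. partial_deriv b (\<lambda>\<xi>. \<psi> x * cis (- (x \<bullet> \<xi>))) \<xi>)"
        unfolding F_def by (rule L(2)[OF _ that])
      then show ?thesis by (simp add: pd F_def)
    qed
  qed
  have "\<psi> \<in> R"
    using cont decay by (auto simp: R_def)
  then have mem: "F \<psi> \<in> F ` R" by auto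
  have step: "partial_deriv b g \<in> F ` R" if "g \<in> F ` R" "b \<in> Basis" for g b
    using that R_mult deriv by (force simp: fun_eq_iff)
  show "smooth (F \<psi>)" by (rule smooth_coinduct(1)[OF mem]) (use diff step in auto)
  have derivs: "partial_derivs bs (F \<psi>) \<in> F ` R" if "bs \<in> lists Basis" for bs
    by (rule smooth_coinduct(2)[OF mem]) (use diff step that in auto)
  have "\<exists>C. \<forall>\<xi>\<in>UNIV. cmod (partial_derivs bs (F \<psi>) \<xi>) \<le> C * 1" if bs: "bs \<in> lists Basis" for bs
  proof -
    obtain \<psi>' where \<psi>': "\<psi>' \<in> R" "partial_derivs bs (F \<psi>) = F \<psi>'"
      using derivs[OF bs] by auto
    have "cmod (F \<psi>' \<xi>) \<le> (LINT x|lborel. cmod (\<psi>' x))" for \<xi>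
      unfolding F_def using integral_norm_bound[of lborel "\<lambda>x. \<psi>' x * cis (- (x \<bullet> \<xi>))"]
      by (simp add: norm_mult)
    then show ?thesis
      using \<psi>' by auto
  qed
  then show "\<exists>C. \<forall>\<xi>. jet_bound K (F \<psi>) \<xi> C"
    using jet_bound_uniform[of K UNIV "\<lambda>_. F \<psi>" "\<lambda>\<xi>. \<xi>" "\<lambda>_. 1"] by auto
qed

text \<open>\<open>m\<close> integrations by parts in each coordinate, with a weight that makes
  every derivative integrable. The constant is explicit and linear in \<open>E\<close>, since
  \<open>E\<close> will carry uniformity in an index and, in one application, a power of the
  position that has to be cancelled.\<close>

lemma smooth_fourier_decay:
  fixes G :: "'a::euclidean_space \<Rightarrow> complex" and E :: real
  assumes G: "smooth G" and bd: "\<And>x. jet_bound m G x (E / (1 + norm x) ^ (2 * DIM('a)))"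
  shows "(1 + norm \<sigma>) ^ m * cmod (LINT x|lborel. G x * cis (x \<bullet> \<sigma>)) \<le>
    (1 + DIM('a)) ^ Suc m * E * (LINT x|lborel. 1 / (1 + norm (x::'a)) ^ (2 * DIM('a)))"
proof -
  let ?w = "\<lambda>x::'a. 1 / (1 + norm x) ^ (2 * DIM('a))"
  let ?X = "cmod (LINT x|lborel. G x * cis (x \<bullet> \<sigma>))"
  have pos: "0 < 1 + norm x" for x :: 'a by (simp add: add_pos_nonneg)
  have int: "integrable lborel (partial_derivs bs G)"
    and le: "(LINT x|lborel. cmod (partial_derivs bs G x)) \<le> E * (LINT x|lborel. ?w x)"
    if "bs \<in> lists Basis" "length bs \<le> m" for bs
  proof -
    have bd': "cmod (partial_derivs bs G x) \<le> E * ?w x" for x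
      using jet_boundD[OF bd that] by simp
    show i: "integrable lborel (partial_derivs bs G)"
    proof (rule integrable_decay)
      show "partial_derivs bs G \<in> borel_measurable borel"
        by (rule continuous_borel_measurable[OF smooth_continuous_on[OF smoothD(3)[OF G that(1)]]])
      show "(1 + norm x) ^ (2 * DIM('a)) * cmod (partial_derivs bs G x) \<le> E" for x
        using bd'[of x] pos[of x] by (simp add: field_simps)
    qed
    have "(LINT x|lborel. cmod (partial_derivs bs G x)) \<le> (LINT x|lborel. E * ?w x)"
      by (intro integral_mono integrable_norm i integrable_mult_right integrable_weight bd')
    then show "(LINT x|lborel. cmod (partial_derivs bs G x)) \<le> E * (LINT x|lborel. ?w x)"
      by (simp only: integral_mult_right_zero)
  qed
  have coord: "\<bar>\<sigma> \<bullet> b\<bar> ^ m * ?X \<le> E * (LINT x|lborel. ?w x)" if b: "b \<in> Basis" for b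
  proof -
    have mem: "replicate i b \<in> lists Basis" for i
      using b by (induction i) auto
    show ?thesis
      using order_trans[OF fourier_integral_decay[OF G b int] le[of "replicate m b"]] mem by simp
  qed
  have X: "?X \<le> E * (LINT x|lborel. ?w x)"
    using order_trans[OF integral_norm_bound[of lborel "\<lambda>x. G x * cis (x \<bullet> \<sigma>)"]] le[of "[]"]
    by (simp add: norm_mult)
  have "(1 + norm \<sigma>) ^ m * ?X \<le> ((1 + DIM('a)) ^ m * (1 + (\<Sum>b\<in>Basis. \<bar>\<sigma> \<bullet> b\<bar> ^ m))) * ?X"
    by (intro mult_right_mono one_plus_norm_power_le) auto
  also have "\<dots> = (1 + DIM('a)) ^ m * (?X + (\<Sum>b\<in>Basis. \<bar>\<sigma> \<bullet> b\<bar> ^ m * ?X))"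
    by (simp add: sum_distrib_right distrib_left distrib_right mult.assoc)
  also have "\<dots> \<le> (1 + DIM('a)) ^ m * (E * (LINT x|lborel. ?w x) + (\<Sum>b\<in>(Basis::'a set). E * (LINT x|lborel. ?w x)))"
    by (intro mult_left_mono add_mono sum_mono coord X) auto
  \<comment> \<open>One copy of the bound for the integral itself and one for each coordinate give
    the additional factor \<open>1 + DIM('a)\<close>.\<close>
  also have "\<dots> = (1 + DIM('a)) ^ Suc m * E * (LINT x|lborel. ?w x)"
    by (simp add: algebra_simps)
  finally show ?thesis .
qed

subsection \<open>Integrals with a compactly supported amplitude\<close>

text \<open>The exponent \<open>p\<close> is fixed before the order \<open>K\<close>, so
  differentiation does not worsen the growth in the first variable. All bounds are uniform in the
  index \<open>i\<close>, which will number a sequence of symbols.\<close>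

definition amplitude_family ::
    "real \<Rightarrow> nat \<Rightarrow> ('i \<Rightarrow> 'a::euclidean_space \<times> 'a \<Rightarrow> complex) \<Rightarrow> bool" where
  "amplitude_family R p Q \<longleftrightarrow> (\<forall>i. smooth (Q i)) \<and>
     (\<forall>i s \<zeta>. R < norm \<zeta> \<longrightarrow> Q i (s, \<zeta>) = 0) \<and>
     (\<forall>K. \<exists>C. \<forall>i s \<zeta>. jet_bound K (Q i) (s, \<zeta>) (C * (1 + norm s) ^ p))"

text \<open>Up to normalization, an inverse Fourier transform whose amplitude may depend on the
  point of evaluation: the form of an operator with \<open>t = 1\<close> once its inner integral has
  been carried out.\<close>

definition osc_integral :: "('a::euclidean_space \<times> 'a \<Rightarrow> complex) \<Rightarrow> 'a \<Rightarrow> complex" where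
  "osc_integral Q s = (LINT \<zeta>|lborel. Q (s, \<zeta>) * cis (s \<bullet> \<zeta>))"

lemma amplitude_family_bound:
  assumes "amplitude_family R p Q"
  shows "\<exists>C\<ge>0. \<forall>i s \<zeta>. jet_bound K (Q i) (s, \<zeta>) (C * (1 + norm s) ^ p)"
proof -
  obtain C where C: "\<And>i s \<zeta>. jet_bound K (Q i) (s, \<zeta>) (C * (1 + norm s) ^ p)"
    using assms unfolding amplitude_family_def by blast
  have "0 \<le> C"
    using jet_bound_pos[OF C[of undefined 0 0]] by simp
  then show ?thesis
    using C by blast
qed

lemma amplitude_family_smooth: "amplitude_family R p Q \<Longrightarrow> smooth (Q i)"
  by (auto simp: amplitude_family_def)

lemma amplitude_family_support: "amplitude_family R p Q \<Longrightarrow> R < norm \<zeta> \<Longrightarrow> partial_derivs bs (Q i) (s, \<zeta>) = 0"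
  by (rule partial_derivs_eq_0_on_open[of "{z. R < norm (snd z)}"])
    (auto simp: amplitude_family_def intro!: open_Collect_less continuous_intros)

lemma amplitude_family_deriv:
  assumes Q: "amplitude_family R p Q" and b: "b \<in> Basis"
  shows "amplitude_family R p (\<lambda>i. partial_deriv b (Q i))"
  unfolding amplitude_family_def
proof (intro conjI allI impI)
  show "smooth (partial_deriv b (Q i))" for i
    using amplitude_family_smooth[OF Q] b smoothD(2) by blast
  show "partial_deriv b (Q i) (s, \<zeta>) = 0" if "R < norm \<zeta>" for i s \<zeta>
    using amplitude_family_support[OF Q that, of "[b]"] by simp
  show "\<exists>C. \<forall>i s \<zeta>. jet_bound K (partial_deriv b (Q i)) (s, \<zeta>) (C * (1 + norm s) ^ p)" for K
    using amplitude_family_bound[OF Q, of "Suc K"] jet_bound_deriv[OF _ b] by blast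
qed

lemma amplitude_family_add:
  assumes P: "amplitude_family R p P" and Q: "amplitude_family R p Q"
  shows "amplitude_family R p (\<lambda>i z. P i z + Q i z)"
  unfolding amplitude_family_def
proof (intro conjI allI impI)
  note s = amplitude_family_smooth[OF P] amplitude_family_smooth[OF Q]
  show "smooth (\<lambda>z. P i z + Q i z)" for i
    using s by (intro smooth_add)
  show "P i (s, \<zeta>) + Q i (s, \<zeta>) = 0" if "R < norm \<zeta>" for i s \<zeta>
    using P Q that by (auto simp: amplitude_family_def)
  fix K
  obtain C D where "\<And>i s \<zeta>. jet_bound K (P i) (s, \<zeta>) (C * (1 + norm s) ^ p)"
    "\<And>i s \<zeta>. jet_bound K (Q i) (s, \<zeta>) (D * (1 + norm s) ^ p)"
    using amplitude_family_bound[OF P, of K] amplitude_family_bound[OF Q, of K] by blast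
  then have "jet_bound K (\<lambda>z. P i z + Q i z) (s, \<zeta>) ((C + D) * (1 + norm s) ^ p)" for i s \<zeta>
    using jet_bound_add[OF s, of K i "(s, \<zeta>)" _ i] by (simp add: distrib_right)
  then show "\<exists>C. \<forall>i s \<zeta>. jet_bound K (\<lambda>z. P i z + Q i z) (s, \<zeta>) (C * (1 + norm s) ^ p)"
    by blast
qed

text \<open>The multiplier is controlled only where \<open>norm \<zeta> \<le> R\<close>. Elsewhere
  the product vanishes on an open set, hence so do its derivatives. This admits multipliers that are
  unbounded in \<open>\<zeta>\<close>.\<close>

lemma amplitude_family_mult:
  assumes Q: "amplitude_family R p Q" and f: "\<And>i. smooth (f i)"
    and bd: "\<And>K. \<exists>C\<ge>0. \<forall>i s \<zeta>. norm \<zeta> \<le> R \<longrightarrow> jet_bound K (f i) (s, \<zeta>) (C * (1 + norm s) ^ q)"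
  shows "amplitude_family R (q + p) (\<lambda>i z. f i z * Q i z)"
  unfolding amplitude_family_def
proof (intro conjI allI impI)
  note s = amplitude_family_smooth[OF Q]
  show sm: "smooth (\<lambda>z. f i z * Q i z)" for i
    using s f by (intro smooth_mult)
  show z: "f i (s, \<zeta>) * Q i (s, \<zeta>) = 0" if "R < norm \<zeta>" for i s \<zeta>
    using Q that by (auto simp: amplitude_family_def)
  then have z': "f i w * Q i w = 0" if "R < norm (snd w)" for i w by (metis prod.collapse that)
  fix K
  obtain C D where CD: "0 \<le> C" "0 \<le> D"
    "\<And>i s \<zeta>. norm \<zeta> \<le> R \<Longrightarrow> jet_bound K (f i) (s, \<zeta>) (C * (1 + norm s) ^ q)"
    "\<And>i s \<zeta>. jet_bound K (Q i) (s, \<zeta>) (D * (1 + norm s) ^ p)"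
    using bd[of K] amplitude_family_bound[OF Q, of K] by blast
  have "jet_bound K (\<lambda>z. f i z * Q i z) (s, \<zeta>) ((2 ^ K * C * D) * (1 + norm s) ^ (q + p))" for i s \<zeta>
  proof (cases "norm \<zeta> \<le> R")
    case True
    then show ?thesis
      using jet_bound_mult[OF f s CD(3)[OF True] CD(4)] by (simp add: power_add mult_ac)
  next
    case False
    then have "partial_derivs bs (\<lambda>z. f i z * Q i z) (s, \<zeta>) = 0" for bs
      by (intro partial_derivs_eq_0_on_open[of "{z. R < norm (snd z)}"])
        (use False z' in \<open>auto intro!: open_Collect_less continuous_intros simp del: mult_eq_0_iff\<close>)
    then show ?thesis
      using CD(1,2) by (auto simp: jet_bound_def)
  qed
  then show "\<exists>C. \<forall>i s \<zeta>. jet_bound K (\<lambda>z. f i z * Q i z) (s, \<zeta>) (C * (1 + norm s) ^ (q + p))"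
    by blast
qed

text \<open>Over the support a coordinate of \<open>\<zeta>\<close> is bounded, and its first
  derivatives are constants of size at most 1, so it acts as a multiplier with growth exponent
  0.\<close>

lemma amplitude_family_mult_coordinate:
  fixes Q :: "'i \<Rightarrow> 'a::euclidean_space \<times> 'a \<Rightarrow> complex"
  assumes Q: "amplitude_family R p Q" and b: "b \<in> Basis"
  shows "amplitude_family R p (\<lambda>i z. c * complex_of_real (b \<bullet> snd z) * Q i z)"
proof -
  have bl: "bounded_linear (\<lambda>z. b \<bullet> snd z)"
    by (intro bounded_linear_compose[OF bounded_linear_inner_right] bounded_linear_snd)
  define f where "f = (\<lambda>z::'a \<times> 'a. complex_of_real (b \<bullet> snd z))"
  have f: "smooth f"
    unfolding f_def by (rule smooth_linear[OF bl])
  have pd: "partial_deriv b' f = (\<lambda>z. of_real (b \<bullet> snd b'))" for b'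
    unfolding f_def by (rule smooth_linear[OF bl])
  have "jet_bound K f (s, \<zeta>) (1 + norm \<zeta>)" for K s \<zeta>
  proof (cases K)
    case (Suc K')
    have "jet_bound K' (\<lambda>z. complex_of_real (b \<bullet> snd b')) (s, \<zeta>) (1 + norm \<zeta>)" if "b' \<in> Basis" for b'
    proof (rule jet_bound_mono[OF jet_bound_const order_refl])
      have "\<bar>b \<bullet> snd b'\<bar> \<le> norm (snd b')"
        using Basis_le_norm[OF b, of "snd b'"] by (simp add: inner_commute)
      also have "\<dots> \<le> norm b'" by (metis norm_snd_le prod.collapse)
      also have "\<dots> \<le> 1 + norm \<zeta>"
        using that by simp
      finally show "cmod (complex_of_real (b \<bullet> snd b')) \<le> 1 + norm \<zeta>" by simp
    qed
    then show ?thesis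
      using Basis_le_norm[OF b, of \<zeta>] unfolding Suc jet_bound_Suc pd
      by (auto simp: f_def inner_commute)
  qed (use Basis_le_norm[OF b, of \<zeta>] in \<open>auto simp: f_def inner_commute\<close>)
  then have bd: "jet_bound K (\<lambda>z. c * f z) (s, \<zeta>) (cmod c * (1 + norm \<zeta>))" for K s \<zeta>
    by (intro jet_bound_cmult f)
  \<comment> \<open>\<open>max 0 R\<close> keeps the constant nonnegative when \<open>R\<close> is
    negative.\<close>
  have "jet_bound K (\<lambda>z. c * f z) (s, \<zeta>) (cmod c * (1 + max 0 R) * (1 + norm s) ^ 0)"
    if "norm \<zeta> \<le> R" for K s \<zeta>
    by (rule jet_bound_mono[OF bd]) (use that in \<open>auto intro!: mult_left_mono\<close>)
  then have "amplitude_family R (0 + p) (\<lambda>i z. c * f z * Q i z)"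
    by (intro amplitude_family_mult[OF Q] smooth_cmult[OF f]
        exI[of _ "cmod c * (1 + max 0 R)"]) auto
  then show ?thesis by (simp add: f_def)
qed

lemma partial_deriv_Pair_left:
  assumes "smooth Q"
  shows "partial_deriv b (\<lambda>s. Q (s, \<zeta>)) = (\<lambda>s. partial_deriv (b, 0) Q (s, \<zeta>))"
  using partial_deriv_affine[of "\<lambda>s. (s, \<zeta>)" b 1 "(b, 0)" Q] smoothD(1)[OF assms] by simp

lemma integrable_bounded_cball:
  fixes f :: "'a::euclidean_space \<Rightarrow> complex"
  assumes "f \<in> borel_measurable borel" "\<And>x. cmod (f x) \<le> C * indicator (cball 0 R) x"
  shows "integrable lborel f" and "(LINT x|lborel. cmod (f x)) \<le> C * measure lborel (cball (0::'a) R)"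
proof -
  have int: "integrable lborel (\<lambda>x::'a. C * indicator (cball 0 R) x)"
    by (intro integrable_mult_right integrable_real_indicator)
      (auto simp: emeasure_lborel_cball_finite[unfolded infinity_ennreal_def])
  show i: "integrable lborel f"
    by (rule Bochner_Integration.integrable_bound[OF int])
      (use assms in \<open>auto intro!: AE_I2 intro: order_trans[OF _ abs_ge_self]\<close>)
  have "(LINT x|lborel. cmod (f x)) \<le> (LINT x|lborel. C * indicator (cball (0::'a) R) x)"
    using i int assms by (intro integral_mono) auto
  then show "(LINT x|lborel. cmod (f x)) \<le> C * measure lborel (cball (0::'a) R)" by simp
qed

lemma smooth_Pair_measurable:
  assumes "smooth Q"
  shows "(\<lambda>\<zeta>. Q (s, \<zeta>)) \<in> borel_measurable borel" "(\<lambda>\<zeta>. Q (s, \<zeta>) * cis (v \<bullet> \<zeta>)) \<in> borel_measurable borel"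
  by (intro continuous_borel_measurable continuous_intros
      continuous_on_compose2[OF smooth_continuous_on[OF assms, of UNIV]]; auto)+

lemma amplitude_family_fibre_bound:
  assumes Q: "amplitude_family R p Q" and "bs \<in> lists Basis"
  shows "\<exists>C\<ge>0. \<forall>i s \<zeta>. cmod (partial_derivs bs (Q i) (s, \<zeta>)) \<le> (C * (1 + norm s) ^ p) * indicator (cball 0 R) \<zeta>"
proof -
  obtain C where "0 \<le> C" "\<And>i s \<zeta>. jet_bound (length bs) (Q i) (s, \<zeta>) (C * (1 + norm s) ^ p)"
    using amplitude_family_bound[OF Q, of "length bs"] by blast
  then show ?thesis
    using amplitude_family_support[OF Q] assms(2)
    by (intro exI[of _ C]) (auto split: split_indicator simp: not_le jet_bound_def)
qed

text \<open>A derivative in \<open>s\<close> falls on the amplitude or on the phase; the latter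
  brings down a coordinate of \<open>\<zeta>\<close>, which the compact support keeps bounded. The
  new amplitude stays in the class, with the same \<open>R\<close> and \<open>p\<close>.\<close>

lemma osc_integral_deriv:
  fixes Q :: "'i \<Rightarrow> 'a::euclidean_space \<times> 'a \<Rightarrow> complex"
  assumes Q: "amplitude_family R p Q"
  shows "osc_integral (Q i) differentiable (at s0)"
    and "b \<in> Basis \<Longrightarrow> partial_deriv b (osc_integral (Q i)) s0 =
      osc_integral (\<lambda>z. partial_deriv (b, 0) (Q i) z + \<i> * (b \<bullet> snd z) * Q i z) s0"
proof -
  note sm = amplitude_family_smooth[OF Q, of i]
  have smL: "smooth (\<lambda>s. Q i (s, \<zeta>))" for \<zeta>
    using smooth_affine[of "\<lambda>s. (s, \<zeta>)" "\<lambda>_. 1" "\<lambda>b. (b, 0)" "Q i"] sm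
    by (auto simp: Basis_prod_def)
  have pd: "partial_deriv b (\<lambda>s. Q i (s, \<zeta>) * cis (s \<bullet> \<zeta>)) s =
     (partial_deriv (b, 0) (Q i) (s, \<zeta>) + \<i> * (b \<bullet> \<zeta>) * Q i (s, \<zeta>)) * cis (s \<bullet> \<zeta>)" for b s \<zeta>
    by (subst partial_deriv_mult)
      (auto simp: smoothD(1)[OF smL] partial_deriv_Pair_left[OF sm] distrib_right)
  have fam': "amplitude_family R p (\<lambda>i z. partial_deriv (b, 0) (Q i) z + \<i> * (b \<bullet> snd z) * Q i z)"
    if "b \<in> Basis" for b
    using that by (intro amplitude_family_add amplitude_family_deriv[OF Q]
        amplitude_family_mult_coordinate[OF Q]) (auto simp: Basis_prod_def)
  have intP: "integrable lborel (\<lambda>\<zeta>. P i (s, \<zeta>) * cis (s \<bullet> \<zeta>))" if P: "amplitude_family R p P"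
    for P :: "'i \<Rightarrow> 'a \<times> 'a \<Rightarrow> complex" and s
  proof -
    obtain C where C: "\<And>i s \<zeta>. cmod (P i (s, \<zeta>)) \<le> (C * (1 + norm s) ^ p) * indicator (cball 0 R) \<zeta>"
      using amplitude_family_fibre_bound[OF P, of "[]"] by auto
    show ?thesis
      by (rule integrable_bounded_cball[where C = "C * (1 + norm s) ^ p" and R = R])
        (use C smooth_Pair_measurable[OF amplitude_family_smooth[OF P]] in \<open>auto simp: norm_mult\<close>)
  qed
  have dom: "\<exists>g. integrable lborel g \<and> (\<forall>s\<in>ball s0 1. \<forall>\<zeta>. \<forall>b\<in>Basis.
      cmod (partial_deriv b (\<lambda>s. Q i (s, \<zeta>) * cis (s \<bullet> \<zeta>)) s) \<le> g \<zeta>)" for s0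
  proof -
    have "\<exists>C\<ge>0. \<forall>b\<in>Basis. \<forall>(s, \<zeta>)\<in>UNIV.
       cmod (partial_deriv (b, 0) (Q i) (s, \<zeta>) + \<i> * (b \<bullet> snd (s, \<zeta>)) * Q i (s, \<zeta>)) \<le>
       C * ((1 + norm s) ^ p * indicator (cball 0 R) \<zeta>)"
      unfolding case_prod_beta
    proof (rule finite_choice_bound)
      fix b :: 'a assume "b \<in> Basis"
      from amplitude_family_fibre_bound[OF fam'[OF this], of "[]"]
      show "\<exists>C. \<forall>z\<in>UNIV. cmod (partial_deriv (b, 0) (Q i) (fst z, snd z) + \<i> * (b \<bullet> snd (fst z, snd z)) * Q i (fst z, snd z)) \<le>
       C * ((1 + norm (fst z)) ^ p * indicator (cball 0 R) (snd z))"
        by (auto simp: mult.assoc)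
    qed auto
    then obtain C where C: "0 \<le> C" "\<And>b s \<zeta>. b \<in> Basis \<Longrightarrow>
       cmod (partial_deriv (b, 0) (Q i) (s, \<zeta>) + \<i> * (b \<bullet> \<zeta>) * Q i (s, \<zeta>)) \<le>
       C * ((1 + norm s) ^ p * indicator (cball 0 R) \<zeta>)"
      by auto
    \<comment> \<open>The value \<open>2 + norm s0\<close> dominates \<open>1 + norm s\<close> on
      the whole unit ball around \<open>s0\<close>.\<close>
    define g where "g \<zeta> = C * ((2 + norm s0) ^ p * indicator (cball 0 R) \<zeta>)" for \<zeta> :: 'a
    have "integrable lborel g"
      unfolding g_def by (intro integrable_mult_right integrable_real_indicator)
        (auto simp: emeasure_lborel_cball_finite[unfolded infinity_ennreal_def])
    moreover have "cmod (partial_deriv b (\<lambda>s. Q i (s, \<zeta>) * cis (s \<bullet> \<zeta>)) s) \<le> g \<zeta>"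
      if "s \<in> ball s0 1" "b \<in> Basis" for s \<zeta> b
    proof -
      have "norm s \<le> norm s0 + 1"
        using that(1) norm_triangle_sub[of s s0] by (simp add: dist_norm norm_minus_commute)
      then have "(1 + norm s) ^ p \<le> (2 + norm s0) ^ p" by (intro power_mono) auto
      then have "C * ((1 + norm s) ^ p * indicator (cball 0 R) \<zeta>) \<le> g \<zeta>"
        unfolding g_def using C(1) by (intro mult_left_mono mult_right_mono) auto
      then show ?thesis
        using C(2)[OF that(2), of s \<zeta>] by (simp add: pd norm_mult)
    qed
    ultimately show ?thesis by blast
  qed
  have meas: "(\<lambda>\<zeta>. partial_deriv b (\<lambda>s. Q i (s, \<zeta>) * cis (s \<bullet> \<zeta>)) s) \<in> borel_measurable lborel" if "b \<in> Basis" for b s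
    using borel_measurable_integrable[OF intP[OF fam'[OF that]]] by (simp add: pd)
  have d: "(\<lambda>s. Q i (s, \<zeta>) * cis (s \<bullet> \<zeta>)) differentiable (at s)" for s \<zeta>
    by (intro smoothD(1) smooth_mult smL smooth_cis_inner)
  note L = Leibniz_partial_deriv[of lborel "\<lambda>s \<zeta>. Q i (s, \<zeta>) * cis (s \<bullet> \<zeta>)", OF intP[OF Q] d meas dom]
  show "osc_integral (Q i) differentiable (at s0)"
    unfolding osc_integral_def[abs_def] by (rule L(1))
  show "partial_deriv b (osc_integral (Q i)) s0 =
      osc_integral (\<lambda>z. partial_deriv (b, 0) (Q i) z + \<i> * (b \<bullet> snd z) * Q i z) s0" if "b \<in> Basis"
  proof -
    have "partial_deriv b (osc_integral (Q i)) s0 =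
        (LINT \<zeta>|lborel. partial_deriv b (\<lambda>s. Q i (s, \<zeta>) * cis (s \<bullet> \<zeta>)) s0)"
      unfolding osc_integral_def[abs_def] by (rule L(2)[OF _ that])
    then show ?thesis by (simp add: pd osc_integral_def)
  qed
qed

lemma osc_integral_decay:
  fixes Q :: "'i \<Rightarrow> 'a::euclidean_space \<times> 'a \<Rightarrow> complex"
  assumes Q: "amplitude_family R p Q"
  shows "\<exists>C\<ge>0. \<forall>i s. (1 + norm s) ^ k * cmod (osc_integral (Q i) s) \<le> C"
proof -
  \<comment> \<open>Of the \<open>m\<close> integrations by parts, \<open>p\<close> cancel the
    growth of the amplitude in \<open>s\<close> and \<open>k\<close> remain as decay.\<close>
  define m where "m = k + p"
  define W where "W = (LINT x|lborel. 1 / (1 + norm (x::'a)) ^ (2 * DIM('a)))"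
  obtain C where C: "0 \<le> C" "\<And>i s \<zeta>. jet_bound m (Q i) (s, \<zeta>) (C * (1 + norm s) ^ p)"
    using amplitude_family_bound[OF Q, of m] by blast
  \<comment> \<open>Over the support \<open>1 + norm \<zeta>\<close> is at most
    \<open>1 + max 0 R\<close>, so the integrable weight in \<open>\<zeta>\<close> can be inserted
    at the price of a constant.\<close>
  define D where "D = C * (1 + max 0 R) ^ (2 * DIM('a))"
  have D: "0 \<le> D"
    using C(1) by (simp add: D_def)
  have L: "(s, \<zeta> + \<tau> *\<^sub>R b) = (s, \<zeta>) + (\<tau> * 1) *\<^sub>R (0, b)" "(0, b) \<in> Basis" if "b \<in> Basis" for s \<zeta> b :: 'a and \<tau>
    using that by (auto simp: Basis_prod_def)
  have d: "Pair s differentiable (at \<zeta>)" for s \<zeta> :: 'a by simp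
  note Q_smooth = amplitude_family_smooth[OF Q]
  have bd: "jet_bound m (\<lambda>\<zeta>. Q i (s, \<zeta>)) \<zeta> (D * (1 + norm s) ^ p / (1 + norm \<zeta>) ^ (2 * DIM('a)))" for i s \<zeta>
  proof (cases "norm \<zeta> \<le> R")
    case True
    have "jet_bound m (\<lambda>\<zeta>. Q i (s, \<zeta>)) \<zeta> (C * (1 + norm s) ^ p)"
      by (rule jet_bound_affine[OF L d Q_smooth _ C(2)]) auto
    moreover have "C * (1 + norm s) ^ p * (1 + norm \<zeta>) ^ (2 * DIM('a)) \<le> C * (1 + norm s) ^ p * (1 + max 0 R) ^ (2 * DIM('a))"
      using True C(1) by (intro mult_left_mono power_mono) auto
    then have "C * (1 + norm s) ^ p \<le> D * (1 + norm s) ^ p / (1 + norm \<zeta>) ^ (2 * DIM('a))"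
      using add_pos_nonneg[OF zero_less_one norm_ge_zero, of \<zeta>] by (simp add: D_def le_divide_eq mult_ac)
    ultimately show ?thesis
      using jet_bound_mono by blast
  next
    case False
    then have "partial_derivs bs (\<lambda>\<zeta>. Q i (s, \<zeta>)) \<zeta> = 0" for bs
      using Q by (intro partial_derivs_eq_0_on_open[of "{\<zeta>. R < norm \<zeta>}"])
        (auto simp: amplitude_family_def intro!: open_Collect_less continuous_intros)
    then show ?thesis
      using D by (simp add: jet_bound_def)
  qed
  define M where "M = (1 + DIM('a)) ^ Suc m * D * W"
  have "(1 + norm s) ^ k * cmod (osc_integral (Q i) s) \<le> M" for i s
  proof -
    have "(1 + norm s) ^ m * cmod (osc_integral (Q i) s) \<le> (1 + DIM('a)) ^ Suc m * (D * (1 + norm s) ^ p) * W"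
      using smooth_fourier_decay[OF smooth_affine[OF L d Q_smooth] bd, of s] by (simp add: osc_integral_def inner_commute W_def)
    then have "(1 + norm s) ^ p * ((1 + norm s) ^ k * cmod (osc_integral (Q i) s)) \<le> (1 + norm s) ^ p * M"
      by (simp add: M_def m_def power_add mult_ac)
    moreover have "0 < (1 + norm s) ^ p" by (simp add: add_pos_nonneg)
    ultimately show ?thesis by simp
  qed
  then show ?thesis by (intro exI[of _ "max 0 M"]) (simp add: le_max_iff_disj)
qed

text \<open>Differentiation acts on amplitudes by \<open>step\<close>, which stays within the class.
  The induction runs over all families \<open>Q\<close>, so the decay of the values, known for every
  family, passes to the derivatives.\<close>

lemma
  fixes Q :: "'i \<Rightarrow> 'a::euclidean_space \<times> 'a \<Rightarrow> complex"
  assumes Q: "amplitude_family R p Q"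
  shows smooth_osc_integral: "smooth (osc_integral (Q i))"
    and osc_integral_jet_decay: "\<exists>C\<ge>0. \<forall>i s. jet_bound K (osc_integral (Q i)) s (C / (1 + norm s) ^ k)"
proof -
  define step where "step b P = (\<lambda>i z. partial_deriv (b, 0) (P i) z + \<i> * (b \<bullet> snd z) * P i z)"
    for b :: 'a and P :: "'i \<Rightarrow> 'a \<times> 'a \<Rightarrow> complex"
  have step: "amplitude_family R p (step b P)" if "b \<in> Basis" "amplitude_family R p P" for b P
    unfolding step_def using that by (intro amplitude_family_add amplitude_family_deriv
        amplitude_family_mult_coordinate) (auto simp: Basis_prod_def)
  have pd: "partial_deriv b (osc_integral (P i)) = osc_integral (step b P i)"
    if "b \<in> Basis" "amplitude_family R p P" for b P i
    unfolding step_def using osc_integral_deriv(2)[OF that(2,1)] by auto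
  show "smooth (osc_integral (Q i))"
  proof (rule smooth_coinduct(1)[of _ "{osc_integral (P i) |P. amplitude_family R p P}"])
    show "osc_integral (Q i) \<in> {osc_integral (P i) |P. amplitude_family R p P}"
      using Q by auto
    show "g differentiable at x" if "g \<in> {osc_integral (P i) |P. amplitude_family R p P}" for g :: "'a \<Rightarrow> complex" and x
      using that osc_integral_deriv(1) by auto
    show "partial_deriv b g \<in> {osc_integral (P i) |P. amplitude_family R p P}"
      if "g \<in> {osc_integral (P i) |P. amplitude_family R p P}" "b \<in> Basis" for g :: "'a \<Rightarrow> complex" and b
      using that pd step by blast
  qed
  show "\<exists>C\<ge>0. \<forall>i s. jet_bound K (osc_integral (Q i)) s (C / (1 + norm s) ^ k)"
    using Q
  proof (induction K arbitrary: Q)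
    case 0
    obtain C where "0 \<le> C" "\<And>i s. (1 + norm s) ^ k * cmod (osc_integral (Q i) s) \<le> C"
      using osc_integral_decay[OF 0, of k] by blast
    moreover have "0 < 1 + norm s" for s :: 'a by (simp add: add_pos_nonneg)
    ultimately show ?case by (intro exI[of _ C]) (auto simp: field_simps)
  next
    case (Suc K)
    obtain C where C: "0 \<le> C" "\<And>i s. (1 + norm s) ^ k * cmod (osc_integral (Q i) s) \<le> C"
      using osc_integral_decay[OF Suc.prems, of k] by blast
    have "\<exists>D. \<forall>b\<in>Basis. 0 \<le> D b \<and> (\<forall>i s. jet_bound K (osc_integral (step b Q i)) s (D b / (1 + norm s) ^ k))"
      using Suc.IH[OF step[OF _ Suc.prems]] by metis
    then obtain D where D: "\<And>b. b \<in> Basis \<Longrightarrow> 0 \<le> D b"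
      "\<And>b i s. b \<in> Basis \<Longrightarrow> jet_bound K (osc_integral (step b Q i)) s (D b / (1 + norm s) ^ k)"
      by blast
    define E where "E = C + (\<Sum>b\<in>Basis. D b)"
    have D_le: "D b \<le> E" if "b \<in> Basis" for b
      using member_le_sum[of b Basis D] that D C by (auto simp: E_def)
    have "jet_bound (Suc K) (osc_integral (Q i)) s (E / (1 + norm s) ^ k)" for i s
      unfolding jet_bound_Suc
    proof (intro conjI ballI)
      have pos: "0 < 1 + norm s" by (simp add: add_pos_nonneg)
      have "C \<le> E"
        using D by (auto simp: E_def intro: sum_nonneg)
      then show "cmod (osc_integral (Q i) s) \<le> E / (1 + norm s) ^ k"
        using C(2)[of s i] pos by (simp add: field_simps)
      show "jet_bound K (partial_deriv b (osc_integral (Q i))) s (E / (1 + norm s) ^ k)" if "b \<in> Basis" for b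
        unfolding pd[OF that Suc.prems]
        by (rule jet_bound_mono[OF D(2)[OF that]]) (use D_le[OF that] in \<open>auto intro!: divide_right_mono\<close>)
    qed
    moreover have "0 \<le> E"
      using D C by (auto simp: E_def intro!: add_nonneg_nonneg sum_nonneg)
    ultimately show ?case by blast
  qed
qed

subsection \<open>Rescaling to unit scale\<close>

text \<open>The substitution \<open>x' = y + sqrt h *\<^sub>R s'\<close>,
  \<open>\<xi> = \<eta> + sqrt h *\<^sub>R \<sigma>\<close> turns the phase at \<open>h\<close> into
  the phase at 1. The two Jacobians together cancel the power of \<open>h\<close> in the
  normalization.\<close>

lemma quantize_coherent_state:
  fixes c :: "(real^'n) \<times> (real^'n) \<Rightarrow> complex"
  assumes h: "h > 0"
  shows "quantize t h c (coherent_state v y \<eta> h) =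
    coherent_state (quantize t 1 (\<lambda>z. c ((y, \<eta>) + sqrt h *\<^sub>R z)) v) y \<eta> h"
proof
  fix x :: "real^'n"
  define s where "s = (1 / sqrt h) *\<^sub>R (x - y)"
  have x: "x = y + sqrt h *\<^sub>R s"
    using h by (simp add: s_def)
  let ?n = "CARD('n)"
  define k where "k = complex_of_real (h powr (- real ?n / 4))"
  have sh: "sqrt h > 0" "sqrt h * sqrt h = h"
    using h by auto
  define F where "F = (\<lambda>\<xi> x'. c (t *\<^sub>R x + (1 - t) *\<^sub>R x', \<xi>) * cis (((x - x') \<bullet> \<xi>) / h) * coherent_state v y \<eta> h x')"
  define G where "G = (\<lambda>\<sigma> s'. c ((y, \<eta>) + sqrt h *\<^sub>R (t *\<^sub>R s + (1 - t) *\<^sub>R s', \<sigma>)) * cis ((s - s') \<bullet> \<sigma>) * v s')"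
  have FG: "F (\<eta> + sqrt h *\<^sub>R \<sigma>) (y + sqrt h *\<^sub>R s') = k * cis ((x \<bullet> \<eta>) / h) * G \<sigma> s'" for \<sigma> s'
  proof -
    have 1: "t *\<^sub>R x + (1 - t) *\<^sub>R (y + sqrt h *\<^sub>R s') = y + sqrt h *\<^sub>R (t *\<^sub>R s + (1 - t) *\<^sub>R s')"
      by (simp add: x algebra_simps)
    \<comment> \<open>The kernel contributes \<open>(x - x') \<bullet> \<eta>\<close> and the state
      \<open>x' \<bullet> \<eta>\<close>; their sum no longer involves \<open>x'\<close> and comes
      out of the integral.\<close>
    have 2: "((x - (y + sqrt h *\<^sub>R s')) \<bullet> (\<eta> + sqrt h *\<^sub>R \<sigma>)) / h + ((y + sqrt h *\<^sub>R s') \<bullet> \<eta>) / h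
       = (x \<bullet> \<eta>) / h + (s - s') \<bullet> \<sigma>"
    proof -
      have "(x - (y + sqrt h *\<^sub>R s')) \<bullet> (\<eta> + sqrt h *\<^sub>R \<sigma>) + (y + sqrt h *\<^sub>R s') \<bullet> \<eta>
        = x \<bullet> \<eta> + (sqrt h * sqrt h) * ((s - s') \<bullet> \<sigma>)"
        by (simp only: x inner_add_left inner_add_right inner_diff_left inner_scaleR_left inner_scaleR_right)
          (simp only: algebra_simps)
      then show ?thesis
        using h sh by (simp add: add_divide_distrib[symmetric]) (simp add: field_simps)
    qed
    have 3: "coherent_state v y \<eta> h (y + sqrt h *\<^sub>R s') = k * v s' * cis (((y + sqrt h *\<^sub>R s') \<bullet> \<eta>) / h)"
      using h by (simp add: coherent_state_def k_def)
    have "F (\<eta> + sqrt h *\<^sub>R \<sigma>) (y + sqrt h *\<^sub>R s') =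
       c ((y, \<eta>) + sqrt h *\<^sub>R (t *\<^sub>R s + (1 - t) *\<^sub>R s', \<sigma>)) * k * v s' *
       (cis (((x - (y + sqrt h *\<^sub>R s')) \<bullet> (\<eta> + sqrt h *\<^sub>R \<sigma>)) / h) * cis (((y + sqrt h *\<^sub>R s') \<bullet> \<eta>) / h))"
      unfolding F_def 1 3 by simp
    also have "\<dots> = c ((y, \<eta>) + sqrt h *\<^sub>R (t *\<^sub>R s + (1 - t) *\<^sub>R s', \<sigma>)) * k * v s' *
       (cis ((x \<bullet> \<eta>) / h) * cis ((s - s') \<bullet> \<sigma>))"
      unfolding cis_mult 2 ..
    finally show ?thesis by (simp add: G_def mult_ac)
  qed
  have inner: "(LINT x'|lborel. F (\<eta> + sqrt h *\<^sub>R \<sigma>) x') =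
      sqrt h ^ ?n * (k * cis ((x \<bullet> \<eta>) / h) * (LINT s'|lborel. G \<sigma> s'))" for \<sigma>
    using lborel_integral_affine[OF sh(1), of "F (\<eta> + sqrt h *\<^sub>R \<sigma>)" y]
    by (simp add: FG scaleR_conv_of_real[where 'a=complex])
  have "(LINT \<xi>|lborel. LINT x'|lborel. F \<xi> x') =
      sqrt h ^ ?n * (LINT \<sigma>|lborel. sqrt h ^ ?n * (k * cis ((x \<bullet> \<eta>) / h) * (LINT s'|lborel. G \<sigma> s')))"
    using lborel_integral_affine[OF sh(1), of "\<lambda>\<xi>. LINT x'|lborel. F \<xi> x'" \<eta>]
    by (simp add: inner scaleR_conv_of_real[where 'a=complex])
  also have "\<dots> = (complex_of_real (sqrt h) * complex_of_real (sqrt h)) ^ ?n *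
      (k * cis ((x \<bullet> \<eta>) / h) * (LINT \<sigma>|lborel. LINT s'|lborel. G \<sigma> s'))"
    by (simp add: power_mult_distrib)
  also have "complex_of_real (sqrt h) * complex_of_real (sqrt h) = complex_of_real h"
    using sh(2) by (simp flip: of_real_mult)
  finally have "quantize t h c (coherent_state v y \<eta> h) x = of_real (1 / (2 * pi * h) ^ ?n) *
     (of_real h ^ ?n * (k * cis ((x \<bullet> \<eta>) / h) * (LINT \<sigma>|lborel. LINT s'|lborel. G \<sigma> s')))"
    by (simp add: quantize_def F_def)
  also have "\<dots> = k * (of_real (1 / (2 * pi) ^ ?n) * (LINT \<sigma>|lborel. LINT s'|lborel. G \<sigma> s')) * cis ((x \<bullet> \<eta>) / h)"
    using h by (simp add: power_mult_distrib field_simps)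
  finally show "quantize t h c (coherent_state v y \<eta> h) x =
     coherent_state (quantize t 1 (\<lambda>z. c ((y, \<eta>) + sqrt h *\<^sub>R z)) v) y \<eta> h x"
    by (simp add: coherent_state_def quantize_def k_def G_def s_def)
qed

subsection \<open>Schwartz functions with compactly supported Fourier transform\<close>

lemma schwartz_continuous: "schwartz \<phi> \<Longrightarrow> continuous_on UNIV \<phi>"
  by (simp add: schwartz_def smooth_continuous_on)

lemma schwartz_decay: "schwartz \<phi> \<Longrightarrow> \<exists>C. \<forall>x. (1 + norm x) ^ k * cmod (\<phi> x) \<le> C"
  unfolding schwartz_def by (auto dest: bspec[of _ _ "[]"])

lemma schwartz_integrable:
  fixes \<phi> :: "real^'n \<Rightarrow> complex"
  assumes "schwartz \<phi>"
  shows "integrable lborel \<phi>"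
proof -
  obtain C where "\<And>x. (1 + norm x) ^ (2 * DIM(real^'n)) * cmod (\<phi> x) \<le> C"
    using schwartz_decay[OF assms, of "2 * DIM(real^'n)"] by blast
  then show ?thesis
    by (rule integrable_decay[OF continuous_borel_measurable[OF schwartz_continuous[OF assms]]])
qed

lemma schwartz_fourier:
  fixes \<phi> :: "real^'n \<Rightarrow> complex"
  assumes "schwartz \<phi>"
  shows "smooth (fourier 1 \<phi>)" and "\<exists>C. \<forall>\<xi>. jet_bound K (fourier 1 \<phi>) \<xi> C"
proof -
  define c where "c = complex_of_real ((2 * pi) powr (- real CARD('n) / 2))"
  define F where "F \<xi> = (LINT x|lborel. \<phi> x * cis (- (x \<bullet> \<xi>)))" for \<xi>
  have F: "smooth F" "\<exists>C. \<forall>\<xi>. jet_bound K F \<xi> C"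
    using smooth_fourier_integral[OF schwartz_continuous schwartz_decay, OF assms assms]
    unfolding F_def by blast+
  have eq: "fourier 1 \<phi> = (\<lambda>\<xi>. c * F \<xi>)"
    by (simp add: fourier_def c_def F_def fun_eq_iff)
  show "smooth (fourier 1 \<phi>)" and "\<exists>C. \<forall>\<xi>. jet_bound K (fourier 1 \<phi>) \<xi> C"
    unfolding eq using F jet_bound_cmult smooth_cmult by blast+
qed

text \<open>Bounded support of the transform supplies the integrability required for inversion; the
  two unitary normalizations multiply to the inverse of \<open>(2 * pi) ^ CARD('n)\<close>.\<close>

lemma schwartz_fourier_inversion:
  fixes \<phi> :: "real^'n \<Rightarrow> complex"
  assumes \<phi>: "schwartz \<phi>" and supp: "\<And>\<xi>. R < norm \<xi> \<Longrightarrow> fourier 1 \<phi> \<xi> = 0"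
  shows "of_real ((2 * pi) powr (- real CARD('n) / 2)) * (LINT \<zeta>|lborel. fourier 1 \<phi> \<zeta> * cis (s \<bullet> \<zeta>)) = \<phi> s"
proof -
  define c where "c = (2 * pi) powr (- real CARD('n) / 2)"
  define F where "F \<xi> = (LINT x|lborel. \<phi> x * cis (- (x \<bullet> \<xi>)))" for \<xi>
  have eq: "fourier 1 \<phi> = (\<lambda>\<xi>. of_real c * F \<xi>)"
    by (simp add: fourier_def c_def F_def fun_eq_iff)
  have c: "c > 0" by (simp add: c_def)
  have "c * c = 1 / (2 * pi) ^ CARD('n)"
    by (simp add: c_def powr_add[symmetric] powr_minus_divide powr_realpow)
  then have cc: "c * c * (2 * pi) ^ CARD('n) = 1" by simp
  obtain B where B: "\<And>x. cmod (\<phi> x) \<le> B"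
    using schwartz_decay[OF \<phi>, of 0] by auto
  obtain C where C: "\<And>\<xi>. cmod (fourier 1 \<phi> \<xi>) \<le> C"
    using schwartz_fourier(2)[OF \<phi>, of 0] by auto
  have "integrable lborel (fourier 1 \<phi>)"
  proof (rule integrable_bounded_cball)
    show "fourier 1 \<phi> \<in> borel_measurable borel"
      by (rule continuous_borel_measurable[OF smooth_continuous_on[OF schwartz_fourier(1)[OF \<phi>]]])
    show "cmod (fourier 1 \<phi> x) \<le> C * indicator (cball 0 R) x" for x
      using C[of x] supp[of x] by (auto split: split_indicator)
  qed
  then have "integrable lborel (\<lambda>\<xi>. of_real (1 / c) * fourier 1 \<phi> \<xi>)"
    by (rule integrable_mult_right)
  then have "integrable lborel F"
    using c by (simp add: eq)
  then have "(LINT \<zeta>|lborel. F \<zeta> * cis (s \<bullet> \<zeta>)) = (2 * pi) ^ CARD('n) * \<phi> s"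
    using fourier_inversion_integral[OF schwartz_continuous[OF \<phi>] B schwartz_integrable[OF \<phi>]]
    by (simp add: F_def[abs_def])
  then have "of_real c * (LINT \<zeta>|lborel. fourier 1 \<phi> \<zeta> * cis (s \<bullet> \<zeta>)) = of_real (c * c * (2 * pi) ^ CARD('n)) * \<phi> s"
    by (simp add: eq mult.assoc)
  then show ?thesis
    unfolding cc by (simp add: c_def)
qed

text \<open>The amplitude left when the inner integral of \<open>quantize 1 1 b \<phi>\<close> has
  been recognized as a Fourier transform, normalizing constant included.\<close>

definition wave_amplitude ::
    "(real^'n \<Rightarrow> complex) \<Rightarrow> ((real^'n) \<times> (real^'n) \<Rightarrow> complex) \<Rightarrow> (real^'n) \<times> (real^'n) \<Rightarrow> complex" where
  "wave_amplitude \<phi> b z = b z * (of_real ((2 * pi) powr (- real CARD('n) / 2)) * fourier 1 \<phi> (snd z))"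

lemma quantize_eq_osc_integral:
  fixes b :: "(real^'n) \<times> (real^'n) \<Rightarrow> complex"
  shows "quantize 1 1 b \<phi> = osc_integral (wave_amplitude \<phi> b)"
proof
  fix s
  have "quantize 1 1 b \<phi> s = of_real ((2 * pi) powr (- real CARD('n) / 2)) *
    (LINT \<xi>|lborel. b (s, \<xi>) * cis (s \<bullet> \<xi>) * fourier 1 \<phi> \<xi>)"
    by (subst quantize_1) auto
  also have "\<dots> = osc_integral (wave_amplitude \<phi> b) s"
    unfolding osc_integral_def wave_amplitude_def
    by (subst integral_mult_right_zero[symmetric]) (simp add: mult_ac)
  finally show "quantize 1 1 b \<phi> s = osc_integral (wave_amplitude \<phi> b) s" .
qed

text \<open>Where \<open>norm \<zeta> \<le> R\<close>, growth of the symbol in \<open>z\<close> is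
  growth in \<open>s\<close> alone; the factor \<open>fourier 1 \<phi>\<close> cuts off the
  rest.\<close>

lemma amplitude_family_wave:
  fixes B :: "'i \<Rightarrow> (real^'n) \<times> (real^'n) \<Rightarrow> complex"
  assumes \<phi>: "schwartz \<phi>" and R: "0 \<le> R" and supp: "\<And>\<xi>. R < norm \<xi> \<Longrightarrow> fourier 1 \<phi> \<xi> = 0"
    and B: "\<And>i. smooth (B i)"
    and bd: "\<And>K. \<exists>C\<ge>0. \<forall>i z. jet_bound K (B i) z (C * (1 + norm z) ^ p)"
  shows "amplitude_family R p (\<lambda>i. wave_amplitude \<phi> (B i))"
proof -
  define k where "k = complex_of_real ((2 * pi) powr (- real CARD('n) / 2))"
  define g where "g = (\<lambda>\<zeta>. k * fourier 1 \<phi> \<zeta>)"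
  have g: "smooth g"
    unfolding g_def by (intro smooth_cmult schwartz_fourier \<phi>)
  have g_bd: "\<exists>C. \<forall>\<zeta>. jet_bound K g \<zeta> C" for K
    unfolding g_def using schwartz_fourier[OF \<phi>] jet_bound_cmult by blast
  \<comment> \<open>Directions of the first component are annihilated by \<open>snd\<close>. They
    receive the coefficient 0 and an arbitrary basis vector, as \<open>smooth_affine\<close> asks
    for a basis vector in every case.\<close>
  define \<beta> where "\<beta> b = (if snd b = 0 then SOME b. b \<in> Basis else snd b)" for b :: "(real^'n) \<times> (real^'n)"
  define c where "c b = (if snd b = 0 then 0 else 1::real)" for b :: "(real^'n) \<times> (real^'n)"
  have L: "snd (x + \<tau> *\<^sub>R b) = snd x + (\<tau> * c b) *\<^sub>R \<beta> b" for x b :: "(real^'n) \<times> (real^'n)" and \<tau>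
    by (auto simp: c_def \<beta>_def)
  have \<beta>: "\<beta> b \<in> Basis" if "b \<in> Basis" for b
    using that by (auto simp: \<beta>_def Basis_prod_def some_in_eq)
  have d: "snd differentiable (at x)" for x :: "(real^'n) \<times> (real^'n)"
    by (intro bounded_linear_imp_differentiable bounded_linear_snd)
  have fam0: "amplitude_family R 0 (\<lambda>(i::'i) z. g (snd (z :: (real^'n) \<times> (real^'n))))"
    unfolding amplitude_family_def
  proof (intro conjI allI impI)
    show "smooth (\<lambda>z :: (real^'n) \<times> (real^'n). g (snd z))"
      using smooth_affine[of snd, OF L \<beta> d g] .
    show "g (snd (s :: real^'n, \<zeta>)) = 0" if "R < norm \<zeta>" for s \<zeta>
      using supp[OF that] by (simp add: g_def)
    fix K
    obtain C where C: "\<And>\<zeta>. jet_bound K g \<zeta> C"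
      using g_bd by blast
    have "jet_bound K (\<lambda>z. g (snd z)) (s :: real^'n, \<zeta>) C" for s \<zeta>
      by (rule jet_bound_affine[of snd, OF L \<beta> d g]) (auto simp: c_def C)
    then show "\<exists>C. \<forall>(i::'i) s \<zeta>. jet_bound K (\<lambda>z. g (snd z)) (s :: real^'n, \<zeta>) (C * (1 + norm s) ^ 0)"
      by auto
  qed
  have "amplitude_family R (p + 0) (\<lambda>i z. B i z * g (snd z))"
  proof (rule amplitude_family_mult[OF fam0 B])
    fix K
    obtain C where C: "0 \<le> C" "\<And>i z. jet_bound K (B i) z (C * (1 + norm z) ^ p)"
      using bd by blast
    have "jet_bound K (B i) (s, \<zeta>) (C * (1 + R) ^ p * (1 + norm s) ^ p)" if "norm \<zeta> \<le> R" for i s \<zeta>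
    proof (rule jet_bound_mono[OF C(2) order_refl])
      have "norm (s, \<zeta>) \<le> norm s + R"
        using norm_Pair_le[of s \<zeta>] that by simp
      then have "1 + norm (s, \<zeta>) \<le> (1 + R) * (1 + norm s)"
        using mult_nonneg_nonneg[OF R norm_ge_zero[of s]] by (simp only: distrib_left distrib_right mult_1 mult_1_right)
      then have "(1 + norm (s, \<zeta>)) ^ p \<le> (1 + R) ^ p * (1 + norm s) ^ p"
        unfolding power_mult_distrib[symmetric] by (intro power_mono) auto
      then show "C * (1 + norm (s, \<zeta>)) ^ p \<le> C * (1 + R) ^ p * (1 + norm s) ^ p"
        using C(1) by (simp add: mult.assoc mult_left_mono)
    qed
    then show "\<exists>C\<ge>0. \<forall>i s \<zeta>. norm \<zeta> \<le> R \<longrightarrow> jet_bound K (B i) (s, \<zeta>) (C * (1 + norm s) ^ p)"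
      using C(1) R by (intro exI[of _ "C * (1 + R) ^ p"]) auto
  qed
  then show ?thesis by (simp add: wave_amplitude_def[abs_def] g_def k_def)
qed

subsection \<open>The limit at unit scale\<close>

text \<open>Three nested integrals are handled by dominated convergence: the bounded frequency
  support dominates the innermost, the decay of \<open>w j\<close>, uniform in \<open>j\<close>, the
  next, and integration by parts of \<open>G j \<sigma>\<close> the outermost. The limit is
  evaluated by Fourier inversion.\<close>

theorem quantize_quantize_tendsto:
  fixes B C :: "nat \<Rightarrow> (real^'n) \<times> (real^'n) \<Rightarrow> complex"
  assumes \<phi>: "schwartz \<phi>" and R: "0 \<le> R" and supp: "\<And>\<xi>. R < norm \<xi> \<Longrightarrow> fourier 1 \<phi> \<xi> = 0"
    and B: "\<And>j. smooth (B j)"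
    and B_bd: "\<And>K. \<exists>M\<ge>0. \<forall>j z. jet_bound K (B j) z (M * (1 + norm z) ^ p)"
    and B_lim: "\<And>z. (\<lambda>j. B j z) \<longlonglongrightarrow> 1"
    and C: "\<And>j. smooth (C j)"
    and C_bd: "\<And>K. \<exists>M\<ge>0. \<forall>j z. jet_bound K (C j) z M"
    and C_lim: "\<And>z. (\<lambda>j. C j z) \<longlonglongrightarrow> 1"
    and t: "0 \<le> t" "t \<le> 1"
  shows "(\<lambda>j. quantize t 1 (C j) (quantize 1 1 (B j) \<phi>) s) \<longlonglongrightarrow> \<phi> s"
proof -
  let ?n = "CARD('n)"
  define k where "k = complex_of_real ((2 * pi) powr (- real ?n / 2))"
  define Q where "Q j = wave_amplitude \<phi> (B j)" for j
  have Q: "amplitude_family R p Q"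
    unfolding Q_def by (rule amplitude_family_wave[OF \<phi> R supp B B_bd])
  define w where "w j = osc_integral (Q j)" for j
  have w_eq: "quantize 1 1 (B j) \<phi> = w j" for j
    by (simp add: w_def Q_def quantize_eq_osc_integral)
  have inversion: "k * (LINT \<zeta>|lborel. fourier 1 \<phi> \<zeta> * cis (x \<bullet> \<zeta>)) = \<phi> x" for x
    unfolding k_def by (rule schwartz_fourier_inversion[OF \<phi> supp])
  have w_smooth: "smooth (w j)" for j
    unfolding w_def by (rule smooth_osc_integral[OF Q])
  have w_lim: "(\<lambda>j. w j x) \<longlonglongrightarrow> \<phi> x" for x
  proof -
    obtain D where D: "\<And>j s \<zeta>. cmod (Q j (s, \<zeta>)) \<le> (D * (1 + norm s) ^ p) * indicator (cball 0 R) \<zeta>"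
      using amplitude_family_fibre_bound[OF Q, of "[]"] by auto
    have "(\<lambda>j. LINT \<zeta>|lborel. Q j (x, \<zeta>) * cis (x \<bullet> \<zeta>)) \<longlonglongrightarrow> (LINT \<zeta>|lborel. k * (fourier 1 \<phi> \<zeta> * cis (x \<bullet> \<zeta>)))"
    proof (rule integral_dominated_convergence[where w = "\<lambda>\<zeta>. (D * (1 + norm x) ^ p) * indicator (cball 0 R) \<zeta>"])
      show "AE \<zeta> in lborel. (\<lambda>j. Q j (x, \<zeta>) * cis (x \<bullet> \<zeta>)) \<longlonglongrightarrow> k * (fourier 1 \<phi> \<zeta> * cis (x \<bullet> \<zeta>))"
      proof (rule AE_I2)
        fix \<zeta>
        have "(\<lambda>j. B j (x, \<zeta>) * (k * fourier 1 \<phi> \<zeta>) * cis (x \<bullet> \<zeta>)) \<longlonglongrightarrow> 1 * (k * fourier 1 \<phi> \<zeta>) * cis (x \<bullet> \<zeta>)"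
          by (intro tendsto_intros B_lim)
        then show "(\<lambda>j. Q j (x, \<zeta>) * cis (x \<bullet> \<zeta>)) \<longlonglongrightarrow> k * (fourier 1 \<phi> \<zeta> * cis (x \<bullet> \<zeta>))"
          by (simp add: Q_def wave_amplitude_def k_def mult.assoc)
      qed
      show "AE \<zeta> in lborel. norm (Q j (x, \<zeta>) * cis (x \<bullet> \<zeta>)) \<le> D * (1 + norm x) ^ p * indicat_real (cball 0 R) \<zeta>" for j
        using D by (simp add: norm_mult)
      show "(\<lambda>\<zeta>. Q j (x, \<zeta>) * cis (x \<bullet> \<zeta>)) \<in> borel_measurable lborel" for j
        using smooth_Pair_measurable(2)[OF amplitude_family_smooth[OF Q]] by simp
      have "continuous_on UNIV (\<lambda>\<zeta>. k * (fourier 1 \<phi> \<zeta> * cis (x \<bullet> \<zeta>)))"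
        by (intro continuous_intros smooth_continuous_on schwartz_fourier \<phi>)
      then show "(\<lambda>\<zeta>. k * (fourier 1 \<phi> \<zeta> * cis (x \<bullet> \<zeta>))) \<in> borel_measurable lborel"
        by simp
      show "integrable lborel (\<lambda>\<zeta>::real^'n. (D * (1 + norm x) ^ p) * indicator (cball 0 R) \<zeta>)"
        by (intro integrable_mult_right integrable_real_indicator)
          (auto simp: emeasure_lborel_cball_finite[unfolded infinity_ennreal_def])
    qed
    moreover have "(LINT \<zeta>|lborel. k * (fourier 1 \<phi> \<zeta> * cis (x \<bullet> \<zeta>))) = \<phi> x"
      using inversion[of x] by simp
    ultimately show ?thesis by (simp add: w_def osc_integral_def)
  qed
  \<comment> \<open>One exponent with two uses: it is the integrable decay of \<open>w j\<close> in
    position and the number of integrations by parts that give \<open>J j\<close> an integrable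
    bound.\<close>
  define m where "m = 2 * DIM(real^'n)"
  obtain D where D: "0 \<le> D" "\<And>j x. jet_bound m (w j) x (D / (1 + norm x) ^ m)"
    using osc_integral_jet_decay[OF Q, of m m] unfolding w_def by blast
  obtain M where M: "0 \<le> M" "\<And>j z. jet_bound m (C j) z M"
    using C_bd by blast
  have pos: "0 < 1 + norm x" for x :: "real^'n" by (simp add: add_pos_nonneg)
  define L where "L \<sigma> s' = (t *\<^sub>R s + (1 - t) *\<^sub>R s', \<sigma>)" for \<sigma> s' :: "real^'n"
  have L: "L \<sigma> (x + \<tau> *\<^sub>R b) = L \<sigma> x + (\<tau> * (1 - t)) *\<^sub>R (b, 0)" for \<sigma> x b \<tau>
    by (simp add: L_def algebra_simps)
  have Lb: "(b, 0) \<in> Basis" if "b \<in> Basis" for b :: "real^'n"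
    using that by (auto simp: Basis_prod_def)
  have Ld: "L \<sigma> differentiable (at x)" for \<sigma> x
    unfolding L_def by (auto intro!: derivative_intros simp: differentiable_def) 
       (auto intro!: exI derivative_eq_intros)
  have L_cont: "continuous_on UNIV (\<lambda>z. L (fst z) (snd z))"
    unfolding L_def by (intro continuous_intros)
  define G where "G j \<sigma> s' = C j (L \<sigma> s') * w j s'" for j \<sigma> s'
  have G_smooth: "smooth (G j \<sigma>)" for j \<sigma>
    unfolding G_def by (intro smooth_mult w_smooth smooth_affine[OF L Lb Ld C])
  define E where "E = 2 ^ m * M * D"
  have G_bd: "jet_bound m (G j \<sigma>) x (E / (1 + norm x) ^ m)" for j \<sigma> x
  proof -
    have "jet_bound m (\<lambda>s'. C j (L \<sigma> s')) x M"
      by (rule jet_bound_affine[OF L Lb Ld C]) (use M t in auto)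
    from jet_bound_mult[OF smooth_affine[OF L Lb Ld C] w_smooth this D(2)]
    show ?thesis by (simp add: G_def[abs_def] E_def)
  qed
  define J where "J j \<sigma> = (LINT s'|lborel. G j \<sigma> s' * cis (s' \<bullet> - \<sigma>))" for j \<sigma>
  have quant: "quantize t 1 (C j) (w j) s = of_real (1 / (2 * pi) ^ ?n) * (LINT \<sigma>|lborel. cis (s \<bullet> \<sigma>) * J j \<sigma>)" for j
  proof -
    have "(LINT y|lborel. C j (t *\<^sub>R s + (1 - t) *\<^sub>R y, \<sigma>) * cis (((s - y) \<bullet> \<sigma>) / 1) * w j y) = cis (s \<bullet> \<sigma>) * J j \<sigma>" for \<sigma>
    proof -
      have "cis ((s - y) \<bullet> \<sigma>) = cis (s \<bullet> \<sigma>) * cis (y \<bullet> - \<sigma>)" for y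
        by (simp add: cis_mult inner_diff_left)
      then have eq: "C j (t *\<^sub>R s + (1 - t) *\<^sub>R y, \<sigma>) * cis (((s - y) \<bullet> \<sigma>) / 1) * w j y =
          cis (s \<bullet> \<sigma>) * (G j \<sigma> y * cis (y \<bullet> - \<sigma>))" for y
        by (simp add: G_def L_def mult_ac)
      show ?thesis
        unfolding eq J_def by (rule integral_mult_right_zero)
    qed
    then show ?thesis by (simp add: quantize_def)
  qed
  have J_lim: "(\<lambda>j. J j \<sigma>) \<longlonglongrightarrow> (LINT s'|lborel. \<phi> s' * cis (s' \<bullet> - \<sigma>))" for \<sigma>
    unfolding J_def
  proof (rule integral_dominated_convergence[where w = "\<lambda>x. E * (1 / (1 + norm x) ^ m)"])
    show "AE x in lborel. (\<lambda>j. G j \<sigma> x * cis (x \<bullet> - \<sigma>)) \<longlonglongrightarrow> \<phi> x * cis (x \<bullet> - \<sigma>)"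
    proof (rule AE_I2)
      fix x
      have "(\<lambda>j. C j (L \<sigma> x) * w j x * cis (x \<bullet> - \<sigma>)) \<longlonglongrightarrow> 1 * \<phi> x * cis (x \<bullet> - \<sigma>)"
        by (intro tendsto_intros C_lim w_lim)
      then show "(\<lambda>j. G j \<sigma> x * cis (x \<bullet> - \<sigma>)) \<longlonglongrightarrow> \<phi> x * cis (x \<bullet> - \<sigma>)"
        by (simp add: G_def)
    qed
    show "AE x in lborel. norm (G j \<sigma> x * cis (x \<bullet> - \<sigma>)) \<le> E * (1 / (1 + norm x) ^ m)" for j
      using jet_bound_val[OF G_bd] by (simp add: norm_mult)
    have "continuous_on UNIV (\<lambda>x. G j \<sigma> x * cis (x \<bullet> - \<sigma>))" for j
      by (intro continuous_intros smooth_continuous_on G_smooth)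
    then show "(\<lambda>x. G j \<sigma> x * cis (x \<bullet> - \<sigma>)) \<in> borel_measurable lborel" for j
      by simp
    have "continuous_on UNIV (\<lambda>x. \<phi> x * cis (x \<bullet> - \<sigma>))"
      by (intro continuous_intros schwartz_continuous \<phi>)
    then show "(\<lambda>x. \<phi> x * cis (x \<bullet> - \<sigma>)) \<in> borel_measurable lborel"
      by simp
    show "integrable lborel (\<lambda>x::real^'n. E * (1 / (1 + norm x) ^ m))"
      unfolding m_def by (intro integrable_mult_right integrable_weight)
  qed
  define W where "W = (1 + DIM(real^'n)) ^ Suc m * E * (LINT x|lborel. 1 / (1 + norm (x::real^'n)) ^ m)"
  have J_bd: "cmod (J j \<sigma>) \<le> W * (1 / (1 + norm \<sigma>) ^ m)" for j \<sigma>
    using smooth_fourier_decay[OF G_smooth[of j \<sigma>], of m E "- \<sigma>"] G_bd pos[of \<sigma>]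
    by (simp add: J_def W_def m_def field_simps)
  \<comment> \<open>Measurability in the parameter comes from joint continuity of the integrand in
    \<open>\<sigma>\<close> and \<open>s'\<close>.\<close>
  have J_meas: "J j \<in> borel_measurable lborel" for j
  proof -
    have "continuous_on UNIV (\<lambda>z. C j (L (fst z) (snd z)) * w j (snd z) * cis (snd z \<bullet> - fst z))"
      by (intro continuous_intros continuous_on_compose2[OF smooth_continuous_on[OF C, of UNIV] L_cont]
          continuous_on_compose2[OF smooth_continuous_on[OF w_smooth, of UNIV]]) auto
    then have "(\<lambda>z. C j (L (fst z) (snd z)) * w j (snd z) * cis (snd z \<bullet> - fst z)) \<in> borel_measurable (lborel \<Otimes>\<^sub>M lborel)"
      by (simp add: lborel_prod)
    then have "(\<lambda>\<sigma>. LINT s'|lborel. C j (L \<sigma> s') * w j s' * cis (s' \<bullet> - \<sigma>)) \<in> borel_measurable lborel"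
      by (intro lborel.borel_measurable_lebesgue_integral) (simp add: case_prod_beta')
    then show ?thesis by (simp add: J_def[abs_def] G_def)
  qed
  have F_eq: "fourier 1 \<phi> \<sigma> = k * (LINT s'|lborel. \<phi> s' * cis (s' \<bullet> - \<sigma>))" for \<sigma>
    by (simp add: fourier_def k_def)
  have k0: "k \<noteq> 0" by (simp add: k_def)
  have "(\<lambda>j. LINT \<sigma>|lborel. cis (s \<bullet> \<sigma>) * J j \<sigma>) \<longlonglongrightarrow> (LINT \<sigma>|lborel. fourier 1 \<phi> \<sigma> * cis (s \<bullet> \<sigma>) / k)"
  proof (rule integral_dominated_convergence[where w = "\<lambda>x. W * (1 / (1 + norm x) ^ m)"])
    show "AE \<sigma> in lborel. (\<lambda>j. cis (s \<bullet> \<sigma>) * J j \<sigma>) \<longlonglongrightarrow> fourier 1 \<phi> \<sigma> * cis (s \<bullet> \<sigma>) / k"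
    proof (rule AE_I2)
      fix \<sigma>
      have "(\<lambda>j. cis (s \<bullet> \<sigma>) * J j \<sigma>) \<longlonglongrightarrow> cis (s \<bullet> \<sigma>) * (LINT s'|lborel. \<phi> s' * cis (s' \<bullet> - \<sigma>))"
        by (intro tendsto_intros J_lim)
      then show "(\<lambda>j. cis (s \<bullet> \<sigma>) * J j \<sigma>) \<longlonglongrightarrow> fourier 1 \<phi> \<sigma> * cis (s \<bullet> \<sigma>) / k"
        unfolding F_eq using k0 by (simp add: mult.commute)
    qed
    show "AE \<sigma> in lborel. norm (cis (s \<bullet> \<sigma>) * J j \<sigma>) \<le> W * (1 / (1 + norm \<sigma>) ^ m)" for j
      using J_bd by (simp add: norm_mult)
    have "continuous_on UNIV (\<lambda>\<sigma>. cis (s \<bullet> \<sigma>))"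
      by (intro continuous_intros)
    then have "(\<lambda>\<sigma>. cis (s \<bullet> \<sigma>)) \<in> borel_measurable lborel"
      by simp
    then show "(\<lambda>\<sigma>. cis (s \<bullet> \<sigma>) * J j \<sigma>) \<in> borel_measurable lborel" for j
      using J_meas by (intro borel_measurable_times)
    have "continuous_on UNIV (\<lambda>\<sigma>. fourier 1 \<phi> \<sigma> * cis (s \<bullet> \<sigma>) / k)"
      by (intro continuous_intros smooth_continuous_on schwartz_fourier \<phi>) (use k0 in auto)
    then show "(\<lambda>\<sigma>. fourier 1 \<phi> \<sigma> * cis (s \<bullet> \<sigma>) / k) \<in> borel_measurable lborel"
      by simp
    show "integrable lborel (\<lambda>x::real^'n. W * (1 / (1 + norm x) ^ m))"
      unfolding m_def by (intro integrable_mult_right integrable_weight)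
  qed
  then have "(\<lambda>j. quantize t 1 (C j) (w j) s) \<longlonglongrightarrow>
     of_real (1 / (2 * pi) ^ ?n) * (LINT \<sigma>|lborel. fourier 1 \<phi> \<sigma> * cis (s \<bullet> \<sigma>) / k)"
    unfolding quant by (intro tendsto_intros)
  \<comment> \<open>One factor \<open>k\<close> cancels the division by \<open>k\<close>, the other
    belongs to the inversion formula.\<close>
  also have "of_real (1 / (2 * pi) ^ ?n) = k * k"
  proof -
    have "1 / (2 * pi) ^ ?n = (2 * pi) powr (- real ?n / 2) * (2 * pi) powr (- real ?n / 2)"
      by (simp add: powr_add[symmetric] powr_minus_divide powr_realpow)
    then show ?thesis
      unfolding k_def by (metis of_real_mult)
  qed
  also have "k * k * (LINT \<sigma>|lborel. fourier 1 \<phi> \<sigma> * cis (s \<bullet> \<sigma>) / k) = \<phi> s"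
    using inversion[of s] k0 by simp
  finally show ?thesis by (simp add: w_eq)
qed

subsection \<open>Interpolation of derivatives\<close>

text \<open>The chain \<open>f 0\<close>, \<open>f 1\<close>, and so on encodes a function with its
  successive derivatives. The constant is independent of position and length of the interval, as a
  recursion over subintervals requires.\<close>

definition small_derivative_const :: "nat \<Rightarrow> real \<Rightarrow> bool" where
  "small_derivative_const L c \<longleftrightarrow> 0 \<le> c \<and> (\<forall>a l m (f :: nat \<Rightarrow> real \<Rightarrow> real). l > 0 \<longrightarrow>
     (\<forall>i x. i < L \<longrightarrow> (f i has_real_derivative f (Suc i) x) (at x)) \<longrightarrow>
     (\<forall>x\<in>{a..a + l}. \<bar>f 0 x\<bar> \<le> m) \<longrightarrow> (\<exists>x\<in>{a..a + l}. \<bar>f L x\<bar> * l ^ L \<le> c * m))"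

lemmas small_derivative_constD = small_derivative_const_def[THEN iffD1, THEN conjunct2, rule_format]

text \<open>Each outer third of the interval contains a point where the derivative of order
  \<open>L\<close> is small. The mean value theorem between these points, which are at least a third
  of the length apart, yields the next order and the constant
  \<open>2 * 3 ^ Suc L * c\<close>.\<close>

lemma exists_small_derivative: "\<exists>c. small_derivative_const L c"
proof (induction L)
  case 0
  show ?case
    unfolding small_derivative_const_def by (intro exI[of _ 1] conjI allI impI) (auto intro!: bexI)
next
  case (Suc L)
  obtain c where c: "small_derivative_const L c"
    using Suc.IH by blast
  then have c0: "0 \<le> c" by (simp add: small_derivative_const_def)
  show ?case
    unfolding small_derivative_const_def
  proof (intro exI[of _ "2 * 3 ^ Suc L * c"] conjI allI impI)
    fix a l m and f :: "nat \<Rightarrow> real \<Rightarrow> real"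
    assume l: "l > 0" and der: "\<forall>i x. i < Suc L \<longrightarrow> (f i has_real_derivative f (Suc i) x) (at x)"
      and m: "\<forall>x\<in>{a..a + l}. \<bar>f 0 x\<bar> \<le> m"
    obtain x where x: "x \<in> {a..a + l / 3}" "\<bar>f L x\<bar> * (l / 3) ^ L \<le> c * m"
      using small_derivative_constD[OF c, of "l / 3" f a m] l der m by auto
    obtain y where y: "y \<in> {a + 2 * l / 3..a + 2 * l / 3 + l / 3}" "\<bar>f L y\<bar> * (l / 3) ^ L \<le> c * m"
      using small_derivative_constD[OF c, of "l / 3" f "a + 2 * l / 3" m] l der m by auto
    have xy: "x < y" "l / 3 \<le> y - x"
      using x y l by auto
    obtain z where z: "x < z" "z < y" "f L y - f L x = (y - x) * f (Suc L) z"
      using MVT2[OF xy(1), of "f L" "f (Suc L)"] der by auto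
    have "(l / 3) * (\<bar>f (Suc L) z\<bar> * (l / 3) ^ L) \<le> (y - x) * (\<bar>f (Suc L) z\<bar> * (l / 3) ^ L)"
      using xy l by (intro mult_right_mono) auto
    then have "\<bar>f (Suc L) z\<bar> * (l / 3) ^ Suc L \<le> \<bar>f (Suc L) z\<bar> * (y - x) * (l / 3) ^ L"
      by (simp add: mult_ac)
    also have "\<dots> = \<bar>f L y - f L x\<bar> * (l / 3) ^ L"
      using xy by (simp add: z(3) abs_mult)
    also have "\<dots> \<le> (\<bar>f L y\<bar> + \<bar>f L x\<bar>) * (l / 3) ^ L"
      using l by (intro mult_right_mono) auto
    also have "\<dots> \<le> 2 * c * m"
      using x y by (simp add: distrib_right)
    finally have "\<bar>f (Suc L) z\<bar> * l ^ Suc L \<le> 2 * 3 ^ Suc L * c * m"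
      by (simp add: power_divide field_simps)
    moreover have "z \<in> {a..a + l}"
      using x y z by auto
    ultimately show "\<exists>x\<in>{a..a + l}. \<bar>f (Suc L) x\<bar> * l ^ Suc L \<le> 2 * 3 ^ Suc L * c * m"
      by blast
  qed (use c0 in auto)
qed

definition interpolation_const_real :: "nat \<Rightarrow> real \<Rightarrow> bool" where
  "interpolation_const_real L c \<longleftrightarrow> 0 \<le> c \<and> (\<forall>m B (f :: nat \<Rightarrow> real \<Rightarrow> real) x.
     (\<forall>i x. i < L \<longrightarrow> (f i has_real_derivative f (Suc i) x) (at x)) \<longrightarrow>
     (\<forall>x\<in>{0..1}. \<bar>f 0 x\<bar> \<le> m) \<longrightarrow> (\<forall>x\<in>{0..1}. \<bar>f L x\<bar> \<le> B) \<longrightarrow>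
     x \<in> {0..1} \<longrightarrow> \<bar>f 1 x\<bar> \<le> c * (m + B))"

lemmas interpolation_const_realD = interpolation_const_real_def[THEN iffD1, THEN conjunct2, rule_format]

text \<open>A Landau-Kolmogorov type inequality. The derivative of order \<open>L\<close> is at most
  a multiple of \<open>m\<close> somewhere, and its own derivative is at most \<open>B\<close>, so
  it is controlled on the whole interval; this reduces order \<open>L + 1\<close> to order
  \<open>L\<close>.\<close>

lemma first_derivative_interpolation_real:
  assumes "L \<ge> 1"
  shows "\<exists>c. interpolation_const_real L c"
  using assms
proof (induction L rule: nat_induct_at_least)
  case base
  show ?case
    unfolding interpolation_const_real_def
  proof (intro exI[of _ 1] conjI allI impI ballI)
    fix m B x :: real and f :: "nat \<Rightarrow> real \<Rightarrow> real"
    assume m: "\<forall>x\<in>{0..1}. \<bar>f 0 x\<bar> \<le> m" and B: "\<forall>x\<in>{0..1}. \<bar>f 1 x\<bar> \<le> B" and x: "x \<in> {0..1}"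
    have "\<bar>f 0 0\<bar> \<le> m"
      using m by auto
    then have "0 \<le> m"
      using abs_ge_zero order_trans by blast
    then show "\<bar>f 1 x\<bar> \<le> 1 * (m + B)"
      using B[rule_format, OF x] by simp
  qed simp
next
  case (Suc L)
  obtain c where c: "interpolation_const_real L c"
    using Suc.IH by blast
  then have c0: "0 \<le> c" by (simp add: interpolation_const_real_def)
  obtain d where d: "small_derivative_const L d"
    using exists_small_derivative by blast
  then have d0: "0 \<le> d" by (simp add: small_derivative_const_def)
  show ?case
    unfolding interpolation_const_real_def
  proof (intro exI[of _ "c * (1 + d)"] conjI allI impI ballI)
    fix m B x :: real and f :: "nat \<Rightarrow> real \<Rightarrow> real"
    assume der: "\<forall>i x. i < Suc L \<longrightarrow> (f i has_real_derivative f (Suc i) x) (at x)"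
      and m: "\<forall>x\<in>{0..1}. \<bar>f 0 x\<bar> \<le> m" and B: "\<forall>x\<in>{0..1}. \<bar>f (Suc L) x\<bar> \<le> B" and x: "x \<in> {0..1::real}"
    have pos: "0 \<le> m" "0 \<le> B"
      using m[rule_format, of 0] B[rule_format, of 0] by auto
    obtain y where y: "y \<in> {0..1}" "\<bar>f L y\<bar> \<le> d * m"
      using small_derivative_constD[OF d, of 1 f 0 m] der m by auto
    have fL: "\<bar>f L z\<bar> \<le> d * m + B" if z: "z \<in> {0..1}" for z
    proof -
      have "norm (f L z - f L y) \<le> B * norm (z - y)"
        by (rule field_differentiable_bound[of "{0..1}" _ "f (Suc L)"])
          (use der B z y in \<open>auto intro: has_field_derivative_at_within\<close>)
      also have "\<dots> \<le> B * 1"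
        using z y pos by (intro mult_left_mono) auto
      finally show ?thesis
        using y(2) by (simp add: abs_if split: if_splits)
    qed
    have "\<bar>f 1 x\<bar> \<le> c * (m + (d * m + B))"
      by (rule interpolation_const_realD[OF c, where f = f]) (use der m fL x in auto)
    also have "\<dots> \<le> c * ((1 + d) * (m + B))"
      using c0 d0 pos by (intro mult_left_mono) (auto simp: algebra_simps)
    finally show "\<bar>f 1 x\<bar> \<le> c * (1 + d) * (m + B)" by (simp add: mult.assoc)
  qed (use c0 d0 in auto)
qed

text \<open>Rescaling the segment of length \<open>\<tau>\<close> to the unit interval produces the
  powers of \<open>\<tau>\<close>. Real and imaginary parts are treated separately, hence the factor
  2 in the constant.\<close>

lemma partial_deriv_interpolation:
  assumes "L \<ge> 1"
  shows "\<exists>c\<ge>0. \<forall>(f :: 'a::euclidean_space \<Rightarrow> complex) b z \<tau> m B. smooth f \<longrightarrow> b \<in> Basis \<longrightarrow> \<tau> > 0 \<longrightarrow>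
     (\<forall>x\<in>{0..\<tau>}. cmod (f (z + x *\<^sub>R b)) \<le> m) \<longrightarrow>
     (\<forall>x\<in>{0..\<tau>}. cmod (partial_derivs (replicate L b) f (z + x *\<^sub>R b)) \<le> B) \<longrightarrow>
     \<tau> * cmod (partial_deriv b f z) \<le> c * (m + \<tau> ^ L * B)"
proof -
  obtain c where c: "interpolation_const_real L c"
    using first_derivative_interpolation_real[OF assms] by blast
  then have c0: "0 \<le> c" by (simp add: interpolation_const_real_def)
  show ?thesis
  proof (intro exI[of _ "2 * c"] conjI allI impI)
    fix f :: "'a \<Rightarrow> complex" and b z \<tau> m B
    assume f: "smooth f" and b: "b \<in> Basis" and \<tau>: "\<tau> > 0"
      and m: "\<forall>x\<in>{0..\<tau>}. cmod (f (z + x *\<^sub>R b)) \<le> m"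
      and B: "\<forall>x\<in>{0..\<tau>}. cmod (partial_derivs (replicate L b) f (z + x *\<^sub>R b)) \<le> B"
    define g where "g i x = \<tau> ^ i *\<^sub>R partial_derivs (replicate i b) f (z + (\<tau> * x) *\<^sub>R b)" for i and x :: real
    have sm: "smooth (partial_derivs (replicate i b) f)" for i
    proof -
      have "replicate i b \<in> lists Basis"
        using b by (induction i) auto
      then show ?thesis
        using f smoothD(3) by blast
    qed
    have der: "(g i has_vector_derivative g (Suc i) x) (at x)" for i x
    proof -
      have "((\<lambda>s. partial_derivs (replicate i b) f (z + s *\<^sub>R b)) has_vector_derivative
          partial_derivs (replicate (Suc i) b) f (z + (\<tau> * x) *\<^sub>R b)) (at (\<tau> * x))"
        using has_vector_derivative_partial[of "partial_derivs (replicate i b) f" z "\<tau> * x" b, OF smoothD(1)[OF sm]] by simp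
      moreover have "((\<lambda>x. \<tau> * x) has_vector_derivative \<tau>) (at x)"
        by (auto intro!: derivative_eq_intros simp: has_real_derivative_iff_has_vector_derivative[symmetric])
      ultimately have "((\<lambda>x. partial_derivs (replicate i b) f (z + (\<tau> * x) *\<^sub>R b)) has_vector_derivative
          \<tau> *\<^sub>R partial_derivs (replicate (Suc i) b) f (z + (\<tau> * x) *\<^sub>R b)) (at x)"
        using vector_diff_chain_at[of "\<lambda>x. \<tau> * x" \<tau> x "\<lambda>s. partial_derivs (replicate i b) f (z + s *\<^sub>R b)"]
        by (simp add: o_def)
      then have "((\<lambda>x. \<tau> ^ i *\<^sub>R partial_derivs (replicate i b) f (z + (\<tau> * x) *\<^sub>R b)) has_vector_derivative
          \<tau> ^ i *\<^sub>R \<tau> *\<^sub>R partial_derivs (replicate (Suc i) b) f (z + (\<tau> * x) *\<^sub>R b)) (at x)"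
        by (rule bounded_linear.has_vector_derivative[OF bounded_linear_scaleR_right])
      then show ?thesis by (simp add: g_def[abs_def] mult.commute)
    qed
    have Re: "((\<lambda>x. Re (g i x)) has_real_derivative Re (g (Suc i) x)) (at x)"
      and Im: "((\<lambda>x. Im (g i x)) has_real_derivative Im (g (Suc i) x)) (at x)" for i x
      using bounded_linear.has_vector_derivative[OF bounded_linear_Re der]
        bounded_linear.has_vector_derivative[OF bounded_linear_Im der]
      by (simp_all add: has_real_derivative_iff_has_vector_derivative)
    have x: "\<tau> * x \<in> {0..\<tau>}" if "x \<in> {0..1}" for x
      using that \<tau> by (auto simp: mult_le_cancel_left1)
    have 0: "cmod (g 0 x) \<le> m" and L: "cmod (g L x) \<le> \<tau> ^ L * B" if "x \<in> {0..1}" for x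
      using m B x[OF that] \<tau> by (auto simp: g_def intro!: mult_left_mono)
    have "\<bar>Re (g 1 0)\<bar> \<le> c * (m + \<tau> ^ L * B)"
      by (rule interpolation_const_realD[OF c, where f = "\<lambda>i x. Re (g i x)"])
        (use Re 0 L in \<open>auto intro: order_trans[OF abs_Re_le_cmod]\<close>)
    moreover have "\<bar>Im (g 1 0)\<bar> \<le> c * (m + \<tau> ^ L * B)"
      by (rule interpolation_const_realD[OF c, where f = "\<lambda>i x. Im (g i x)"])
        (use Im 0 L in \<open>auto intro: order_trans[OF abs_Im_le_cmod]\<close>)
    moreover have "cmod (g 1 0) = \<tau> * cmod (partial_deriv b f z)"
      using \<tau> by (simp add: g_def)
    ultimately show "\<tau> * cmod (partial_deriv b f z) \<le> 2 * c * (m + \<tau> ^ L * B)"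
      using cmod_le[of "g 1 0"] by (simp add: mult.assoc)
  qed (use c0 in auto)
qed

text \<open>Each of the \<open>k\<close> differentiations looks ahead along a segment of length
  \<open>r\<close>, so values are needed on a ball larger by \<open>k * r\<close>, and derivatives
  up to order \<open>L + k\<close>. The \<open>itself\<close> argument fixes the space on which the
  constant depends.\<close>

definition interpolation_const :: "'a::euclidean_space itself \<Rightarrow> nat \<Rightarrow> nat \<Rightarrow> real \<Rightarrow> bool" where
  "interpolation_const _ L k c \<longleftrightarrow> 0 \<le> c \<and> (\<forall>(f :: 'a \<Rightarrow> complex) z0 r m D \<rho>. smooth f \<longrightarrow> r > 0 \<longrightarrow>
     (\<forall>z\<in>cball z0 ((\<rho> + k) * r). cmod (f z) \<le> m) \<longrightarrow>
     (\<forall>bs\<in>lists Basis. \<forall>z. L \<le> length bs \<longrightarrow> length bs \<le> L + k \<longrightarrow>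
         r ^ length bs * cmod (partial_derivs bs f z) \<le> D) \<longrightarrow>
     (\<forall>bs\<in>lists Basis. \<forall>z\<in>cball z0 (\<rho> * r). length bs = k \<longrightarrow>
         r ^ k * cmod (partial_derivs bs f z) \<le> c * (m + D)))"

lemmas interpolation_constD = interpolation_const_def[THEN iffD1, THEN conjunct2, rule_format]

text \<open>Induction on \<open>k\<close>: the outermost derivative is estimated by interpolation
  along a segment, between the derivative of order \<open>k\<close>, controlled on the radius
  enlarged by \<open>r\<close>, and the one obtained from it by \<open>L\<close> further
  differentiations in the same direction.\<close>

lemma partial_derivs_interpolation:
  assumes L: "L \<ge> 1"
  shows "\<exists>c. interpolation_const TYPE('a::euclidean_space) L k c"
proof (induction k)
  case 0
  obtain b0 :: 'a where b0: "b0 \<in> Basis"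
    using nonempty_Basis by blast
  show ?case
    unfolding interpolation_const_def
  proof (intro exI[of _ 1] conjI allI impI ballI)
    fix f :: "'a \<Rightarrow> complex" and z0 r m D \<rho> and bs :: "'a list" and z
    assume r: "r > 0" and m: "\<forall>z\<in>cball z0 ((\<rho> + real 0) * r). cmod (f z) \<le> m"
      and D: "\<forall>bs\<in>lists Basis. \<forall>z. L \<le> length bs \<longrightarrow> length bs \<le> L + 0 \<longrightarrow>
         r ^ length bs * cmod (partial_derivs bs f z) \<le> D"
      and z: "z \<in> cball z0 (\<rho> * r)" and bs: "length bs = 0"
    \<comment> \<open>A derivative of order \<open>L\<close> serves here to show
      \<open>0 \<le> D\<close>.\<close>
    have "replicate L b0 \<in> lists Basis"
      using b0 by (induction L) auto
    then have "r ^ L * cmod (partial_derivs (replicate L b0) f z) \<le> D"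
      using D by (auto dest!: bspec)
    then have "0 \<le> D"
      using r by (meson mult_nonneg_nonneg norm_ge_zero order_trans zero_le_power less_imp_le)
    then show "r ^ 0 * cmod (partial_derivs bs f z) \<le> 1 * (m + D)"
      using m z bs by force
  qed auto
next
  case (Suc k)
  obtain c where c: "interpolation_const TYPE('a) L k c"
    using Suc.IH by blast
  then have c0: "0 \<le> c" by (simp add: interpolation_const_def)
  obtain d where d: "0 \<le> d" "\<And>(f :: 'a::euclidean_space \<Rightarrow> complex) b z \<tau> m B. smooth f \<Longrightarrow> b \<in> Basis \<Longrightarrow> \<tau> > 0 \<Longrightarrow>
     (\<And>x. x \<in> {0..\<tau>} \<Longrightarrow> cmod (f (z + x *\<^sub>R b)) \<le> m) \<Longrightarrow>
     (\<And>x. x \<in> {0..\<tau>} \<Longrightarrow> cmod (partial_derivs (replicate L b) f (z + x *\<^sub>R b)) \<le> B) \<Longrightarrow>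
     \<tau> * cmod (partial_deriv b f z) \<le> d * (m + \<tau> ^ L * B)"
    using partial_deriv_interpolation[OF L, where 'a='a] by blast
  show ?case
    unfolding interpolation_const_def
  proof (intro exI[of _ "d * (c + 1)"] conjI allI impI ballI)
    fix f :: "'a \<Rightarrow> complex" and z0 r m D \<rho> and bs :: "'a list" and z
    assume f: "smooth f" and r: "r > 0" and m: "\<forall>z\<in>cball z0 ((\<rho> + real (Suc k)) * r). cmod (f z) \<le> m"
      and D: "\<forall>bs\<in>lists Basis. \<forall>z. L \<le> length bs \<longrightarrow> length bs \<le> L + Suc k \<longrightarrow>
         r ^ length bs * cmod (partial_derivs bs f z) \<le> D"
      and bs: "bs \<in> lists Basis" "length bs = Suc k" and z: "z \<in> cball z0 (\<rho> * r)"
    obtain b bs' where b: "bs = b # bs'" "b \<in> Basis" "bs' \<in> lists Basis" "length bs' = k"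
      using bs by (cases bs) auto
    have near: "z + x *\<^sub>R b \<in> cball z0 ((\<rho> + 1) * r)" if "x \<in> {0..r}" for x
    proof -
      have "dist z0 (z + x *\<^sub>R b) \<le> dist z0 z + dist z (z + x *\<^sub>R b)"
        by (rule dist_triangle)
      also have "dist z (z + x *\<^sub>R b) \<le> r"
        using that b by (simp add: dist_norm)
      finally show ?thesis
        using z by (simp add: distrib_right)
    qed
    have m': "cmod (f w) \<le> m" if "w \<in> cball z0 ((\<rho> + 1 + real k) * r)" for w
      using m that by (auto simp: add_ac)
    have 1: "cmod (partial_derivs bs' f (z + x *\<^sub>R b)) \<le> c * (m + D) / r ^ k" if "x \<in> {0..r}" for x
    proof -
      have "r ^ k * cmod (partial_derivs bs' f (z + x *\<^sub>R b)) \<le> c * (m + D)"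
        by (rule interpolation_constD[OF c, where \<rho> = "\<rho> + 1" and ?z0.0 = z0])
          (use f r m' D near[OF that] b in auto)
      then show ?thesis
        using r by (simp add: field_simps)
    qed
    have 2: "cmod (partial_derivs (replicate L b) (partial_derivs bs' f) (z + x *\<^sub>R b)) \<le> D / r ^ (L + k)" for x
    proof -
      have "replicate L b @ bs' \<in> lists Basis"
        using b by (induction L) auto
      then have "r ^ (L + k) * cmod (partial_derivs (replicate L b @ bs') f (z + x *\<^sub>R b)) \<le> D"
        using D[rule_format, of "replicate L b @ bs'"] b(4) by simp
      then show ?thesis
        using r by (simp add: partial_derivs_append field_simps)
    qed
    have "r * cmod (partial_deriv b (partial_derivs bs' f) z) \<le> d * (c * (m + D) / r ^ k + r ^ L * (D / r ^ (L + k)))"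
      by (rule d(2)[OF smoothD(3)[OF f b(3)] b(2) r 1 2])
    also have "\<dots> = d * (c * (m + D) + D) / r ^ k"
      using r by (simp add: power_add field_simps)
    finally have "r ^ Suc k * cmod (partial_derivs bs f z) \<le> d * (c * (m + D) + D)"
      using r by (simp add: b(1) field_simps)
    moreover have "d * (c * (m + D) + D) \<le> d * (c + 1) * (m + D)"
    proof -
      have "0 \<le> \<rho>"
        using order_trans[OF zero_le_dist, of z0 z "\<rho> * r"] z r by (simp add: zero_le_mult_iff)
      then have "z0 \<in> cball z0 ((\<rho> + real (Suc k)) * r)"
        using r by simp
      then have "0 \<le> m"
        using order_trans[OF norm_ge_zero m[rule_format]] by blast
      then show ?thesis
        using d(1) by (simp add: algebra_simps)
    qed
    ultimately show "r ^ Suc k * cmod (partial_derivs bs f z) \<le> d * (c + 1) * (m + D)"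
      by linarith
  qed (use c0 d in auto)
qed

lemma smooth_lipschitz:
  fixes f :: "'a::euclidean_space \<Rightarrow> complex" and M :: real
  assumes f: "smooth f" and S: "convex S" "x \<in> S" "y \<in> S"
    and bd: "\<And>z b. z \<in> S \<Longrightarrow> b \<in> Basis \<Longrightarrow> cmod (partial_deriv b f z) \<le> M"
  shows "cmod (f x - f y) \<le> DIM('a) * M * norm (x - y)"
proof (rule differentiable_bound[OF S(1) _ _ S(2,3)])
  show "(f has_derivative (\<lambda>v. \<Sum>b\<in>Basis. (v \<bullet> b) *\<^sub>R partial_deriv b f z)) (at z within S)" for z
    by (rule has_derivative_at_withinI[OF has_derivative_partial_deriv[OF smoothD(1)[OF f]]])
  show "onorm (\<lambda>v. \<Sum>b\<in>Basis. (v \<bullet> b) *\<^sub>R partial_deriv b f z) \<le> DIM('a) * M" if "z \<in> S" for z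
  proof (rule onorm_le)
    fix v :: 'a
    have "norm (\<Sum>b\<in>Basis. (v \<bullet> b) *\<^sub>R partial_deriv b f z) \<le> (\<Sum>b\<in>(Basis::'a set). norm v * M)"
    proof (rule sum_norm_le)
      fix b :: 'a assume b: "b \<in> Basis"
      show "norm ((v \<bullet> b) *\<^sub>R partial_deriv b f z) \<le> norm v * M"
        using mult_mono[OF Basis_le_norm[OF b, of v] bd[OF that b]] by simp
    qed
    then show "norm (\<Sum>b\<in>Basis. (v \<bullet> b) *\<^sub>R partial_deriv b f z) \<le> DIM('a) * M * norm v"
      by (simp add: mult_ac)
  qed
qed

subsection \<open>Choice of the points\<close>

lemma symbol_class_bound:
  fixes a :: "real \<Rightarrow> (real^'n) \<times> (real^'n) \<Rightarrow> complex"
  assumes "a \<in> symbol_class h0 \<delta>"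
  shows "\<exists>C\<ge>0. \<forall>bs\<in>lists Basis. length bs \<le> K \<longrightarrow> (\<forall>h\<in>{0<..<h0}. \<forall>z.
      cmod (partial_derivs bs (a h) z) \<le> C * h powr (- \<delta> * real (length bs)))"
proof -
  let ?A = "{bs. set bs \<subseteq> (Basis :: ((real^'n) \<times> (real^'n)) set) \<and> length bs \<le> K}"
  have "finite ?A" by (rule finite_lists_length_le) auto
  then have "\<exists>C\<ge>0. \<forall>bs\<in>?A. \<forall>p\<in>{0<..<h0} \<times> UNIV.
      cmod (partial_derivs bs (a (fst p)) (snd p)) / fst p powr (- \<delta> * real (length bs)) \<le> C * 1"
  proof (rule finite_choice_bound)
    fix bs assume "bs \<in> ?A"
    then have "bs \<in> lists Basis" by (auto simp: lists_eq_set)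
    then obtain C where "\<forall>h\<in>{0<..<h0}. \<forall>z. cmod (partial_derivs bs (a h) z) \<le> C * h powr (- \<delta> * real (length bs))"
      using assms unfolding symbol_class_def by blast
    then show "\<exists>C. \<forall>p\<in>{0<..<h0} \<times> UNIV.
      cmod (partial_derivs bs (a (fst p)) (snd p)) / fst p powr (- \<delta> * real (length bs)) \<le> C * 1"
      by (intro exI[of _ C]) (auto simp: divide_le_eq)
  qed auto
  then show ?thesis by (auto simp: lists_eq_set divide_le_eq)
qed

lemma symbol_class_smooth: "a \<in> symbol_class h0 \<delta> \<Longrightarrow> h \<in> {0<..<h0} \<Longrightarrow> smooth (a h)"
  by (auto simp: symbol_class_def)

text \<open>A maximum of \<open>cmod (f z) * exp (- norm (z - z1) / r)\<close> over a ball is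
  global: beyond the radius \<open>r * ln (C / cmod (f z1))\<close> the weight is at most
  \<open>cmod (f z1) / C\<close>, so the product cannot exceed its value at \<open>z1\<close>. The
  triangle inequality moves the centre of the weight from \<open>z1\<close> to the maximum
  point.\<close>

lemma exists_weighted_maximum:
  fixes f :: "'a::euclidean_space \<Rightarrow> complex"
  assumes cont: "continuous_on UNIV f" and C: "\<And>z. cmod (f z) \<le> C" and z1: "f z1 \<noteq> 0" and r: "r > 0"
  shows "\<exists>z'. (\<forall>z. cmod (f z) \<le> exp (norm (z - z') / r) * cmod (f z')) \<and>
    cmod (f z1) \<le> cmod (f z') \<and> norm (z' - z1) \<le> r * ln (C / cmod (f z1))"
proof -
  define g where "g z = cmod (f z) * exp (- norm (z - z1) / r)" for z
  define \<rho> where "\<rho> = r * ln (C / cmod (f z1))"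
  have f1: "0 < cmod (f z1)" "cmod (f z1) \<le> C"
    using z1 C by auto
  then have "0 < C" by linarith
  have \<rho>: "0 \<le> \<rho>"
    using f1 r by (auto simp: \<rho>_def intro!: mult_nonneg_nonneg ln_ge_zero)
  have cont_g: "continuous_on (cball z1 \<rho>) g"
    unfolding g_def by (intro continuous_intros continuous_on_subset[OF cont]) (use r in auto)
  obtain z' where z': "z' \<in> cball z1 \<rho>" "\<And>z. z \<in> cball z1 \<rho> \<Longrightarrow> g z \<le> g z'"
    using continuous_attains_sup[OF compact_cball _ cont_g] \<rho> by auto
  have g1: "g z1 = cmod (f z1)" by (simp add: g_def)
  have g_max: "g z \<le> g z'" for z
  proof (cases "z \<in> cball z1 \<rho>")
    case False
    then have "\<rho> < norm (z - z1)" by (simp add: dist_norm norm_minus_commute)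
    then have "ln (C / cmod (f z1)) < norm (z - z1) / r"
      using r by (simp add: \<rho>_def field_simps)
    then have "exp (- norm (z - z1) / r) \<le> exp (- ln (C / cmod (f z1)))" by simp
    also have "\<dots> = cmod (f z1) / C"
      using f1 \<open>0 < C\<close> by (simp add: exp_minus)
    finally have "g z \<le> C * (cmod (f z1) / C)"
      unfolding g_def using C \<open>0 < C\<close> by (intro mult_mono) auto
    also have "\<dots> = g z1"
      using \<open>0 < C\<close> by (simp add: g1)
    also have "\<dots> \<le> g z'"
      using z'(2)[of z1] \<rho> by simp
    finally show ?thesis .
  qed (use z' in auto)
  have "cmod (f z) \<le> exp (norm (z - z') / r) * cmod (f z')" for z
  proof -
    have "cmod (f z) = g z * exp (norm (z - z1) / r)"
      by (simp add: g_def mult.assoc exp_add[symmetric])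
    also have "\<dots> \<le> g z' * exp (norm (z - z1) / r)"
      using g_max by (intro mult_right_mono) auto
    also have "\<dots> = cmod (f z') * exp ((norm (z - z1) - norm (z' - z1)) / r)"
      by (simp add: g_def mult.assoc exp_add[symmetric] diff_divide_distrib)
    also have "\<dots> \<le> cmod (f z') * exp (norm (z - z') / r)"
      using r norm_triangle_sub[of "z - z1" "z' - z1"] by (intro mult_left_mono) (auto intro!: divide_right_mono)
    finally show ?thesis by (simp add: mult.commute)
  qed
  moreover have "cmod (f z1) \<le> cmod (f z')"
  proof -
    have "cmod (f z1) \<le> cmod (f z') * exp (- norm (z' - z1) / r)"
      using g_max[of z1] by (simp add: g1) (simp add: g_def)
    also have "\<dots> \<le> cmod (f z') * 1"
      using r by (intro mult_left_mono) auto
    finally show ?thesis by simp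
  qed
  moreover have "norm (z' - z1) \<le> \<rho>"
    using z'(1) by (simp add: dist_norm norm_minus_commute)
  ultimately show ?thesis
    unfolding \<rho>_def by blast
qed

text \<open>If the values near \<open>z0\<close> were below every power of \<open>h\<close>,
  interpolation with step \<open>h\<close> against derivatives of high order would make every
  derivative negligible on a smaller ball, contradicting the essential support.\<close>

lemma ess_supp_not_negligible:
  fixes a :: "real \<Rightarrow> (real^'n) \<times> (real^'n) \<Rightarrow> complex"
  assumes h0: "0 < h0" and \<delta>: "\<delta> < 1 / 2" and a: "a \<in> symbol_class h0 \<delta>"
    and z0: "z0 \<in> ess_supp a" and \<epsilon>: "\<epsilon> > 0"
  shows "\<exists>N::nat. \<exists>\<^sub>F h in at_right 0. \<exists>z\<in>ball z0 \<epsilon>. h ^ N < cmod (a h z)"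
proof (rule ccontr)
  assume "\<not> ?thesis"
  then have small: "\<forall>\<^sub>F h in at_right 0. \<forall>z\<in>ball z0 \<epsilon>. cmod (a h z) \<le> h ^ N" for N
    by (simp add: not_frequently not_less)
  have "\<exists>C. \<forall>\<^sub>F h in at_right 0. \<forall>z\<in>ball z0 (\<epsilon> / 2). cmod (partial_derivs bs (a h) z) \<le> C * h ^ N"
    if bs: "bs \<in> lists Basis" for bs and N :: nat
  proof -
    define k where "k = length bs"
    \<comment> \<open>With step \<open>h\<close> a derivative of order at least \<open>L\<close>
      contributes at most a multiple of \<open>h powr ((1 - \<delta>) * L)\<close>, and
      \<open>1 - \<delta> > 1 / 2\<close> brings this below \<open>h ^ (N + k)\<close>. The extra
      \<open>k\<close> powers pay for the division by \<open>h ^ k\<close>.\<close>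
    define L where "L = 2 * (N + k) + 1"
    obtain c where c: "interpolation_const TYPE((real^'n) \<times> (real^'n)) L k c"
      using partial_derivs_interpolation[of L k] by (auto simp: L_def)
    obtain C where C: "0 \<le> C" "\<And>bs h z. bs \<in> lists Basis \<Longrightarrow> length bs \<le> L + k \<Longrightarrow> h \<in> {0<..<h0} \<Longrightarrow>
        cmod (partial_derivs bs (a h) z) \<le> C * h powr (- \<delta> * real (length bs))"
      using symbol_class_bound[OF a, of "L + k"] by blast
    have "\<forall>\<^sub>F h in at_right 0. h < min h0 (min 1 (\<epsilon> / 2 / (k + 1)))"
      using h0 \<epsilon> by (intro eventually_at_right_less eventually_at_rightI[of 0 "min h0 (min 1 (\<epsilon> / 2 / (k + 1)))"]) auto
    then have "\<forall>\<^sub>F h in at_right 0. \<forall>z\<in>ball z0 (\<epsilon> / 2). cmod (partial_derivs bs (a h) z) \<le> c * (1 + C) * h ^ N"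
      using small[of "N + k"] eventually_at_right_less[of 0]
    proof eventually_elim
      case (elim h)
      \<comment> \<open>The last inequality keeps the interpolation balls of radius
        \<open>k * h\<close> inside the ball of radius \<open>\<epsilon>\<close>.\<close>
      then have h: "0 < h" "h < 1" "h \<in> {0<..<h0}" and kh: "(k + 1) * h < \<epsilon> / 2"
        by (auto simp: field_simps)
      show ?case
      proof
        fix z assume z: "z \<in> ball z0 (\<epsilon> / 2)"
        have "h ^ k * cmod (partial_derivs bs (a h) z) \<le> c * (h ^ (N + k) + C * h ^ (N + k))"
        proof (rule interpolation_constD[OF c, where ?z0.0 = z and \<rho> = 0])
          show "cmod (a h w) \<le> h ^ (N + k)" if "w \<in> cball z ((0 + real k) * h)" for w
          proof -
            have "dist z0 w \<le> dist z0 z + dist z w" by (rule dist_triangle)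
            also have "\<dots> < \<epsilon> / 2 + \<epsilon> / 2"
              using that z kh h(1) by (intro add_less_le_mono) (auto simp: algebra_simps)
            finally show ?thesis
              using elim(2) by auto
          qed
          show "h ^ length cs * cmod (partial_derivs cs (a h) w) \<le> C * h ^ (N + k)"
            if cs: "cs \<in> lists Basis" "L \<le> length cs" "length cs \<le> L + k" for cs w
          proof -
            have "h ^ length cs * cmod (partial_derivs cs (a h) w) \<le> h ^ length cs * (C * h powr (- \<delta> * real (length cs)))"
              using C(2)[OF cs(1,3) h(3)] h(1) by (intro mult_left_mono) auto
            also have "\<dots> = C * h powr ((1 - \<delta>) * real (length cs))"
              using h(1) by (simp add: powr_realpow[symmetric] powr_add[symmetric] algebra_simps)
            also have "\<dots> \<le> C * h powr (real (N + k))"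
            proof (intro mult_left_mono powr_mono')
              have "real (N + k) \<le> (1 / 2) * real (length cs)"
                using cs(2) by (simp add: L_def)
              also have "\<dots> \<le> (1 - \<delta>) * real (length cs)"
                using \<delta> by (intro mult_right_mono) auto
              finally show "real (N + k) \<le> (1 - \<delta>) * real (length cs)" .
            qed (use h C in auto)
            finally show ?thesis by (simp only: powr_realpow[OF h(1)])
          qed
        qed (use symbol_class_smooth[OF a h(3)] h bs k_def in auto)
        then have "h ^ k * cmod (partial_derivs bs (a h) z) \<le> h ^ k * (c * (1 + C) * h ^ N)"
          by (simp add: power_add algebra_simps)
        then show "cmod (partial_derivs bs (a h) z) \<le> c * (1 + C) * h ^ N"
          using h(1) by (simp add: mult_le_cancel_left_pos)
      qed
    qed
    then show ?thesis by blast
  qed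
  then have "z0 \<notin> ess_supp a"
    using \<epsilon> unfolding ess_supp_def by (intro notI) (auto dest!: spec[of _ "ball z0 (\<epsilon> / 2)"])
  with z0 show False by blast
qed

text \<open>Moving from a point with value above \<open>h ^ N\<close> to the weighted maximum costs
  a distance of at most \<open>h powr \<kappa> * ln (C / h ^ N)\<close>, where the power beats the
  logarithm. The value at the maximum is no smaller, so \<open>N\<close> is kept.\<close>

lemma ess_supp_peak:
  fixes a :: "real \<Rightarrow> (real^'n) \<times> (real^'n) \<Rightarrow> complex"
  assumes h0: "0 < h0" and \<delta>: "\<delta> < 1 / 2" and a: "a \<in> symbol_class h0 \<delta>"
    and z0: "z0 \<in> ess_supp a" and \<epsilon>: "\<epsilon> > 0" and \<kappa>: "\<kappa> > 0"
  shows "\<exists>N::nat. \<exists>\<^sub>F h in at_right 0. \<exists>z'. h < h0 \<and> h < 1 \<and> norm (z' - z0) < \<epsilon> \<and> h ^ N \<le> cmod (a h z') \<and>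
    (\<forall>z. cmod (a h z) \<le> exp (norm (z - z') / h powr \<kappa>) * cmod (a h z'))"
proof -
  obtain N where N: "\<exists>\<^sub>F h in at_right 0. \<exists>z\<in>ball z0 (\<epsilon> / 2). h ^ N < cmod (a h z)"
    using ess_supp_not_negligible[OF h0 \<delta> a z0, of "\<epsilon> / 2"] \<epsilon> by auto
  obtain C' where C': "0 \<le> C'" "\<forall>bs\<in>lists Basis. length bs \<le> 0 \<longrightarrow> (\<forall>h\<in>{0<..<h0}. \<forall>z.
      cmod (partial_derivs bs (a h) z) \<le> C' * h powr (- \<delta> * real (length bs)))"
    using symbol_class_bound[OF a, of 0] by blast
  \<comment> \<open>Adding 1 makes the bound strictly positive, as the logarithm requires.\<close>
  define C where "C = C' + 1"
  have C0: "C > 0"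
    using C'(1) by (simp add: C_def)
  have C1: "cmod (a h z) \<le> C" if "h \<in> {0<..<h0}" for h z
    using C'(2)[rule_format, of "[]" h z] that by (simp add: C_def)
  note C = C0 C1
  have "((\<lambda>h. h powr \<kappa> * ln (C / h ^ N)) \<longlongrightarrow> 0) (at_right 0)"
    using C(1) \<kappa> by real_asymp
  then have "\<forall>\<^sub>F h in at_right 0. h powr \<kappa> * ln (C / h ^ N) < \<epsilon> / 2"
    using \<epsilon> by (intro order_tendstoD) auto
  moreover have "\<forall>\<^sub>F h in at_right 0. 0 < h \<and> h < h0 \<and> h < (1::real)"
    using h0 by (intro eventually_at_rightI[of 0 "min h0 1"]) auto
  ultimately have ev: "\<forall>\<^sub>F h in at_right 0. 0 < h \<and> h < h0 \<and> h < 1 \<and> h powr \<kappa> * ln (C / h ^ N) < \<epsilon> / 2"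
    by eventually_elim auto
  have "\<exists>\<^sub>F h in at_right 0. \<exists>z'. h < h0 \<and> h < 1 \<and> norm (z' - z0) < \<epsilon> \<and> h ^ N \<le> cmod (a h z') \<and>
    (\<forall>z. cmod (a h z) \<le> exp (norm (z - z') / h powr \<kappa>) * cmod (a h z'))"
    using frequently_eventually_frequently[OF N ev]
  proof (rule frequently_elim1)
    fix h assume "(\<exists>z\<in>ball z0 (\<epsilon> / 2). h ^ N < cmod (a h z)) \<and> 0 < h \<and> h < h0 \<and> h < 1 \<and> h powr \<kappa> * ln (C / h ^ N) < \<epsilon> / 2"
    then obtain z1 where z1: "z1 \<in> ball z0 (\<epsilon> / 2)" "h ^ N < cmod (a h z1)"
      and h: "0 < h" "h < h0" "h < 1" "h powr \<kappa> * ln (C / h ^ N) < \<epsilon> / 2"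
      by blast
    have hN: "0 < h ^ N"
      using h(1) by simp
    have cont: "continuous_on UNIV (a h)"
      using symbol_class_smooth[OF a, of h] h smooth_continuous_on by auto
    have "a h z1 \<noteq> 0" "h powr \<kappa> > 0" "\<And>z. cmod (a h z) \<le> C"
      using z1 hN h C by auto
    then obtain z' where z': "\<forall>z. cmod (a h z) \<le> exp (norm (z - z') / h powr \<kappa>) * cmod (a h z')"
      "cmod (a h z1) \<le> cmod (a h z')" "norm (z' - z1) \<le> h powr \<kappa> * ln (C / cmod (a h z1))"
      using exists_weighted_maximum[OF cont, of C z1 "h powr \<kappa>"] by blast
    have "norm (z' - z1) \<le> h powr \<kappa> * ln (C / h ^ N)"
    proof (rule order_trans[OF z'(3)], intro mult_left_mono)
      have pos: "0 < cmod (a h z1)"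
        using z1(2) hN by linarith
      have "C / cmod (a h z1) \<le> C / h ^ N"
        using z1(2) hN C(1) by (intro frac_le) auto
      moreover have "0 < C / cmod (a h z1)" "0 < C / h ^ N"
        using pos hN C(1) by simp_all
      ultimately show "ln (C / cmod (a h z1)) \<le> ln (C / h ^ N)"
        using ln_le_cancel_iff by blast
    qed auto
    then have "norm (z' - z1) + norm (z1 - z0) < \<epsilon>"
      using h(4) z1(1) by (simp add: dist_norm norm_minus_commute)
    then have "norm (z' - z0) < \<epsilon>"
      using norm_triangle_ineq[of "z' - z1" "z1 - z0"] by simp
    then show "\<exists>z'. h < h0 \<and> h < 1 \<and> norm (z' - z0) < \<epsilon> \<and> h ^ N \<le> cmod (a h z') \<and>
      (\<forall>z. cmod (a h z) \<le> exp (norm (z - z') / h powr \<kappa>) * cmod (a h z'))"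
      using z' z1 h by (intro exI[of _ z']) auto
  qed
  then show ?thesis by blast
qed

text \<open>The first component of \<open>prod_decode\<close> takes every value \<open>k\<close> infinitely often. The parameters are chosen
  strictly decreasing, hence distinct, so that \<open>Z\<close> can be prescribed at each of them.\<close>

lemma diagonal_selection:
  assumes ex: "\<And>k::nat. \<exists>\<^sub>F h in at_right (0::real). \<exists>z. P k h z"
  shows "\<exists>Z. \<forall>k. \<exists>H :: nat \<Rightarrow> real. (\<forall>j. 0 < H j \<and> P k (H j) (Z (H j))) \<and> H \<longlonglongrightarrow> 0"
proof -
  have step: "\<exists>x. (P k (fst x) (snd x) \<and> 0 < fst x \<and> fst x < 1 / real (Suc m)) \<and> fst x < u"
    if "0 < u" for k m u
  proof -
    have "\<forall>\<^sub>F h in at_right (0::real). 0 < h \<and> h < min u (1 / real (Suc m))"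
      using that by (intro eventually_at_rightI[of 0 "min u (1 / real (Suc m))"]) auto
    from frequently_eventually_frequently[OF ex[of k] this]
    obtain h z where "P k h z" "0 < h" "h < min u (1 / real (Suc m))"
      using frequently_ex by blast
    then show ?thesis by (intro exI[of _ "(h, z)"]) auto
  qed
  have "\<exists>x. \<forall>m. (P (fst (prod_decode m)) (fst (x m)) (snd (x m)) \<and> 0 < fst (x m) \<and> fst (x m) < 1 / real (Suc m))
     \<and> fst (x (Suc m)) < fst (x m)"
  proof (rule dependent_nat_choice)
    show "\<exists>x. P (fst (prod_decode 0)) (fst x) (snd x) \<and> 0 < fst x \<and> fst x < 1 / real (Suc 0)"
      using step[where k = "fst (prod_decode 0)" and m = 0 and u = 1] by simp
    show "\<exists>y. (P (fst (prod_decode (Suc m))) (fst y) (snd y) \<and> 0 < fst y \<and> fst y < 1 / real (Suc (Suc m))) \<and> fst y < fst x"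
      if "P (fst (prod_decode m)) (fst x) (snd x) \<and> 0 < fst x \<and> fst x < 1 / real (Suc m)" for x m
      using step[where k = "fst (prod_decode (Suc m))" and m = "Suc m" and u = "fst x"] that by blast
  qed
  then obtain x where x: "\<And>m. P (fst (prod_decode m)) (fst (x m)) (snd (x m)) \<and> 0 < fst (x m) \<and> fst (x m) < 1 / real (Suc m)"
    and dec: "\<And>m. fst (x (Suc m)) < fst (x m)"
    by blast
  define h where "h m = fst (x m)" for m
  have "inj h"
  proof (rule injI)
    fix i j assume eq: "h i = h j"
    have less: "h j < h i" if "i < j" for i j
      using dec lift_Suc_mono_less[of "\<lambda>m. - h m" i j] that by (simp add: h_def)
    show "i = j"
      using less[of i j] less[of j i] eq by (cases i j rule: linorder_cases) auto
  qed
  define Z where "Z u = snd (x (inv h u))" for u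
  have Z: "Z (h m) = snd (x m)" for m
    using \<open>inj h\<close> by (simp add: Z_def)
  show ?thesis
  proof (intro exI[of _ Z] allI)
    fix k
    define H where "H j = h (prod_encode (k, j))" for j
    have "P k (H j) (Z (H j))" "0 < H j" for j
      using x[of "prod_encode (k, j)"] by (auto simp: H_def Z) (simp_all add: h_def)
    moreover have "H \<longlonglongrightarrow> 0"
    proof (rule tendsto_sandwich[of "\<lambda>_. 0" _ _ "\<lambda>j. 1 / real (Suc j)"])
      have "H j \<le> 1 / real (Suc j)" for j
      proof -
        have "H j < 1 / real (Suc (prod_encode (k, j)))"
          using x by (simp add: H_def h_def)
        also have "\<dots> \<le> 1 / real (Suc j)"
          using le_prod_encode_2[of j k] by (intro divide_left_mono) auto
        finally show ?thesis by simp
      qed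
      then show "\<forall>\<^sub>F j in sequentially. H j \<le> 1 / real (Suc j)" by simp
      show "(\<lambda>j. 1 / real (Suc j)) \<longlonglongrightarrow> 0"
        by (rule LIMSEQ_Suc) (rule lim_1_over_n)
    qed (use \<open>\<And>j. 0 < H j\<close> in \<open>auto intro!: always_eventually less_imp_le\<close>)
    ultimately show "\<exists>H. (\<forall>j. 0 < H j \<and> P k (H j) (Z (H j))) \<and> H \<longlonglongrightarrow> 0"
      by blast
  qed
qed

subsection \<open>Normalized symbols\<close>

lemma
  fixes f :: "'a::euclidean_space \<Rightarrow> complex"
  assumes "smooth f"
  shows smooth_rescale: "smooth (\<lambda>x. f (z0 + r *\<^sub>R x))"
    and partial_derivs_rescale: "bs \<in> lists Basis \<Longrightarrow> partial_derivs bs (\<lambda>x. f (z0 + r *\<^sub>R x)) =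
      (\<lambda>x. of_real (r ^ length bs) * partial_derivs bs f (z0 + r *\<^sub>R x))"
proof -
  have d: "(\<lambda>x::'a. z0 + r *\<^sub>R x) differentiable (at x)" for x
    by (auto simp: differentiable_def intro!: exI derivative_eq_intros)
  have L: "z0 + r *\<^sub>R (x + \<tau> *\<^sub>R b) = (z0 + r *\<^sub>R x) + (\<tau> * r) *\<^sub>R id b" for x b :: 'a and \<tau>
    by (simp add: algebra_simps)
  show "smooth (\<lambda>x. f (z0 + r *\<^sub>R x))" by (rule smooth_affine[OF L _ d assms]) simp
  show "partial_derivs bs (\<lambda>x. f (z0 + r *\<^sub>R x)) =
      (\<lambda>x. of_real (r ^ length bs) * partial_derivs bs f (z0 + r *\<^sub>R x))" if "bs \<in> lists Basis"
    using partial_derivs_affine[of "\<lambda>x. z0 + r *\<^sub>R x" "\<lambda>_. r" id f bs, OF L _ d assms that]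
    by (simp add: map_replicate_const prod_list_replicate)
qed

definition normalized_symbol ::
    "('a::euclidean_space \<Rightarrow> complex) \<Rightarrow> 'a \<Rightarrow> real \<Rightarrow> 'a \<Rightarrow> complex" where
  "normalized_symbol f z h w = f (z + sqrt h *\<^sub>R w) / f z"

lemma normalized_symbol_smooth: "smooth f \<Longrightarrow> smooth (normalized_symbol f z h)"
  using smooth_cmult[OF smooth_rescale, of f "1 / f z" z "sqrt h"]
  by (simp add: normalized_symbol_def[abs_def])

lemma normalized_symbol_derivs:
  assumes "smooth f" "bs \<in> lists Basis" "0 < h"
  shows "cmod (partial_derivs bs (normalized_symbol f z h) w) =
    h powr (length bs / 2) * cmod (partial_derivs bs f (z + sqrt h *\<^sub>R w)) / cmod (f z)"
proof -
  have "sqrt h ^ length bs = h powr (length bs / 2)"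
    using assms(3) by (simp add: powr_half_sqrt[symmetric] powr_powr[symmetric] powr_realpow[symmetric] powr_powr)
  moreover have eq: "normalized_symbol f z h = (\<lambda>w. (1 / f z) * f (z + sqrt h *\<^sub>R w))"
    by (simp add: normalized_symbol_def[abs_def])
  have "partial_derivs bs (normalized_symbol f z h) w =
      (1 / f z) * (of_real (sqrt h ^ length bs) * partial_derivs bs f (z + sqrt h *\<^sub>R w))"
    unfolding eq by (simp only: partial_derivs_cmult[OF smooth_rescale[OF assms(1)] assms(2)]
        partial_derivs_rescale[OF assms(1,2)])
  ultimately show ?thesis
    using assms(3) by (simp add: norm_mult norm_divide norm_power)
qed

text \<open>The normalized symbol is 1 at the origin, so the mean value inequality on the ball of
  radius \<open>norm w\<close> turns first derivatives tending to 0 into convergence.\<close>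

lemma normalized_symbol_tendsto:
  fixes f :: "nat \<Rightarrow> 'a::euclidean_space \<Rightarrow> complex"
  assumes f: "\<And>j. smooth (f j)" and nz: "\<And>j. f j (z j) \<noteq> 0"
    and bd: "\<forall>\<^sub>F j in sequentially. \<forall>x\<in>cball 0 (norm w). \<forall>b\<in>Basis.
       cmod (partial_deriv b (normalized_symbol (f j) (z j) (H j)) x) \<le> \<epsilon> j"
    and \<epsilon>: "\<epsilon> \<longlonglongrightarrow> 0"
  shows "(\<lambda>j. normalized_symbol (f j) (z j) (H j) w) \<longlonglongrightarrow> 1"
proof -
  have "(\<lambda>j. normalized_symbol (f j) (z j) (H j) w - 1) \<longlonglongrightarrow> 0"
  proof (rule Lim_null_comparison)
    show "(\<lambda>j. DIM('a) * \<epsilon> j * norm w) \<longlonglongrightarrow> 0"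
      using tendsto_mult_left[OF tendsto_mult_right[OF \<epsilon>], of "real DIM('a)" "norm w"] by (simp add: mult.assoc)
    show "\<forall>\<^sub>F j in sequentially. norm (normalized_symbol (f j) (z j) (H j) w - 1) \<le> DIM('a) * \<epsilon> j * norm w"
      using bd
    proof eventually_elim
      case (elim j)
      have "cmod (normalized_symbol (f j) (z j) (H j) w - normalized_symbol (f j) (z j) (H j) 0) \<le> DIM('a) * \<epsilon> j * norm (w - 0)"
        using smooth_lipschitz[of "normalized_symbol (f j) (z j) (H j)" "cball 0 (norm w)" w 0 "\<epsilon> j"]
          normalized_symbol_smooth[OF f] elim by auto
      then show ?case
        using nz[of j] by (simp add: normalized_symbol_def)
    qed
  qed
  then show ?thesis by (simp add: LIM_zero_iff)
qed

locale peak_sequence =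
  fixes a :: "real \<Rightarrow> (real^'n) \<times> (real^'n) \<Rightarrow> complex"
    and h0 \<delta> \<kappa> :: real and H :: "nat \<Rightarrow> real" and z :: "nat \<Rightarrow> (real^'n) \<times> (real^'n)" and N :: nat
  assumes a: "a \<in> symbol_class h0 \<delta>" and \<kappa>: "\<delta> < \<kappa>" "\<kappa> < 1 / 2" "0 < \<kappa>"
    and H: "\<And>j. 0 < H j" "\<And>j. H j < h0" "\<And>j. H j < 1" "H \<longlonglongrightarrow> 0"
    and lower: "\<And>j. H j ^ N \<le> cmod (a (H j) (z j))"
    and peak: "\<And>j w. cmod (a (H j) w) \<le> exp (norm (w - z j) / H j powr \<kappa>) * cmod (a (H j) (z j))"
begin

lemma H_mem: "H j \<in> {0<..<h0}"
  using H by auto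

lemma a_smooth: "smooth (a (H j))" by (rule symbol_class_smooth[OF a H_mem])

lemma HN_pos: "0 < H j ^ N"
  using H(1) by simp

lemma a_nz: "0 < cmod (a (H j) (z j))"
  using lower[of j] HN_pos[of j] by linarith

text \<open>Interpolation at scale \<open>H j powr \<kappa>\<close>. On the ball of
  \<open>1 + k\<close> times this radius the damping costs only \<open>exp (1 + k)\<close>, and
  rescaled derivatives of order at least \<open>L\<close> are at most a multiple of
  \<open>H j ^ N\<close>, hence of the peak value.\<close>

lemma relative_bound_order:
  "\<exists>M\<ge>0. \<forall>j. \<forall>bs\<in>lists Basis. \<forall>w\<in>cball (z j) (H j powr \<kappa>). length bs = k \<longrightarrow>
    (H j powr \<kappa>) ^ k * cmod (partial_derivs bs (a (H j)) w) \<le> M * cmod (a (H j) (z j))"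
proof -
  \<comment> \<open>Each differentiation at this scale gains
    \<open>H j powr (\<kappa> - \<delta>)\<close>; \<open>L\<close> of them reach
    \<open>H j ^ N\<close>. The added 1 keeps \<open>L\<close> positive when
    \<open>N = 0\<close>.\<close>
  define L where "L = nat \<lceil>N / (\<kappa> - \<delta>)\<rceil> + 1"
  have "N / (\<kappa> - \<delta>) \<le> L"
    unfolding L_def by linarith
  then have L: "L \<ge> 1" "N \<le> (\<kappa> - \<delta>) * L"
    using \<kappa> by (auto simp: L_def field_simps)
  obtain c where c: "interpolation_const TYPE((real^'n) \<times> (real^'n)) L k c"
    using partial_derivs_interpolation[OF L(1)] by blast
  then have c0: "0 \<le> c" by (simp add: interpolation_const_def)
  obtain C where C: "0 \<le> C" "\<forall>bs\<in>lists Basis. length bs \<le> L + k \<longrightarrow> (\<forall>h\<in>{0<..<h0}. \<forall>z.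
      cmod (partial_derivs bs (a h) z) \<le> C * h powr (- \<delta> * real (length bs)))"
    using symbol_class_bound[OF a, of "L + k"] by blast
  have "(H j powr \<kappa>) ^ k * cmod (partial_derivs bs (a (H j)) w) \<le> c * (exp (1 + k) + C) * cmod (a (H j) (z j))"
    if bs: "bs \<in> lists Basis" "length bs = k" and w: "w \<in> cball (z j) (H j powr \<kappa>)" for j bs w
  proof -
    let ?r = "H j powr \<kappa>"
    have r: "0 < ?r"
      using H(1)[of j] by simp
    have "?r ^ k * cmod (partial_derivs bs (a (H j)) w) \<le> c * (exp (1 + k) * cmod (a (H j) (z j)) + C * cmod (a (H j) (z j)))"
    proof (rule interpolation_constD[OF c a_smooth r, where ?z0.0 = "z j" and \<rho> = 1])
      fix v assume v: "v \<in> cball (z j) ((1 + real k) * ?r)"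
      then have "norm (v - z j) / ?r \<le> 1 + k"
        using r by (simp add: dist_norm norm_minus_commute divide_le_eq)
      then have "exp (norm (v - z j) / ?r) * cmod (a (H j) (z j)) \<le> exp (1 + k) * cmod (a (H j) (z j))"
        by (intro mult_right_mono) auto
      then show "cmod (a (H j) v) \<le> exp (1 + k) * cmod (a (H j) (z j))"
        using peak[of j v] by linarith
    next
      fix cs v assume cs: "cs \<in> lists (Basis :: ((real^'n) \<times> (real^'n)) set)" "L \<le> length cs" "length cs \<le> L + k"
      have "?r ^ length cs * cmod (partial_derivs cs (a (H j)) v) \<le> ?r ^ length cs * (C * H j powr (- \<delta> * real (length cs)))"
        using C(2)[rule_format, OF cs(1,3) H_mem, of j v] by (intro mult_left_mono) auto
      also have "\<dots> = C * H j powr ((\<kappa> - \<delta>) * real (length cs))"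
        using H(1)[of j] r by (simp add: powr_realpow[symmetric] powr_powr powr_add[symmetric] algebra_simps)
      also have "\<dots> \<le> C * H j powr (real N)"
      proof (intro mult_left_mono powr_mono')
        show "real N \<le> (\<kappa> - \<delta>) * real (length cs)"
          by (rule order_trans[OF L(2)]) (use cs(2) \<kappa> in \<open>auto intro!: mult_left_mono\<close>)
      qed (use H(1,3)[of j] C in auto)
      also have "\<dots> \<le> C * cmod (a (H j) (z j))"
        using lower[of j] C(1) H(1)[of j] by (intro mult_left_mono) (auto simp: powr_realpow)
      finally show "?r ^ length cs * cmod (partial_derivs cs (a (H j)) v) \<le> C * cmod (a (H j) (z j))" .
    qed (use bs w in auto)
    then show ?thesis by (simp add: algebra_simps)
  qed
  then show ?thesis
    using c0 C(1) by (intro exI[of _ "c * (exp (1 + k) + C)"]) auto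
qed

text \<open>Passing from the scale \<open>H j powr \<kappa>\<close> to the smaller scale
  \<open>sqrt (H j)\<close> gains \<open>H j powr (1 / 2 - \<kappa>)\<close> per derivative. The
  condition on \<open>w\<close> keeps the point within the first scale of the peak.\<close>

lemma relative_bound:
  "\<exists>M\<ge>0. \<forall>j. \<forall>bs\<in>lists Basis. \<forall>w. length bs \<le> K \<longrightarrow> sqrt (H j) * norm w \<le> H j powr \<kappa> \<longrightarrow>
    cmod (partial_derivs bs (normalized_symbol (a (H j)) (z j) (H j)) w) \<le> M * H j powr ((1 / 2 - \<kappa>) * length bs)"
proof -
  have "\<forall>k. \<exists>M\<ge>0. \<forall>j. \<forall>bs\<in>lists Basis. \<forall>w\<in>cball (z j) (H j powr \<kappa>). length bs = k \<longrightarrow>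
      (H j powr \<kappa>) ^ k * cmod (partial_derivs bs (a (H j)) w) \<le> M * cmod (a (H j) (z j))"
    by (rule allI, rule relative_bound_order)
  from choice[OF this] obtain Mf where Mf0: "\<forall>k. 0 \<le> Mf k \<and>
    (\<forall>j. \<forall>bs\<in>lists Basis. \<forall>w\<in>cball (z j) (H j powr \<kappa>). length bs = k \<longrightarrow>
      (H j powr \<kappa>) ^ k * cmod (partial_derivs bs (a (H j)) w) \<le> Mf k * cmod (a (H j) (z j)))" ..
  note Mf = Mf0[rule_format, THEN conjunct1] Mf0[rule_format, THEN conjunct2, rule_format]
  define M where "M = (\<Sum>k\<le>K. Mf k)"
  have "cmod (partial_derivs bs (normalized_symbol (a (H j)) (z j) (H j)) w) \<le> M * H j powr ((1 / 2 - \<kappa>) * length bs)"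
    if bs: "bs \<in> lists Basis" "length bs \<le> K" and w: "sqrt (H j) * norm w \<le> H j powr \<kappa>" for j bs w
  proof -
    let ?k = "length bs" and ?m = "cmod (a (H j) (z j))"
    have "z j + sqrt (H j) *\<^sub>R w \<in> cball (z j) (H j powr \<kappa>)"
      using w H(1)[of j] by (simp add: dist_norm)
    then have "(H j powr \<kappa>) ^ ?k * cmod (partial_derivs bs (a (H j)) (z j + sqrt (H j) *\<^sub>R w)) \<le> Mf ?k * ?m"
      by (rule Mf(2)[OF bs(1) _ refl])
    also have "\<dots> \<le> M * ?m"
      unfolding M_def using bs(2) Mf(1) by (intro mult_right_mono member_le_sum) auto
    finally have "H j powr ((1 / 2 - \<kappa>) * ?k) * ((H j powr \<kappa>) ^ ?k * cmod (partial_derivs bs (a (H j)) (z j + sqrt (H j) *\<^sub>R w)))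
        \<le> H j powr ((1 / 2 - \<kappa>) * ?k) * (M * ?m)"
      by (intro mult_left_mono) auto
    moreover have "H j powr ((1 / 2 - \<kappa>) * ?k) * (H j powr \<kappa>) ^ ?k = H j powr (?k / 2)"
      using H(1)[of j] by (simp add: powr_realpow[symmetric] powr_powr powr_add[symmetric] algebra_simps)
    ultimately show ?thesis
      using a_nz[of j] unfolding normalized_symbol_derivs[OF a_smooth bs(1) H(1)]
      by (simp add: mult.assoc[symmetric] divide_le_eq) (simp add: mult_ac)
  qed
  moreover have "0 \<le> M"
    unfolding M_def by (intro sum_nonneg Mf)
  ultimately show ?thesis by blast
qed

text \<open>Where the relative bound does not apply, \<open>norm w\<close> exceeds a negative power of \<open>H j\<close>, so the absolute bounds
  on the symbol are absorbed by \<open>(1 + norm w) ^ p\<close>.\<close>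

lemma normalized_symbol_bound:
  assumes p: "N \<le> (1 / 2 - \<kappa>) * real p"
  shows "\<exists>M\<ge>0. \<forall>j w. jet_bound K (normalized_symbol (a (H j)) (z j) (H j)) w (M * (1 + norm w) ^ p)"
proof -
  obtain M where M: "0 \<le> M" "\<forall>j. \<forall>bs\<in>lists Basis. \<forall>w. length bs \<le> K \<longrightarrow> sqrt (H j) * norm w \<le> H j powr \<kappa> \<longrightarrow>
    cmod (partial_derivs bs (normalized_symbol (a (H j)) (z j) (H j)) w) \<le> M * H j powr ((1 / 2 - \<kappa>) * length bs)"
    using relative_bound[of K] by blast
  obtain C where C: "0 \<le> C" "\<forall>bs\<in>lists Basis. length bs \<le> K \<longrightarrow> (\<forall>h\<in>{0<..<h0}. \<forall>z.
      cmod (partial_derivs bs (a h) z) \<le> C * h powr (- \<delta> * real (length bs)))"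
    using symbol_class_bound[OF a, of K] by blast
  have "cmod (partial_derivs bs (normalized_symbol (a (H j)) (z j) (H j)) w) \<le> (M + C) * (1 + norm w) ^ p"
    if bs: "bs \<in> lists Basis" "length bs \<le> K" for bs j w
  proof (cases "sqrt (H j) * norm w \<le> H j powr \<kappa>")
    case True
    have "H j powr ((1 / 2 - \<kappa>) * length bs) \<le> 1"
      using H(1,3)[of j] \<kappa> by (intro powr_le1) auto
    then have "M * H j powr ((1 / 2 - \<kappa>) * length bs) \<le> M * 1"
      using M(1) by (intro mult_left_mono)
    moreover have "M * 1 \<le> (M + C) * (1 + norm w) ^ p"
      using M(1) C(1) by (intro mult_mono) (auto simp: one_le_power)
    ultimately show ?thesis
      using M(2) bs True by (meson order_trans)
  next
    case False
    have h: "0 < H j" "H j < 1"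
      using H by auto
    have "cmod (partial_derivs bs (normalized_symbol (a (H j)) (z j) (H j)) w) \<le>
      H j powr (length bs / 2) * (C * H j powr (- \<delta> * real (length bs))) / cmod (a (H j) (z j))"
      unfolding normalized_symbol_derivs[OF a_smooth bs(1) H(1)]
      using C(2)[rule_format, OF bs H_mem, of j "z j + sqrt (H j) *\<^sub>R w"]
      by (intro divide_right_mono mult_left_mono) auto
    also have "\<dots> = C * H j powr ((1 / 2 - \<delta>) * length bs) / cmod (a (H j) (z j))"
      using h by (simp add: powr_add[symmetric] algebra_simps)
    also have "\<dots> \<le> C * 1 / H j ^ N"
    proof (rule frac_le)
      show "C * H j powr ((1 / 2 - \<delta>) * length bs) \<le> C * 1"
        using h \<kappa> C(1) by (intro mult_left_mono powr_le1) auto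
    qed (use C lower[of j] HN_pos[of j] in auto)
    also have "\<dots> = C * H j powr (- real N)"
      using h by (simp add: powr_minus powr_realpow divide_inverse)
    \<comment> \<open>The failed condition says \<open>norm w > H j powr (\<kappa> - 1 / 2)\<close>;
      by the choice of \<open>p\<close>, the power \<open>p\<close> of this outweighs the loss from
      dividing by the peak value.\<close>
    also have "\<dots> \<le> C * H j powr ((\<kappa> - 1 / 2) * p)"
      using p h C(1) by (intro mult_left_mono powr_mono') (auto simp: algebra_simps)
    also have "\<dots> = C * (H j powr (\<kappa> - 1 / 2)) ^ p"
      using h by (simp add: powr_realpow[symmetric] powr_powr)
    also have "\<dots> \<le> C * (1 + norm w) ^ p"
    proof (intro mult_left_mono power_mono)
      have "H j powr (\<kappa> - 1 / 2) = H j powr \<kappa> / sqrt (H j)"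
        using h by (simp add: powr_diff powr_half_sqrt)
      also have "\<dots> \<le> norm w"
        using False h by (simp add: divide_le_eq mult.commute)
      finally show "H j powr (\<kappa> - 1 / 2) \<le> 1 + norm w" by simp
    qed (use C in auto)
    also have "\<dots> \<le> (M + C) * (1 + norm w) ^ p"
      using M(1) by (intro mult_right_mono) auto
    finally show ?thesis .
  qed
  then show ?thesis
    using M(1) C(1) unfolding jet_bound_def by (intro exI[of _ "M + C"]) auto
qed

text \<open>For fixed \<open>w\<close> the ball of radius \<open>norm w\<close> eventually lies
  where the relative bounds hold, because \<open>sqrt (H j)\<close> is negligible against
  \<open>H j powr \<kappa>\<close>; first derivatives there are bounded by a multiple of
  \<open>H j powr (1 / 2 - \<kappa>)\<close>.\<close>

lemma normalized_symbol_limit: "(\<lambda>j. normalized_symbol (a (H j)) (z j) (H j) w) \<longlonglongrightarrow> 1"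
proof -
  obtain M where M: "0 \<le> M" "\<forall>j. \<forall>bs\<in>lists Basis. \<forall>w. length bs \<le> 1 \<longrightarrow> sqrt (H j) * norm w \<le> H j powr \<kappa> \<longrightarrow>
    cmod (partial_derivs bs (normalized_symbol (a (H j)) (z j) (H j)) w) \<le> M * H j powr ((1 / 2 - \<kappa>) * length bs)"
    using relative_bound[of 1] by blast
  have lim: "(\<lambda>j. H j powr (1 / 2 - \<kappa>)) \<longlonglongrightarrow> 0"
    using H \<kappa> by (intro tendsto_zero_powrI[OF H(4) tendsto_const]) (auto intro!: always_eventually less_imp_le)
  then have "(\<lambda>j. H j powr (1 / 2 - \<kappa>) * norm w) \<longlonglongrightarrow> 0 * norm w"
    by (intro tendsto_intros)
  then have "\<forall>\<^sub>F j in sequentially. H j powr (1 / 2 - \<kappa>) * norm w < 1"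
    by (intro order_tendstoD(2)) auto
  then have ev: "\<forall>\<^sub>F j in sequentially. \<forall>x\<in>cball 0 (norm w). \<forall>b\<in>Basis.
       cmod (partial_deriv b (normalized_symbol (a (H j)) (z j) (H j)) x) \<le> M * H j powr (1 / 2 - \<kappa>)"
  proof eventually_elim
    case (elim j)
    show ?case
    proof (intro ballI)
      fix x b :: "(real^'n) \<times> (real^'n)" assume x: "x \<in> cball 0 (norm w)" and b: "b \<in> Basis"
      have "sqrt (H j) = H j powr \<kappa> * H j powr (1 / 2 - \<kappa>)"
        using H(1)[of j] by (simp add: powr_add[symmetric] powr_half_sqrt)
      then have "sqrt (H j) * norm x = H j powr \<kappa> * (H j powr (1 / 2 - \<kappa>) * norm x)"
        by simp
      also have "\<dots> \<le> H j powr \<kappa> * (H j powr (1 / 2 - \<kappa>) * norm w)"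
        using x by (intro mult_left_mono) auto
      also have "\<dots> \<le> H j powr \<kappa> * 1"
        using elim by (intro mult_left_mono) auto
      finally have "sqrt (H j) * norm x \<le> H j powr \<kappa>" by simp
      then show "cmod (partial_deriv b (normalized_symbol (a (H j)) (z j) (H j)) x) \<le> M * H j powr (1 / 2 - \<kappa>)"
        using M(2)[rule_format, of "[b]" j x] b by simp
    qed
  qed
  show ?thesis
  proof (rule normalized_symbol_tendsto[OF a_smooth _ ev])
    show "(\<lambda>j. M * H j powr (1 / 2 - \<kappa>)) \<longlonglongrightarrow> 0"
      using tendsto_mult_left[OF lim, of M] by simp
  qed (use a_nz in auto)
qed

end

text \<open>For \<open>\<delta> = 0\<close> the rescaling gains half a power of \<open>H j\<close>
  per derivative, and division by a value of modulus at least \<open>e\<close> costs a fixed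
  constant. So these bounds are uniform in \<open>w\<close>.\<close>

lemma
  fixes c :: "real \<Rightarrow> (real^'n) \<times> (real^'n) \<Rightarrow> complex"
  assumes c: "c \<in> symbol_class h0 0" and H: "\<And>j. 0 < H j" "\<And>j. H j < h0" "\<And>j. H j < 1" "H \<longlonglongrightarrow> 0"
    and e: "0 < e" "\<And>j. e \<le> cmod (c (H j) (z j))"
  shows elliptic_normalized_symbol_bound:
      "\<exists>M\<ge>0. \<forall>j w. jet_bound K (normalized_symbol (c (H j)) (z j) (H j)) w M"
    and elliptic_normalized_symbol_limit:
      "(\<lambda>j. normalized_symbol (c (H j)) (z j) (H j) w) \<longlonglongrightarrow> 1"
proof -
  have mem: "H j \<in> {0<..<h0}" for j
    using H by auto
  note sm = symbol_class_smooth[OF c mem]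
  have bd: "\<exists>M\<ge>0. \<forall>j. \<forall>bs\<in>lists Basis. \<forall>w. length bs \<le> K \<longrightarrow>
    cmod (partial_derivs bs (normalized_symbol (c (H j)) (z j) (H j)) w) \<le> M * H j powr (length bs / 2)" for K
  proof -
    obtain C where C: "0 \<le> C" "\<forall>bs\<in>lists Basis. length bs \<le> K \<longrightarrow> (\<forall>h\<in>{0<..<h0}. \<forall>z.
      cmod (partial_derivs bs (c h) z) \<le> C * h powr (- 0 * real (length bs)))"
      using symbol_class_bound[OF c, of K] by blast
    have "cmod (partial_derivs bs (normalized_symbol (c (H j)) (z j) (H j)) w) \<le> (C / e) * H j powr (length bs / 2)"
      if bs: "bs \<in> lists Basis" "length bs \<le> K" for bs j w
    proof -
      have "cmod (partial_derivs bs (c (H j)) (z j + sqrt (H j) *\<^sub>R w)) \<le> C"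
        using C(2)[rule_format, OF bs mem[of j], of "z j + sqrt (H j) *\<^sub>R w"] H(1)[of j] by simp
      then have "H j powr (length bs / 2) * cmod (partial_derivs bs (c (H j)) (z j + sqrt (H j) *\<^sub>R w)) / cmod (c (H j) (z j))
        \<le> H j powr (length bs / 2) * C / e"
        using e C(1) by (intro frac_le mult_left_mono) auto
      then show ?thesis
        unfolding normalized_symbol_derivs[OF sm bs(1) H(1)] by (simp add: mult.commute)
    qed
    then show ?thesis
      using C(1) e(1) by (intro exI[of _ "C / e"]) auto
  qed
  show "\<exists>M\<ge>0. \<forall>j w. jet_bound K (normalized_symbol (c (H j)) (z j) (H j)) w M"
  proof -
    obtain M where M: "0 \<le> M" "\<forall>j. \<forall>bs\<in>lists Basis. \<forall>w. length bs \<le> K \<longrightarrow>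
      cmod (partial_derivs bs (normalized_symbol (c (H j)) (z j) (H j)) w) \<le> M * H j powr (length bs / 2)"
      using bd by blast
    have "M * H j powr (k / 2) \<le> M" for j and k :: nat
      using M(1) H(1,3)[of j] by (intro mult_left_le powr_le1) auto
    then show ?thesis
      using M unfolding jet_bound_def by (meson order_trans)
  qed
  obtain M where M: "0 \<le> M" "\<forall>j. \<forall>bs\<in>lists Basis. \<forall>w. length bs \<le> 1 \<longrightarrow>
      cmod (partial_derivs bs (normalized_symbol (c (H j)) (z j) (H j)) w) \<le> M * H j powr (length bs / 2)"
    using bd by blast
  show "(\<lambda>j. normalized_symbol (c (H j)) (z j) (H j) w) \<longlonglongrightarrow> 1"
  proof (rule normalized_symbol_tendsto[where \<epsilon> = "\<lambda>j. M * H j powr (1 / 2)", OF sm])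
    show "c (H j) (z j) \<noteq> 0" for j
      using e(1) e(2)[of j] by auto
    show "\<forall>\<^sub>F j in sequentially. \<forall>x\<in>cball 0 (norm w). \<forall>b\<in>Basis.
       cmod (partial_deriv b (normalized_symbol (c (H j)) (z j) (H j)) x) \<le> M * H j powr (1 / 2)"
      using M(2)[rule_format, of "[_]"] by (intro always_eventually) auto
    have "(\<lambda>j. H j powr (1 / 2)) \<longlonglongrightarrow> 0"
      using H by (intro tendsto_zero_powrI[OF H(4) tendsto_const]) (auto intro!: always_eventually less_imp_le)
    from tendsto_mult_left[OF this, of M] show "(\<lambda>j. M * H j powr (1 / 2)) \<longlonglongrightarrow> 0"
      by simp
  qed
qed

subsection \<open>Coherent states and square integrability\<close>

text \<open>The extension \<open>T\<close> is tied to the quantization only on Schwartz functions,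
  so the transformed state has to be placed in that class. Dilation costs
  \<open>(1 + r) ^ K\<close>, and the product with the character is covered by the Leibniz
  bound.\<close>

lemma schwartz_coherent_state:
  fixes v :: "real^'n \<Rightarrow> complex"
  assumes v: "smooth v" and bd: "\<And>K k. \<exists>C\<ge>0. \<forall>s. jet_bound K v s (C / (1 + norm s) ^ k)" and h: "0 < h"
  shows "schwartz (coherent_state v y \<eta> h)"
proof -
  define q where "q = complex_of_real (h powr (- real CARD('n) / 4))"
  define r where "r = 1 / sqrt h"
  have r: "0 < r"
    using h by (simp add: r_def)
  define g where "g = (\<lambda>x. v (- r *\<^sub>R y + r *\<^sub>R x))"
  define f where "f = (\<lambda>x. cis (x \<bullet> ((1 / h) *\<^sub>R \<eta>)))"
  have eq: "coherent_state v y \<eta> h = (\<lambda>x. q * (g x * f x))"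
    by (auto simp: coherent_state_def q_def g_def f_def r_def algebra_simps)
  have g: "smooth g"
    unfolding g_def by (rule smooth_rescale[OF v])
  have f: "smooth f"
    unfolding f_def by (rule smooth_cis_inner)
  have gf: "smooth (\<lambda>x. g x * f x)" by (rule smooth_mult[OF g f])
  have "\<exists>C. \<forall>x. (1 + norm x) ^ k * cmod (partial_derivs bs (\<lambda>x. q * (g x * f x)) x) \<le> C"
    if bs: "bs \<in> lists Basis" for bs k
  proof -
    define K where "K = length bs"
    obtain C where C: "0 \<le> C" "\<And>s. jet_bound K v s (C / (1 + norm s) ^ k)"
      using bd by blast
    obtain D where D: "\<And>x. jet_bound K f x D"
      unfolding f_def using jet_bound_cis_inner by blast
    have D0: "0 \<le> D"
      using jet_bound_pos[OF D] .
    \<comment> \<open>Since \<open>norm x\<close> is at most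
      \<open>norm y + sqrt h * norm ((1 / sqrt h) *\<^sub>R (x - y))\<close>, this constant compares
      the weight at \<open>x\<close> with the weight at the rescaled point.\<close>
    define c1 where "c1 = 1 + norm y + sqrt h"
    have pos: "0 < 1 + norm x" for x :: "real^'n" by (simp add: add_pos_nonneg)
    have weight: "(1 + norm x) ^ k / (1 + norm (- r *\<^sub>R y + r *\<^sub>R x)) ^ k \<le> c1 ^ k" for x
    proof -
      have "norm x \<le> norm y + norm (x - y)" by (metis add.commute norm_triangle_sub)
      also have "norm (x - y) = sqrt h * norm (- r *\<^sub>R y + r *\<^sub>R x)"
      proof -
        have "x - y = sqrt h *\<^sub>R (- r *\<^sub>R y + r *\<^sub>R x)"
          using h by (simp add: r_def algebra_simps)
        then show ?thesis
          using h by (metis abs_of_pos norm_scaleR real_sqrt_gt_0_iff)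
      qed
      finally have "1 + norm x \<le> 1 + norm y + sqrt h * norm (- r *\<^sub>R y + r *\<^sub>R x)"
        by simp
      also have "\<dots> \<le> c1 * (1 + norm (- r *\<^sub>R y + r *\<^sub>R x))"
        using h by (simp add: c1_def algebra_simps)
      finally have "(1 + norm x) ^ k \<le> (c1 * (1 + norm (- r *\<^sub>R y + r *\<^sub>R x))) ^ k"
        by (intro power_mono) auto
      then show ?thesis
        using pos[of "- r *\<^sub>R y + r *\<^sub>R x"] by (simp add: power_mult_distrib divide_le_eq)
    qed
    have g_bd: "jet_bound K g x ((1 + r) ^ K * (C / (1 + norm (- r *\<^sub>R y + r *\<^sub>R x)) ^ k))" for x
      unfolding jet_bound_def
    proof (intro ballI impI)
      fix cs :: "(real^'n) list" assume cs: "cs \<in> lists Basis" "length cs \<le> K"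
      have "r ^ length cs \<le> (1 + r) ^ length cs"
        using r by (intro power_mono) auto
      also have "\<dots> \<le> (1 + r) ^ K"
        using r cs(2) by (intro power_increasing) auto
      finally have "r ^ length cs * cmod (partial_derivs cs v (- r *\<^sub>R y + r *\<^sub>R x))
          \<le> (1 + r) ^ K * (C / (1 + norm (- r *\<^sub>R y + r *\<^sub>R x)) ^ k)"
        using r by (intro mult_mono jet_boundD[OF C(2) cs]) auto
      then show "cmod (partial_derivs cs g x) \<le> (1 + r) ^ K * (C / (1 + norm (- r *\<^sub>R y + r *\<^sub>R x)) ^ k)"
        unfolding g_def partial_derivs_rescale[OF v cs(1)] using r by (simp add: norm_mult norm_power)
    qed
    have "(1 + norm x) ^ k * cmod (partial_derivs bs (\<lambda>x. q * (g x * f x)) x)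
       \<le> cmod q * (2 ^ K * (1 + r) ^ K * C * D * c1 ^ k)" for x
    proof -
      let ?w = "(1 + norm (- r *\<^sub>R y + r *\<^sub>R x)) ^ k"
      have "cmod (partial_derivs bs (\<lambda>x. q * (g x * f x)) x) \<le> cmod q * (2 ^ K * ((1 + r) ^ K * (C / ?w)) * D)"
        by (rule jet_boundD[OF jet_bound_cmult[OF gf jet_bound_mult[OF g f g_bd D]] bs]) (simp add: K_def)
      then have "(1 + norm x) ^ k * cmod (partial_derivs bs (\<lambda>x. q * (g x * f x)) x)
        \<le> (1 + norm x) ^ k * (cmod q * (2 ^ K * ((1 + r) ^ K * (C / ?w)) * D))"
        by (intro mult_left_mono) auto
      also have "\<dots> = cmod q * (2 ^ K * (1 + r) ^ K * C * D) * ((1 + norm x) ^ k / ?w)" by simp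
      also have "\<dots> \<le> cmod q * (2 ^ K * (1 + r) ^ K * C * D) * c1 ^ k"
        using C(1) D0 r by (intro mult_left_mono weight) auto
      finally show ?thesis by (simp add: mult.assoc)
    qed
    then show ?thesis by blast
  qed
  then show ?thesis
    unfolding schwartz_def eq using smooth_cmult[OF gf] by blast
qed

lemma schwartz_L2:
  fixes u :: "real^'n \<Rightarrow> complex"
  assumes "schwartz u"
  shows "u \<in> L2"
proof -
  have [measurable]: "u \<in> borel_measurable borel"
    by (rule continuous_borel_measurable[OF schwartz_continuous[OF assms]])
  obtain B where B: "\<And>x. cmod (u x) \<le> B"
    using schwartz_decay[OF assms, of 0] by auto
  have "integrable lborel (\<lambda>x. (cmod (u x))\<^sup>2)"
  proof (rule Bochner_Integration.integrable_bound)
    show "integrable lborel (\<lambda>x. B * cmod (u x))"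
      using schwartz_integrable[OF assms] by auto
    show "AE x in lborel. norm ((cmod (u x))\<^sup>2) \<le> norm (B * cmod (u x))"
      using B by (auto simp: power2_eq_square abs_mult intro!: AE_I2 mult_right_mono order_trans[OF _ abs_ge_self])
  qed auto
  then show ?thesis by (simp add: L2_def)
qed

lemma nn_integral_L2_norm:
  fixes u :: "real^'n \<Rightarrow> complex"
  assumes "u \<in> L2"
  shows "(\<integral>\<^sup>+x. ennreal ((cmod (u x))\<^sup>2) \<partial>lborel) = ennreal ((L2_norm u)\<^sup>2)"
proof -
  have "(\<integral>\<^sup>+x. ennreal ((cmod (u x))\<^sup>2) \<partial>lborel) = ennreal (LINT x|lborel. (cmod (u x))\<^sup>2)"
    using assms by (intro nn_integral_eq_integral) (auto simp: L2_def)
  moreover have "0 \<le> (LINT x|lborel. (cmod (u x))\<^sup>2)"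
    by (rule Bochner_Integration.integral_nonneg) auto
  ultimately show ?thesis by (simp add: L2_norm_def)
qed

text \<open>The density \<open>q\<close> is built from \<open>u\<close>, which makes it measurable;
  the profile \<open>p\<close> is only an almost everywhere description. The powers of
  \<open>h\<close> cancel because forming a coherent state preserves the norm.\<close>

lemma L2_rescaled_profile:
  fixes u p :: "real^'n \<Rightarrow> complex"
  assumes u: "u \<in> L2" and h: "0 < h" and ae: "AE x in lborel. u x = coherent_state p y \<eta> h x"
  shows "\<exists>q. q \<in> borel_measurable lborel \<and> (AE s in lborel. q s = (cmod (p s))\<^sup>2) \<and>
    (\<integral>\<^sup>+s. ennreal (q s) \<partial>lborel) = ennreal ((L2_norm u)\<^sup>2)"
proof -
  let ?n = "CARD('n)"
  define q where "q s = sqrt h ^ ?n * (cmod (u (y + sqrt h *\<^sub>R s)))\<^sup>2" for s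
  have sh: "0 < sqrt h"
    using h by simp
  have u_meas [measurable]: "u \<in> borel_measurable borel"
    using u by (simp add: L2_def)
  have hn: "sqrt h ^ ?n * (h powr (- real ?n / 4))\<^sup>2 = 1"
  proof -
    have "sqrt h ^ ?n = h powr (real ?n / 2)"
      using h by (simp add: powr_half_sqrt[symmetric] powr_powr powr_realpow[symmetric])
    moreover have "(h powr (- real ?n / 4))\<^sup>2 = h powr (- real ?n / 2)"
      using h by (simp add: power2_eq_square powr_add[symmetric])
    ultimately show ?thesis
      using h by (simp add: powr_add[symmetric])
  qed
  have "AE s in lborel. u (y + sqrt h *\<^sub>R s) = coherent_state p y \<eta> h (y + sqrt h *\<^sub>R s)"
    by (rule AE_lborel_affine[OF sh ae])
  then have "AE s in lborel. q s = (cmod (p s))\<^sup>2"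
  proof eventually_elim
    case (elim s)
    have "cmod (u (y + sqrt h *\<^sub>R s)) = h powr (- real ?n / 4) * cmod (p s)"
      using h unfolding elim coherent_state_def by (simp add: norm_mult)
    then have "q s = (sqrt h ^ ?n * (h powr (- real ?n / 4))\<^sup>2) * (cmod (p s))\<^sup>2"
      by (simp only: q_def power_mult_distrib mult.assoc)
    then show ?case
      unfolding hn by simp
  qed
  moreover have "(\<integral>\<^sup>+s. ennreal (q s) \<partial>lborel) = ennreal ((L2_norm u)\<^sup>2)"
  proof -
    have "(\<integral>\<^sup>+s. ennreal (q s) \<partial>lborel) = ennreal (sqrt h ^ ?n) * (\<integral>\<^sup>+s. ennreal ((cmod (u (y + sqrt h *\<^sub>R s)))\<^sup>2) \<partial>lborel)"
      using h unfolding q_def by (subst nn_integral_cmult[symmetric]) (auto simp: ennreal_mult)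
    also have "\<dots> = (\<integral>\<^sup>+x. ennreal ((cmod (u x))\<^sup>2) \<partial>lborel)"
      using nn_integral_lborel_affine[OF sh, of "\<lambda>x. ennreal ((cmod (u x))\<^sup>2)" y] by simp
    finally show ?thesis by (simp only: nn_integral_L2_norm[OF u])
  qed
  moreover have "q \<in> borel_measurable lborel"
    unfolding q_def by measurable
  ultimately show ?thesis by blast
qed

text \<open>Fatou's lemma forces the limit to vanish almost everywhere, and continuity removes the
  exceptional set, because a nonempty open set is not negligible.\<close>

lemma zero_if_L2_limit_zero:
  fixes \<phi> :: "'a::euclidean_space \<Rightarrow> complex" and p :: "nat \<Rightarrow> 'a \<Rightarrow> complex"
  assumes cont: "continuous_on UNIV \<phi>" and lim: "\<And>s. (\<lambda>j. p j s) \<longlonglongrightarrow> \<phi> s"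
    and meas: "\<And>j. q j \<in> borel_measurable lborel" and ae: "\<And>j. AE s in lborel. q j s = (cmod (p j s))\<^sup>2"
    and int: "(\<lambda>j. \<integral>\<^sup>+s. ennreal (q j s) \<partial>lborel) \<longlonglongrightarrow> 0"
  shows "\<phi> s = 0"
proof -
  have [measurable]: "\<And>j. q j \<in> borel_measurable borel" "\<phi> \<in> borel_measurable borel"
    using meas cont by auto
  have "AE s in lborel. \<forall>j. q j s = (cmod (p j s))\<^sup>2"
    using ae by (simp add: AE_all_countable)
  then have "AE s in lborel. ennreal ((cmod (\<phi> s))\<^sup>2) = liminf (\<lambda>j. ennreal (q j s))"
  proof eventually_elim
    case (elim s)
    have "(\<lambda>j. ennreal ((cmod (p j s))\<^sup>2)) \<longlonglongrightarrow> ennreal ((cmod (\<phi> s))\<^sup>2)"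
      by (intro tendsto_intros lim)
    then have "liminf (\<lambda>j. ennreal ((cmod (p j s))\<^sup>2)) = ennreal ((cmod (\<phi> s))\<^sup>2)"
      by (intro lim_imp_Liminf) auto
    then show ?case
      using elim by simp
  qed
  then have "(\<integral>\<^sup>+s. ennreal ((cmod (\<phi> s))\<^sup>2) \<partial>lborel) = (\<integral>\<^sup>+s. liminf (\<lambda>j. ennreal (q j s)) \<partial>lborel)"
    by (rule nn_integral_cong_AE)
  also have "\<dots> \<le> liminf (\<lambda>j. \<integral>\<^sup>+s. ennreal (q j s) \<partial>lborel)"
    by (intro nn_integral_liminf) auto
  also have "\<dots> = 0"
    using int by (simp add: lim_imp_Liminf)
  finally have "(\<integral>\<^sup>+s. ennreal ((cmod (\<phi> s))\<^sup>2) \<partial>lborel) = 0"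
    by simp
  then have ae0: "AE s in lborel. \<phi> s = 0" by (subst (asm) nn_integral_0_iff_AE) auto
  have "open {s. \<phi> s \<noteq> 0}" by (intro open_Collect_neq cont continuous_intros)
  moreover have "negligible {s. \<phi> s \<noteq> 0}"
  proof -
    have "emeasure lborel {s \<in> space lborel. \<not> \<phi> s = 0} = 0"
      using ae0 by (subst (asm) AE_iff_measurable[OF _ refl]) auto
    then have "{s. \<phi> s \<noteq> 0} \<in> null_sets lborel" by (auto simp: null_sets_def)
    then show ?thesis by (simp add: negligible_iff_null_sets null_sets_completionI)
  qed
  ultimately have "{s. \<phi> s \<noteq> 0} = {}"
    using open_not_negligible by blast
  then show ?thesis by blast
qed

subsection \<open>Concentration at the peaks\<close>

lemma quantize_cmult:
  "quantize t h (\<lambda>z. k * c z) u x = k * quantize t h c u x"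
  "quantize t h c (\<lambda>y. k * u y) x = k * quantize t h c u x"
proof -
  have "k * (LINT \<xi>|lborel. LINT y|lborel. c (t *\<^sub>R x + (1 - t) *\<^sub>R y, \<xi>) * cis (((x - y) \<bullet> \<xi>) / h) * u y)
    = (LINT \<xi>|lborel. LINT y|lborel. k * (c (t *\<^sub>R x + (1 - t) *\<^sub>R y, \<xi>) * cis (((x - y) \<bullet> \<xi>) / h) * u y))"
    by (simp only: integral_mult_right_zero)
  then show "quantize t h (\<lambda>z. k * c z) u x = k * quantize t h c u x"
    "quantize t h c (\<lambda>y. k * u y) x = k * quantize t h c u x"
    by (simp_all add: quantize_def mult_ac)
qed

context peak_sequence
begin

text \<open>Almost everywhere \<open>T j (u j)\<close> is a coherent state with profile
  \<open>\<gamma> j * \<alpha> j * q j\<close>. Its norm divided by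
  \<open>cmod (\<gamma> j * \<alpha> j)\<close>, which is at least \<open>e * H j ^ N\<close>, is
  eventually at most \<open>D / e * H j\<close>; so one power beyond \<open>N\<close> would force
  the limit \<open>\<phi>\<close> of \<open>q j\<close> to vanish.\<close>

lemma not_negligible_near_elliptic:
  fixes \<phi> :: "real^'n \<Rightarrow> complex" and c :: "real \<Rightarrow> (real^'n) \<times> (real^'n) \<Rightarrow> complex"
  defines "u \<equiv> \<lambda>j. quantize 1 (H j) (a (H j)) (coherent_state \<phi> (fst (z j)) (snd (z j)) (H j))"
  assumes \<phi>: "schwartz \<phi>" "\<phi> s0 \<noteq> 0" and R: "0 \<le> R" and supp: "\<And>\<xi>. R < norm \<xi> \<Longrightarrow> fourier 1 \<phi> \<xi> = 0"
    and c: "c \<in> symbol_class h0 0" and e: "0 < e" "\<And>j. e \<le> cmod (c (H j) (z j))"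
    and T: "\<And>j. bounded_L2_extension (quantize t (H j) (c (H j))) (T j)" and t: "0 \<le> t" "t \<le> 1"
    and small: "\<forall>\<^sub>F j in sequentially. L2_norm (T j (u j)) \<le> D * H j ^ Suc N"
  shows False
proof -
  obtain p :: nat where "N / (1 / 2 - \<kappa>) \<le> p"
    using real_arch_simple by blast
  then have p: "N \<le> (1 / 2 - \<kappa>) * real p"
    using \<kappa> by (simp add: field_simps)
  define \<alpha> where "\<alpha> j = a (H j) (z j)" for j
  define \<gamma> where "\<gamma> j = c (H j) (z j)" for j
  define B where "B j = normalized_symbol (a (H j)) (z j) (H j)" for j
  define E where "E j = normalized_symbol (c (H j)) (z j) (H j)" for j
  have \<alpha>: "\<alpha> j \<noteq> 0" and \<gamma>: "\<gamma> j \<noteq> 0" for j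
    using a_nz[of j] e(1) e(2)[of j] by (auto simp: \<alpha>_def \<gamma>_def)
  have B_smooth: "smooth (B j)" and E_smooth: "smooth (E j)" for j
    unfolding B_def E_def by (intro normalized_symbol_smooth a_smooth symbol_class_smooth[OF c H_mem])+
  have B_bd: "\<exists>M\<ge>0. \<forall>j z. jet_bound K (B j) z (M * (1 + norm z) ^ p)" for K
    unfolding B_def by (rule normalized_symbol_bound[OF p])
  have E_bd: "\<exists>M\<ge>0. \<forall>j z. jet_bound K (E j) z M" for K
    unfolding E_def by (rule elliptic_normalized_symbol_bound[OF c H e])
  define w where "w j = quantize 1 1 (B j) \<phi>" for j
  define q where "q j = quantize t 1 (E j) (w j)" for j
  have q_lim: "(\<lambda>j. q j s) \<longlonglongrightarrow> \<phi> s" for s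
    unfolding q_def w_def
    by (rule quantize_quantize_tendsto[OF \<phi>(1) R supp B_smooth B_bd _ E_smooth E_bd _ t])
      (auto simp: B_def E_def intro: normalized_symbol_limit elliptic_normalized_symbol_limit[OF c H e])
  have fam: "amplitude_family R p (\<lambda>j. wave_amplitude \<phi> (B j))"
    by (rule amplitude_family_wave[OF \<phi>(1) R supp B_smooth B_bd])
  have w_osc: "w j = osc_integral (wave_amplitude \<phi> (B j))" for j
    by (simp add: w_def quantize_eq_osc_integral)
  define v where "v j = (\<lambda>s. \<alpha> j * w j s)" for j
  have w_smooth: "smooth (w j)" for j
    unfolding w_osc by (rule smooth_osc_integral[OF fam])
  have v_decay: "\<exists>C\<ge>0. \<forall>s. jet_bound K (v j) s (C / (1 + norm s) ^ k)" for j K k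
  proof -
    obtain C where C: "0 \<le> C" "\<And>j s. jet_bound K (w j) s (C / (1 + norm s) ^ k)"
      using osc_integral_jet_decay[OF fam, of K k] unfolding w_osc by blast
    have "jet_bound K (v j) s (cmod (\<alpha> j) * C / (1 + norm s) ^ k)" for s
      unfolding v_def using jet_bound_cmult[OF w_smooth C(2)] by simp
    then show ?thesis
      using C(1) by (intro exI[of _ "cmod (\<alpha> j) * C"]) auto
  qed
  have u_eq: "u j = coherent_state (v j) (fst (z j)) (snd (z j)) (H j)" for j
  proof -
    have eq: "(\<lambda>x. a (H j) ((fst (z j), snd (z j)) + sqrt (H j) *\<^sub>R x)) = (\<lambda>x. \<alpha> j * B j x)"
      using \<alpha>[of j] by (simp add: B_def normalized_symbol_def \<alpha>_def fun_eq_iff)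
    have "quantize 1 1 (\<lambda>x. \<alpha> j * B j x) \<phi> = v j"
      by (simp add: v_def w_def quantize_cmult fun_eq_iff)
    then show ?thesis
      unfolding u_def quantize_coherent_state[OF H(1)] eq by simp
  qed
  have u_schwartz: "schwartz (u j)" for j
    unfolding u_eq by (rule schwartz_coherent_state[OF _ v_decay H(1)])
      (simp add: v_def smooth_cmult w_smooth)
  have Tu: "T j (u j) \<in> L2" for j
    using T[of j] schwartz_L2[OF u_schwartz] by (auto simp: bounded_L2_extension_def)
  have Tu_ae: "AE x in lborel. T j (u j) x =
      coherent_state (\<lambda>s. \<gamma> j * \<alpha> j * q j s) (fst (z j)) (snd (z j)) (H j) x" for j
  proof -
    have eq: "(\<lambda>x. c (H j) ((fst (z j), snd (z j)) + sqrt (H j) *\<^sub>R x)) = (\<lambda>x. \<gamma> j * E j x)"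
      using \<gamma>[of j] by (simp add: E_def normalized_symbol_def \<gamma>_def fun_eq_iff)
    have "quantize t 1 (\<lambda>x. \<gamma> j * E j x) (v j) = (\<lambda>s. \<gamma> j * \<alpha> j * q j s)"
      by (simp add: v_def q_def quantize_cmult fun_eq_iff)
    then have "quantize t (H j) (c (H j)) (u j) = coherent_state (\<lambda>s. \<gamma> j * \<alpha> j * q j s) (fst (z j)) (snd (z j)) (H j)"
      unfolding u_eq quantize_coherent_state[OF H(1)] eq by simp
    then show ?thesis
      using T[of j] u_schwartz[of j] by (auto simp: bounded_L2_extension_def)
  qed
  have "\<exists>g. \<forall>j. g j \<in> borel_measurable lborel \<and> (AE s in lborel. g j s = (cmod (\<gamma> j * \<alpha> j * q j s))\<^sup>2) \<and>
    (\<integral>\<^sup>+s. ennreal (g j s) \<partial>lborel) = ennreal ((L2_norm (T j (u j)))\<^sup>2)"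
    by (rule choice, rule allI, rule L2_rescaled_profile[OF Tu H(1) Tu_ae])
  then obtain g where g: "\<And>j. g j \<in> borel_measurable lborel"
    "\<And>j. AE s in lborel. g j s = (cmod (\<gamma> j * \<alpha> j * q j s))\<^sup>2"
    "\<And>j. (\<integral>\<^sup>+s. ennreal (g j s) \<partial>lborel) = ennreal ((L2_norm (T j (u j)))\<^sup>2)"
    by blast
  \<comment> \<open>Dividing out the scalars leaves the densities
    \<open>(cmod (q j s))\<^sup>2\<close>, whose pointwise limit is
    \<open>(cmod (\<phi> s))\<^sup>2\<close>.\<close>
  define k where "k j = 1 / (cmod (\<gamma> j * \<alpha> j))\<^sup>2" for j
  have k: "0 < k j" for j
    using \<alpha>[of j] \<gamma>[of j] by (simp add: k_def)
  have "\<phi> s0 = 0"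
  proof (rule zero_if_L2_limit_zero[OF schwartz_continuous[OF \<phi>(1)] q_lim])
    show "(\<lambda>s. k j * g j s) \<in> borel_measurable lborel" for j
      using g(1) by auto
    show "AE s in lborel. k j * g j s = (cmod (q j s))\<^sup>2" for j
      using g(2)[of j]
    proof eventually_elim
      case (elim s)
      then show ?case
        using \<alpha>[of j] \<gamma>[of j] by (simp add: k_def norm_mult power_mult_distrib)
    qed
    have int: "(\<integral>\<^sup>+s. ennreal (k j * g j s) \<partial>lborel) = ennreal (k j * (L2_norm (T j (u j)))\<^sup>2)" for j
    proof -
      have [measurable]: "g j \<in> borel_measurable borel"
        using g(1) by simp
      have "(\<integral>\<^sup>+s. ennreal (k j * g j s) \<partial>lborel) = (\<integral>\<^sup>+s. ennreal (k j) * ennreal (g j s) \<partial>lborel)"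
        using k[of j] by (intro nn_integral_cong) (simp add: ennreal_mult')
      also have "\<dots> = ennreal (k j) * ennreal ((L2_norm (T j (u j)))\<^sup>2)"
        by (subst nn_integral_cmult) (auto simp: g(3))
      finally show ?thesis
        using k[of j] by (simp add: ennreal_mult')
    qed
    have "(\<lambda>j. k j * (L2_norm (T j (u j)))\<^sup>2) \<longlonglongrightarrow> 0"
    proof (rule Lim_null_comparison)
      have "(\<lambda>j. (D / e * H j)\<^sup>2) \<longlonglongrightarrow> (D / e * 0)\<^sup>2"
        by (intro tendsto_intros H(4))
      then show "(\<lambda>j. (D / e * H j)\<^sup>2) \<longlonglongrightarrow> 0" by simp
      show "\<forall>\<^sub>F j in sequentially. norm (k j * (L2_norm (T j (u j)))\<^sup>2) \<le> (D / e * H j)\<^sup>2"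
        using small
      proof eventually_elim
        case (elim j)
        have L2_nonneg: "0 \<le> L2_norm (T j (u j))"
          unfolding L2_norm_def by (intro real_sqrt_ge_zero Bochner_Integration.integral_nonneg) auto
        have lower': "e * H j ^ N \<le> cmod (\<gamma> j * \<alpha> j)"
          unfolding norm_mult \<gamma>_def \<alpha>_def using e HN_pos[of j] lower[of j] by (intro mult_mono) auto
        have "L2_norm (T j (u j)) / cmod (\<gamma> j * \<alpha> j) \<le> (D * H j ^ Suc N) / (e * H j ^ N)"
          using elim lower' L2_nonneg e(1) HN_pos[of j] by (intro frac_le) auto
        also have "\<dots> = D / e * H j"
          using HN_pos[of j] by simp
        finally have "(L2_norm (T j (u j)) / cmod (\<gamma> j * \<alpha> j))\<^sup>2 \<le> (D / e * H j)\<^sup>2"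
          using L2_nonneg by (intro power_mono) auto
        then show ?case by (simp add: k_def power_divide)
      qed
    qed
    then have "(\<lambda>j. ennreal (k j * (L2_norm (T j (u j)))\<^sup>2)) \<longlonglongrightarrow> ennreal 0"
      by (intro tendsto_intros)
    then show "(\<lambda>j. \<integral>\<^sup>+s. ennreal (k j * g j s) \<partial>lborel) \<longlonglongrightarrow> 0"
      by (simp add: int)
  qed
  with \<phi>(2) show False by simp
qed

end

theorem theorem1:
  fixes a :: "real \<Rightarrow> (real^'n) \<times> (real^'n) \<Rightarrow> complex"
    and h0 \<delta> :: real
    and x0 \<xi>0 :: "real^'n"
  assumes "0 < h0"
    and "0 \<le> \<delta>" and "\<delta> < 1 / 2"
    and "a \<in> symbol_class h0 \<delta>"
    and "(x0, \<xi>0) \<in> ess_supp a"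
  shows "\<exists>(X :: real \<Rightarrow> real^'n) (\<Xi> :: real \<Rightarrow> real^'n).
           \<forall>\<phi> :: real^'n \<Rightarrow> complex.
             schwartz \<phi> \<and> (\<exists>x. \<phi> x \<noteq> 0) \<and>
             (\<forall>\<xi>. fourier 1 \<phi> \<xi> \<in> \<real>\<^sub>\<ge>\<^sub>0) \<and>
             compact (closure {\<xi>. fourier 1 \<phi> \<xi> \<noteq> 0}) \<longrightarrow>
             (\<forall>t\<in>{0..1}. (x0, \<xi>0) \<in>
                wavefront_set h0 t (\<lambda>h. quantize 1 h (a h) (coherent_state \<phi> (X h) (\<Xi> h) h)))"
proof -
  \<comment> \<open>The midpoint lies strictly between \<open>\<delta>\<close> and
    \<open>1 / 2\<close> and is positive even for \<open>\<delta> = 0\<close>.\<close>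
  define \<kappa> where "\<kappa> = (\<delta> + 1 / 2) / 2"
  have \<kappa>: "\<delta> < \<kappa>" "\<kappa> < 1 / 2" "0 < \<kappa>"
    using assms by (auto simp: \<kappa>_def)
  \<comment> \<open>The distance to the given point shrinks with \<open>k\<close>, and the exponent
    \<open>N\<close> is allowed to depend on \<open>k\<close>.\<close>
  let ?P = "\<lambda>N k h z'. h < h0 \<and> h < 1 \<and> norm (z' - (x0, \<xi>0)) < 1 / real (Suc k) \<and> h ^ N \<le> cmod (a h z') \<and>
    (\<forall>z. cmod (a h z) \<le> exp (norm (z - z') / h powr \<kappa>) * cmod (a h z'))"
  have "\<forall>k. \<exists>N. \<exists>\<^sub>F h in at_right 0. \<exists>z'. ?P N k h z'"
    by (rule allI, rule ess_supp_peak[OF assms(1,3,4,5) _ \<kappa>(3)]) simp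
  from choice[OF this] obtain N where N: "\<forall>k. \<exists>\<^sub>F h in at_right 0. \<exists>z'. ?P (N k) k h z'" ..
  \<comment> \<open>The family \<open>Z\<close> is fixed before \<open>\<phi>\<close>,
    \<open>t\<close> and \<open>c\<close> are introduced, which gives its independence of
    them.\<close>
  have "\<exists>Z. \<forall>k. \<exists>H. (\<forall>j. 0 < H j \<and> ?P (N k) k (H j) (Z (H j))) \<and> H \<longlonglongrightarrow> 0"
    by (rule diagonal_selection, rule N[rule_format])
  then obtain Z where Z: "\<forall>k. \<exists>H. (\<forall>j. 0 < H j \<and> ?P (N k) k (H j) (Z (H j))) \<and> H \<longlonglongrightarrow> 0" ..
  show ?thesis
  proof (rule exI[of _ "\<lambda>h. fst (Z h)"], rule exI[of _ "\<lambda>h. snd (Z h)"], intro allI impI ballI)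
    fix \<phi> :: "real^'n \<Rightarrow> complex" and t :: real
    assume \<phi>: "schwartz \<phi> \<and> (\<exists>x. \<phi> x \<noteq> 0) \<and> (\<forall>\<xi>. fourier 1 \<phi> \<xi> \<in> \<real>\<^sub>\<ge>\<^sub>0) \<and>
             compact (closure {\<xi>. fourier 1 \<phi> \<xi> \<noteq> 0})" and t: "t \<in> {0..1}"
    define u where "u h = quantize 1 h (a h) (coherent_state \<phi> (fst (Z h)) (snd (Z h)) h)" for h
    obtain s0 where s0: "\<phi> s0 \<noteq> 0"
      using \<phi> by blast
    obtain R where R: "0 < R" "\<And>\<xi>. \<xi> \<in> closure {\<xi>. fourier 1 \<phi> \<xi> \<noteq> 0} \<Longrightarrow> norm \<xi> \<le> R"
      using \<phi> compact_imp_bounded bounded_pos by metis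
    have supp: "fourier 1 \<phi> \<xi> = 0" if "R < norm \<xi>" for \<xi>
      using R(2)[of \<xi>] that closure_subset[of "{\<xi>. fourier 1 \<phi> \<xi> \<noteq> 0}"] by force
    have False
      if c: "c \<in> symbol_class h0 0" and pos: "(INF h\<in>{0<..<h0}. cmod (c h (x0, \<xi>0))) > 0"
        and T: "\<And>h. h \<in> {0<..<h0} \<Longrightarrow> bounded_L2_extension (quantize t h (c h)) (T h)"
        and small: "\<And>N::nat. (\<lambda>h. L2_norm (T h (u h))) \<in> O[at_right 0](\<lambda>h. h ^ N)" for c T
    proof -
      \<comment> \<open>Half of the infimum is held in reserve for what may be lost between the
        given point and a nearby peak.\<close>
      define e where "e = (INF h\<in>{0<..<h0}. cmod (c h (x0, \<xi>0))) / 2"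
      have e: "0 < e"
        using pos by (simp add: e_def)
      have c_z0: "2 * e \<le> cmod (c h (x0, \<xi>0))" if "h \<in> {0<..<h0}" for h
        unfolding e_def using that by (auto intro!: cINF_lower bdd_belowI2[of _ 0])
      obtain C where C: "0 \<le> C" "\<forall>bs\<in>lists Basis. length bs \<le> 1 \<longrightarrow> (\<forall>h\<in>{0<..<h0}. \<forall>z.
        cmod (partial_derivs bs (c h) z) \<le> C * h powr (- 0 * real (length bs)))"
        using symbol_class_bound[OF c, of 1] by blast
      define Lc where "Lc = real DIM((real^'n) \<times> (real^'n)) * C"
      have lip: "cmod (c h z - c h z') \<le> Lc * norm (z - z')" if h: "h \<in> {0<..<h0}" for h z z'
        unfolding Lc_def
      proof (rule smooth_lipschitz[OF symbol_class_smooth[OF c h] convex_UNIV])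
        show "cmod (partial_deriv b (c h) w) \<le> C" if "b \<in> Basis" for b w
          using C(2)[rule_format, of "[b]" h w] that h by simp
      qed auto
      have "0 \<le> Lc"
        using C(1) by (simp add: Lc_def)
      \<comment> \<open>This \<open>k\<close> depends on \<open>c\<close>: over the distance
        \<open>1 / Suc k\<close> the symbol varies by at most \<open>e\<close>. It also selects the
        exponent \<open>N k\<close>.\<close>
      obtain k where k: "Lc / e < real k"
        using reals_Archimedean2 by blast
      from Z[THEN spec, of k] obtain H where H0: "(\<forall>j. 0 < H j \<and> ?P (N k) k (H j) (Z (H j))) \<and> H \<longlonglongrightarrow> 0" ..
      note H = H0[THEN conjunct1, rule_format, THEN conjunct1] H0[THEN conjunct1, THEN spec, THEN conjunct2]
        H0[THEN conjunct2]
      have HP: "H j < h0" "H j < 1" and near: "norm (Z (H j) - (x0, \<xi>0)) < 1 / real (Suc k)"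
        and HP': "H j ^ N k \<le> cmod (a (H j) (Z (H j)))"
          "cmod (a (H j) z) \<le> exp (norm (z - Z (H j)) / H j powr \<kappa>) * cmod (a (H j) (Z (H j)))" for j z
        using H(2)[of j] by blast+
      interpret peak_sequence a h0 \<delta> \<kappa> H "\<lambda>j. Z (H j)" "N k"
        by unfold_locales (rule assms \<kappa> H HP HP')+
      have elliptic: "e \<le> cmod (c (H j) (Z (H j)))" for j
      proof -
        have "Lc * norm (Z (H j) - (x0, \<xi>0)) \<le> Lc * (1 / real (Suc k))"
          using \<open>0 \<le> Lc\<close> by (intro mult_left_mono less_imp_le[OF near])
        also have "\<dots> \<le> e"
          using k e by (simp add: field_simps)
        finally have "cmod (c (H j) (Z (H j)) - c (H j) (x0, \<xi>0)) \<le> e"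
          using lip[OF H_mem, of j "Z (H j)" "(x0, \<xi>0)"] by linarith
        then show ?thesis
          using c_z0[OF H_mem, of j] norm_triangle_ineq3[of "c (H j) (Z (H j))" "c (H j) (x0, \<xi>0)"] by linarith
      qed
      \<comment> \<open>Decay of order \<open>N k + 1\<close>, one more than the exponent in the
        lower bound along this sequence, produces the contradiction.\<close>
      obtain D where D: "\<forall>\<^sub>F h in at_right 0. norm (L2_norm (T h (u h))) \<le> D * norm (h ^ Suc (N k))"
        using landau_o.bigE[OF small[of "Suc (N k)"]] by blast
      have "filterlim H (at_right 0) sequentially"
        using H(1,4) by (auto simp: filterlim_at intro!: always_eventually less_imp_neq[symmetric])
      from eventually_compose_filterlim[OF D this]
      have "\<forall>\<^sub>F j in sequentially. L2_norm (T (H j) (u (H j))) \<le> D * H j ^ Suc (N k)"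
        by eventually_elim (use H(1) in \<open>auto simp: abs_of_pos\<close>)
      then show False
        unfolding u_def
        by (intro not_negligible_near_elliptic[where c = c and T = "\<lambda>j. T (H j)" and \<phi> = \<phi> and t = t and D = D, 
              OF _ s0 less_imp_le[OF R(1)] supp c e elliptic T[OF H_mem]])
          (use \<phi> t in auto)
    qed
    then show "(x0, \<xi>0) \<in> wavefront_set h0 t (\<lambda>h. quantize 1 h (a h) (coherent_state \<phi> (fst (Z h)) (snd (Z h)) h))"
      unfolding wavefront_set_def u_def by blast
  qed
qed

end
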